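(* Let $W$ be a finite irreducible Coxeter group of type $A$, $B$, $C$, $H_3$ or of rank 2. Then $H_{W,x}=M_{W,x}$, i.e. $H_{W,x}(w)=M_{W,x}(w)$ for all $w\in W$ and all real $x\neq 0$.
   Context: $W$ is a finite Coxeter group of rank $n$ acting on its $n$-dimensional real reflection representation $V$, with (reduced, $W$-stable) root system and base $\Pi$ of simple roots. $Des(w)=\{\alpha\in\Pi: w(\alpha)\text{ is a negative root}\}$. On subsets of $\Pi$ put $J\sim K$ iff $w(J)=K$ for some $w\in W$; $\lambda$ denotes an equivalence class, $\lambda(K)$ the class of $K$, $|\lambda|$ the number of subsets in $\lambda$, and $\|\lambda\|=|J|$ for any $J\in\lambda$. Definition of $M_{W,x}$: for $J\subseteq\Pi$ let $X_J=\{w\in W: Des(w)\cap J=\emptyset\}$ and $x_J=\sum_{w\in X_J}w$. For $K\subseteq J\subseteq\Pi$ let $\mu_K^J=\frac{|\{w\in X_J:w(K)\subseteq\Pi\}|}{|\lambda(K)|}$, and $\mu_K^J=0$ if $K\not\subseteq J$. Let $(\beta_K^J)$ be the inverse of the matrix $(\mu_K^J)$ (rows indexed by $J$, columns by $K$), $e_\lambda=\frac1{|\lambda|}\sum_{J\in\lambda}\sum_{K\subseteq J}\beta_K^Jx_K$, and $M_{W,x}=\sum_\lambda e_\lambda/x^{\|\lambda\|}$ in $\mathbb{R}[W]$; $M_{W,x}(w)$ is the coefficient of $w$. Definition of $H_{W,x}$: let $L$ be the set of all intersections of root hyperplanes (including $V$), partially ordered by reverse inclusion, with Möbius function $\mu$;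 for $X\in L$, $L^X=\{Y\in L:Y\ge X\}$ and $\chi(L^X,x)=\sum_{Y\ge X}\mu(X,Y)x^{\dim Y}$. For $K\subseteq\Pi$, $W_K$ is the parabolic subgroup generated by the reflections in the roots of $K$, $Fix(W_K)$ its fixed space in $V$, $N_W(W_K)$ its normalizer in $W$. Then $$H_{W,x}(w)=\sum_{K\subseteq\Pi-Des(w)}\frac{|W_K|\chi(L^{Fix(W_K)},x)}{x^n|N_W(W_K)||\lambda(K)|}.$$ *)

theory Defs
  imports "HOL-Analysis.Analysis" "HOL-Algebra.Group_Action" "HOL-Algebra.Multiplicative_Group"
begin

text \<open>
  A finite Coxeter group is given by its reflection representation: a root system \<open>\<Phi>\<close> spanning a
  Euclidean space \<open>V\<close> (a type of class \<open>euclidean_space\<close>, with a group-invariant inner product), not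
  necessarily crystallographic and with unrestricted root lengths. Group elements are functions
  \<open>V \<Rightarrow> V\<close> inside the group \<open>BijGroup UNIV\<close> of all bijections of \<open>V\<close>. Elements of the group
  algebra over the reals are represented by their coefficient functions.
\<close>

section \<open>Reflection groups and root systems\<close>

definition root_refl :: "'a::euclidean_space \<Rightarrow> 'a \<Rightarrow> 'a"
  where "root_refl \<alpha> v = v - (2 * (v \<bullet> \<alpha>) / (\<alpha> \<bullet> \<alpha>)) *\<^sub>R \<alpha>"

definition root_system :: "'a::euclidean_space set \<Rightarrow> bool"
  where "root_system \<Phi> \<longleftrightarrow>
    finite \<Phi> \<and> 0 \<notin> \<Phi> \<and> span \<Phi> = UNIV \<and>
    (\<forall>\<alpha>\<in>\<Phi>. root_refl \<alpha> ` \<Phi> = \<Phi>) \<and>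
    (\<forall>\<alpha>\<in>\<Phi>. \<Phi> \<inter> span {\<alpha>} = {\<alpha>, - \<alpha>})"

definition nonneg_comb :: "'a::euclidean_space set \<Rightarrow> 'a \<Rightarrow> bool"
  where "nonneg_comb \<Delta> v \<longleftrightarrow> (\<exists>c. (\<forall>\<alpha>\<in>\<Delta>. 0 \<le> c \<alpha>) \<and> v = (\<Sum>\<alpha>\<in>\<Delta>. c \<alpha> *\<^sub>R \<alpha>))"

definition root_base :: "'a::euclidean_space set \<Rightarrow> 'a set \<Rightarrow> bool"
  where "root_base \<Phi> \<Delta> \<longleftrightarrow>
    \<Delta> \<subseteq> \<Phi> \<and> independent \<Delta> \<and> span \<Delta> = UNIV \<and>
    (\<forall>\<beta>\<in>\<Phi>. nonneg_comb \<Delta> \<beta> \<or> nonneg_comb \<Delta> (- \<beta>))"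

definition negative_roots :: "'a::euclidean_space set \<Rightarrow> 'a set \<Rightarrow> 'a set"
  where "negative_roots \<Phi> \<Delta> = {\<beta>\<in>\<Phi>. nonneg_comb \<Delta> (- \<beta>)}"

definition refl_group :: "'a::euclidean_space set \<Rightarrow> ('a \<Rightarrow> 'a) monoid"
  where "refl_group A = subgroup_generated (BijGroup UNIV) (root_refl ` A)"

abbreviation refl_elems :: "'a::euclidean_space set \<Rightarrow> ('a \<Rightarrow> 'a) set"
  where "refl_elems A \<equiv> carrier (refl_group A)"

section \<open>Coxeter matrix, irreducibility and types\<close>

definition coxeter_m :: "'a::euclidean_space \<Rightarrow> 'a \<Rightarrow> nat"
  where "coxeter_m \<alpha> \<beta> = group.ord (BijGroup UNIV) (root_refl \<alpha> \<circ> root_refl \<beta>)"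

text \<open>Irreducibility: the Coxeter graph, with an edge where the entry of the Coxeter matrix
  exceeds 2, is nonempty and connected.\<close>

definition irreducible_base :: "'a::euclidean_space set \<Rightarrow> bool"
  where "irreducible_base \<Delta> \<longleftrightarrow> \<Delta> \<noteq> {} \<and>
    (\<forall>A B. A \<union> B = \<Delta> \<and> A \<inter> B = {} \<and> A \<noteq> {} \<and> B \<noteq> {} \<longrightarrow>
      (\<exists>\<alpha>\<in>A. \<exists>\<beta>\<in>B. coxeter_m \<alpha> \<beta> \<noteq> 2))"

definition has_coxeter_matrix :: "'a::euclidean_space set \<Rightarrow> (nat \<Rightarrow> nat \<Rightarrow> nat) \<Rightarrow> bool"
  where "has_coxeter_matrix \<Delta> m \<longleftrightarrow>
    (\<exists>a. bij_betw a {..<card \<Delta>} \<Delta> \<and>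
      (\<forall>i<card \<Delta>. \<forall>j<card \<Delta>. coxeter_m (a i) (a j) = m i j))"

definition matrix_A :: "nat \<Rightarrow> nat \<Rightarrow> nat"
  where "matrix_A i j = (if i = j then 1 else if Suc i = j \<or> Suc j = i then 3 else 2)"

definition matrix_BC :: "nat \<Rightarrow> nat \<Rightarrow> nat \<Rightarrow> nat"
  where "matrix_BC n i j = (if {i, j} = {n - 2, n - 1} then 4 else matrix_A i j)"

definition matrix_H3 :: "nat \<Rightarrow> nat \<Rightarrow> nat"
  where "matrix_H3 i j = (if {i, j} = {0, 1} then 5 else matrix_A i j)"

definition type_A :: "'a::euclidean_space set \<Rightarrow> bool"
  where "type_A \<Delta> \<longleftrightarrow> has_coxeter_matrix \<Delta> matrix_A"

text \<open>Types B and C have the same Coxeter matrix; they differ only in the relative lengths of the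
  roots of a crystallographic root system, which are not constrained here.\<close>

definition type_B :: "'a::euclidean_space set \<Rightarrow> bool"
  where "type_B \<Delta> \<longleftrightarrow> 2 \<le> card \<Delta> \<and> has_coxeter_matrix \<Delta> (matrix_BC (card \<Delta>))"

definition type_C :: "'a::euclidean_space set \<Rightarrow> bool"
  where "type_C \<Delta> \<longleftrightarrow> 2 \<le> card \<Delta> \<and> has_coxeter_matrix \<Delta> (matrix_BC (card \<Delta>))"

definition type_H3 :: "'a::euclidean_space set \<Rightarrow> bool"
  where "type_H3 \<Delta> \<longleftrightarrow> card \<Delta> = 3 \<and> has_coxeter_matrix \<Delta> matrix_H3"

section \<open>Descents and conjugacy of sets of simple roots\<close>

definition Des :: "'a::euclidean_space set \<Rightarrow> 'a set \<Rightarrow> ('a \<Rightarrow> 'a) \<Rightarrow> 'a set"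
  where "Des \<Phi> \<Delta> w = {\<alpha>\<in>\<Delta>. w \<alpha> \<in> negative_roots \<Phi> \<Delta>}"

definition base_conj :: "'a::euclidean_space set \<Rightarrow> 'a set \<Rightarrow> ('a set \<times> 'a set) set"
  where "base_conj \<Phi> \<Delta> = {(J, K). J \<subseteq> \<Delta> \<and> K \<subseteq> \<Delta> \<and> (\<exists>w\<in>refl_elems \<Phi>. w ` J = K)}"

definition conj_class :: "'a::euclidean_space set \<Rightarrow> 'a set \<Rightarrow> 'a set \<Rightarrow> 'a set set"
  where "conj_class \<Phi> \<Delta> K = base_conj \<Phi> \<Delta> `` {K}"

definition conj_classes :: "'a::euclidean_space set \<Rightarrow> 'a set \<Rightarrow> 'a set set set"
  where "conj_classes \<Phi> \<Delta> = Pow \<Delta> // base_conj \<Phi> \<Delta>"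

definition class_rank :: "'a set set \<Rightarrow> nat"
  where "class_rank \<Lambda> = (THE k. \<forall>J\<in>\<Lambda>. card J = k)"

section \<open>The measure M\<close>

definition X_set :: "'a::euclidean_space set \<Rightarrow> 'a set \<Rightarrow> 'a set \<Rightarrow> ('a \<Rightarrow> 'a) set"
  where "X_set \<Phi> \<Delta> J = {w \<in> refl_elems \<Phi>. Des \<Phi> \<Delta> w \<inter> J = {}}"

definition x_elem :: "'a::euclidean_space set \<Rightarrow> 'a set \<Rightarrow> 'a set \<Rightarrow> ('a \<Rightarrow> 'a) \<Rightarrow> real"
  where "x_elem \<Phi> \<Delta> J = indicat_real (X_set \<Phi> \<Delta> J)"

text \<open>The superscript is the first index (row), the subscript the second (column).\<close>

definition mu_coeff :: "'a::euclidean_space set \<Rightarrow> 'a set \<Rightarrow> 'a set \<Rightarrow> 'a set \<Rightarrow> real"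
  where "mu_coeff \<Phi> \<Delta> J K =
    (if K \<subseteq> J
     then real (card {w \<in> X_set \<Phi> \<Delta> J. w ` K \<subseteq> \<Delta>}) / real (card (conj_class \<Phi> \<Delta> K))
     else 0)"

text \<open>The inverse of a square matrix with rows and columns indexed by \<open>I\<close>, extended by 0 outside
  \<open>I\<close> to make it unique.\<close>

definition is_matrix_inverse_on :: "'i set \<Rightarrow> ('i \<Rightarrow> 'i \<Rightarrow> real) \<Rightarrow> ('i \<Rightarrow> 'i \<Rightarrow> real) \<Rightarrow> bool"
  where "is_matrix_inverse_on I A B \<longleftrightarrow>
    (\<forall>i j. i \<notin> I \<or> j \<notin> I \<longrightarrow> B i j = 0) \<and>
    (\<forall>i\<in>I. \<forall>j\<in>I. (\<Sum>k\<in>I. A i k * B k j) = (if i = j then 1 else 0)) \<and>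
    (\<forall>i\<in>I. \<forall>j\<in>I. (\<Sum>k\<in>I. B i k * A k j) = (if i = j then 1 else 0))"

definition matrix_inverse_on :: "'i set \<Rightarrow> ('i \<Rightarrow> 'i \<Rightarrow> real) \<Rightarrow> 'i \<Rightarrow> 'i \<Rightarrow> real"
  where "matrix_inverse_on I A = (THE B. is_matrix_inverse_on I A B)"

lemma is_matrix_inverse_on_unique:
  assumes "finite I" and B: "is_matrix_inverse_on I A B" and C: "is_matrix_inverse_on I A C"
  shows "B = C"
proof (intro ext)
  fix i j
  show "B i j = C i j"
  proof (cases "i \<in> I \<and> j \<in> I")
    case False
    then show ?thesis using B C by (auto simp: is_matrix_inverse_on_def)
  next
    case True
    then have i: "i \<in> I" and j: "j \<in> I" by auto
    have "B i j = (\<Sum>k\<in>I. B i k * (if k = j then 1 else 0))"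
      using \<open>finite I\<close> j by (simp add: if_distrib cong: if_cong)
    also have "\<dots> = (\<Sum>k\<in>I. B i k * (\<Sum>l\<in>I. A k l * C l j))"
      using C j by (intro sum.cong) (auto simp: is_matrix_inverse_on_def)
    also have "\<dots> = (\<Sum>k\<in>I. \<Sum>l\<in>I. B i k * A k l * C l j)"
      by (simp add: sum_distrib_left mult.assoc)
    also have "\<dots> = (\<Sum>l\<in>I. \<Sum>k\<in>I. B i k * A k l * C l j)"
      by (rule sum.swap)
    also have "\<dots> = (\<Sum>l\<in>I. (\<Sum>k\<in>I. B i k * A k l) * C l j)"
      by (simp add: sum_distrib_right)
    also have "\<dots> = (\<Sum>l\<in>I. (if i = l then 1 else 0) * C l j)"
      using B i by (intro sum.cong) (auto simp: is_matrix_inverse_on_def)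
    also have "\<dots> = (\<Sum>l\<in>I. if i = l then C l j else 0)"
      by (intro sum.cong) auto
    also have "\<dots> = C i j"
      using \<open>finite I\<close> i by simp
    finally show ?thesis .
  qed
qed

lemma matrix_inverse_on_eqI:
  assumes "finite I" "is_matrix_inverse_on I A B"
  shows "matrix_inverse_on I A = B"
  unfolding matrix_inverse_on_def
  using assms by (blast intro: the_equality is_matrix_inverse_on_unique)

definition beta_coeff :: "'a::euclidean_space set \<Rightarrow> 'a set \<Rightarrow> 'a set \<Rightarrow> 'a set \<Rightarrow> real"
  where "beta_coeff \<Phi> \<Delta> = matrix_inverse_on (Pow \<Delta>) (mu_coeff \<Phi> \<Delta>)"

definition e_elem :: "'a::euclidean_space set \<Rightarrow> 'a set \<Rightarrow> 'a set set \<Rightarrow> ('a \<Rightarrow> 'a) \<Rightarrow> real"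
  where "e_elem \<Phi> \<Delta> \<Lambda> w =
    (1 / real (card \<Lambda>)) * (\<Sum>J\<in>\<Lambda>. \<Sum>K\<in>Pow J. beta_coeff \<Phi> \<Delta> J K * x_elem \<Phi> \<Delta> K w)"

definition M_measure :: "'a::euclidean_space set \<Rightarrow> 'a set \<Rightarrow> real \<Rightarrow> ('a \<Rightarrow> 'a) \<Rightarrow> real"
  where "M_measure \<Phi> \<Delta> x w = (\<Sum>\<Lambda>\<in>conj_classes \<Phi> \<Delta>. e_elem \<Phi> \<Delta> \<Lambda> w / x ^ class_rank \<Lambda>)"

section \<open>The measure H\<close>

text \<open>The empty intersection is the whole space.\<close>

definition arrangement_lattice :: "'a::euclidean_space set \<Rightarrow> 'a set set"
  where "arrangement_lattice \<Phi> = (\<lambda>A. \<Inter>\<alpha>\<in>A. {v. \<alpha> \<bullet> v = 0}) ` Pow \<Phi>"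

text \<open>The Moebius function of a finite family of sets ordered by reverse inclusion. It vanishes
  unless \<open>Y \<subseteq> X\<close>, since the sum is then empty. Finiteness is tested only for termination.\<close>

function moebius :: "'a set set \<Rightarrow> 'a set \<Rightarrow> 'a set \<Rightarrow> int"
  where "moebius L X Y =
    (if X = Y then 1
     else if finite L then - (\<Sum>Z\<in>{Z\<in>L. Z \<subseteq> X \<and> Y \<subset> Z}. moebius L X Z)
     else 0)"
  by auto
termination
proof (relation "Wellfounded.measure (\<lambda>(L, X, Y). card {Z\<in>L. Y \<subset> Z})", goal_cases)
  case 1
  show ?case by simp
next
  case (2 L X Y Z)
  then have "{U\<in>L. Z \<subset> U} \<subset> {U\<in>L. Y \<subset> U}" by auto
  with 2 show ?case by (auto intro!: psubset_card_mono)
qed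

declare moebius.simps [simp del]

definition upper_char_poly :: "'a::euclidean_space set \<Rightarrow> 'a set \<Rightarrow> real \<Rightarrow> real"
  where "upper_char_poly \<Phi> X x =
    (let L = arrangement_lattice \<Phi>
     in \<Sum>Y\<in>{Y\<in>L. Y \<subseteq> X}. of_int (moebius L X Y) * x ^ dim Y)"

definition fix_space :: "('a \<Rightarrow> 'a) set \<Rightarrow> 'a set"
  where "fix_space U = {v. \<forall>u\<in>U. u v = v}"

definition H_measure :: "'a::euclidean_space set \<Rightarrow> 'a set \<Rightarrow> real \<Rightarrow> ('a \<Rightarrow> 'a) \<Rightarrow> real"
  where "H_measure \<Phi> \<Delta> x w =
    (\<Sum>K\<in>Pow (\<Delta> - Des \<Phi> \<Delta> w).
      (real (card (refl_elems K)) * upper_char_poly \<Phi> (fix_space (refl_elems K)) x) /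
      (x ^ DIM('a) * real (card (normalizer (refl_group \<Phi>) (refl_elems K))) *
        real (card (conj_class \<Phi> \<Delta> K))))"

end

theory Submission
  imports Defs
begin

text \<open>
  Write \<open>a(J, K)\<close> for the number of \<open>w\<close> that are positive on \<open>J\<close> and map \<open>K\<close> into \<open>\<Delta>\<close>. Since
  \<open>|N(W\<^sub>K)| |\<lambda>(K)| = |W\<^sub>K| a(K, K)\<close>, inverting the triangular matrix \<open>\<mu>\<close> turns \<open>H = M\<close> into the identities
  \<open>\<Sum>\<^bsub>J \<supseteq> K\<^esub> \<chi>\<^sub>J(x) a(J, K) / a(J, J) = x ^ (n - |K|)\<close>, where \<open>\<chi>\<^sub>J\<close> is the characteristic polynomial of the
  arrangement restricted to the common kernel of \<open>J\<close>.

  For every finite Coxeter group this holds after averaging over the \<open>K\<close> in a conjugacy class: after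
  exchanging \<open>K\<close> with its image under \<open>w\<close>, the pairs \<open>(J, w)\<close> enumerate the flats below the kernel of \<open>K\<close>
  with total weight one each, and the characteristic polynomials of these flats add up to a power of \<open>x\<close>
  by Moebius inversion. So it is enough that the left hand side is constant on conjugacy classes. It
  only depends on the restricted arrangement together with its fundamental chamber. In types A and B
  these are isomorphic for all \<open>K\<close> of equal cardinality. In rank at most 3 either \<open>K\<close> is empty, hence
  alone in its class, or the restricted arrangement has dimension at most 2, and then the numbers of
  chambers are determined by the existence of a unique chamber opposite to the fundamental one.
\<close>

section \<open>Groups generated by reflections\<close>

text \<open>The exchange of \<open>K\<close> with its image is what forces the averaging. One count
  runs over elements \<open>w\<close> that send a class member inside \<open>J\<close> into
  \<open>\<Delta>\<close>, the other over elements for which a fixed class member lies in the image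
  of \<open>J\<close>. The second can be evaluated for each class member by sorting pairs according
  to flats, the first is the one needed, and the exchange only matches their sums over the class.
  Invariance under conjugation therefore has to come from a separate argument. Chambers of
  restricted arrangements never occur as sets. A chamber is represented by a point of
  \<open>perp K\<close> on no restricted hyperplane, and \<open>adjacent\<close> attaches exactly
  one group element to such a point, so counting chambers becomes counting group elements.
  Characteristic polynomials are not computed from the lattice of flats. They are transported along
  isomorphisms, and for flats of dimension at most one they are read off from the averaged identity
  itself.\<close>

lemma root_refl_linear: "linear (root_refl \<alpha>)"
  unfolding root_refl_def
  by (rule linearI) (simp_all add: inner_add_left add_divide_distrib scaleR_add_left distrib_left
      scaleR_diff_right)

lemma root_refl_self: "\<alpha> \<noteq> 0 \<Longrightarrow> root_refl \<alpha> \<alpha> = - \<alpha>"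
  by (simp add: root_refl_def scaleR_2)

lemma root_refl_fix: "v \<bullet> \<alpha> = 0 \<Longrightarrow> root_refl \<alpha> v = v"
  by (simp add: root_refl_def)

lemma root_refl_inner: "root_refl \<alpha> u \<bullet> root_refl \<alpha> v = u \<bullet> v"
proof (cases "\<alpha> = 0")
  case False
  define c where "c = 2 * (u \<bullet> \<alpha>) / (\<alpha> \<bullet> \<alpha>)"
  define d where "d = 2 * (v \<bullet> \<alpha>) / (\<alpha> \<bullet> \<alpha>)"
  have c: "2 * (u \<bullet> \<alpha>) = c * (\<alpha> \<bullet> \<alpha>)" and d: "2 * (v \<bullet> \<alpha>) = d * (\<alpha> \<bullet> \<alpha>)"
    using False by (simp_all add: c_def d_def)
  have "root_refl \<alpha> u \<bullet> root_refl \<alpha> v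
      = u \<bullet> v - d * (u \<bullet> \<alpha>) - c * (v \<bullet> \<alpha>) + c * d * (\<alpha> \<bullet> \<alpha>)"
    unfolding root_refl_def c_def[symmetric] d_def[symmetric]
    by (simp add: inner_diff_left inner_diff_right inner_commute[of \<alpha> v] algebra_simps)
  \<comment> \<open>Each cross term is half of \<open>c * d * (\<alpha> \<bullet> \<alpha>)\<close>,
    so the two together cancel the last term.\<close>
  moreover have "d * (2 * (u \<bullet> \<alpha>)) = d * (c * (\<alpha> \<bullet> \<alpha>))" "c * (2 * (v \<bullet> \<alpha>)) = c * (d * (\<alpha> \<bullet> \<alpha>))"
    by (simp_all only: c d)
  ultimately show ?thesis by (simp only: mult.assoc mult.left_commute[of d] mult.left_commute[of _ 2])
qed (simp add: root_refl_def)

lemma root_refl_idem: "root_refl \<alpha> (root_refl \<alpha> v) = v"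
proof (cases "\<alpha> = 0")
  case False
  then have "\<alpha> \<bullet> \<alpha> \<noteq> 0" by simp
  then show ?thesis
    by (simp add: root_refl_def inner_diff_left)
qed (simp add: root_refl_def)

lemma root_refl_comp_self: "root_refl \<alpha> \<circ> root_refl \<alpha> = id"
  by (simp add: fun_eq_iff root_refl_idem)

lemma root_refl_scale: "c \<noteq> 0 \<Longrightarrow> root_refl (c *\<^sub>R \<alpha>) = root_refl \<alpha>"
  by (simp add: root_refl_def fun_eq_iff)

lemma root_refl_conj:
  assumes "linear w" "\<And>u v. w u \<bullet> w v = u \<bullet> v"
  shows "w (root_refl \<alpha> v) = root_refl (w \<alpha>) (w v)"
  by (simp add: root_refl_def linear_diff[OF assms(1)] linear_scale[OF assms(1)] assms(2))

section \<open>Elements of a reflection group as words in reflections\<close>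

lemma BijGroup_UNIV_simps [simp]:
  "carrier (BijGroup UNIV) = {f. bij f}"
  "\<one>\<^bsub>BijGroup UNIV\<^esub> = id"
  "bij f \<Longrightarrow> bij g \<Longrightarrow> f \<otimes>\<^bsub>BijGroup UNIV\<^esub> g = f \<circ> g"
  by (auto simp: BijGroup_def Bij_def restrict_def compose_def fun_eq_iff)

lemma BijGroup_UNIV_inv:
  assumes "bij f"
  shows "inv\<^bsub>BijGroup UNIV\<^esub> f = inv_into UNIV f"
proof -
  interpret group "BijGroup UNIV" by (rule group_BijGroup)
  show ?thesis
    by (rule inv_equality) (use assms in \<open>auto simp: bij_imp_bij_inv fun_eq_iff bij_is_inj\<close>)
qed

lemma root_refl_bij: "bij (root_refl \<alpha>)"
  using root_refl_idem by (metis involuntory_imp_bij)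

lemma root_refl_inv: "inv_into UNIV (root_refl \<alpha>) = root_refl \<alpha>"
  by (rule inv_unique_comp) (simp_all add: root_refl_comp_self)

abbreviation winv :: "('a \<Rightarrow> 'a) \<Rightarrow> 'a \<Rightarrow> 'a"
  where "winv \<equiv> inv_into UNIV"

definition refl_word :: "'a::euclidean_space list \<Rightarrow> 'a \<Rightarrow> 'a"
  where "refl_word as = foldr (\<lambda>\<alpha> f. root_refl \<alpha> \<circ> f) as id"

lemma refl_word_simps [simp]:
  "refl_word [] = id"
  "refl_word (\<alpha> # as) = root_refl \<alpha> \<circ> refl_word as"
  by (simp_all add: refl_word_def)

lemma refl_word_append: "refl_word (as @ bs) = refl_word as \<circ> refl_word bs"
  by (induction as) (auto simp: comp_assoc)

lemma refl_word_bij: "bij (refl_word as)"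
  by (induction as) (simp_all only: refl_word_simps bij_id bij_comp root_refl_bij)

lemma refl_word_linear: "linear (refl_word as)"
  by (induction as) (simp_all only: refl_word_simps linear_id linear_compose root_refl_linear)

lemma refl_word_inner: "refl_word as u \<bullet> refl_word as v = u \<bullet> v"
  by (induction as) (auto simp: root_refl_inner)

text \<open>Reflections are their own inverses, so the generated subgroup needs no inverse letters,
  and facts about its elements follow by list induction.\<close>

lemma refl_elems_iff: "w \<in> refl_elems A \<longleftrightarrow> (\<exists>as. set as \<subseteq> A \<and> w = refl_word as)"
proof
  assume "w \<in> refl_elems A"
  then have "w \<in> generate (BijGroup UNIV) (root_refl ` A)"
    by (simp add: refl_group_def carrier_subgroup_generated Int_absorb1 image_subset_iff root_refl_bij)
  then show "\<exists>as. set as \<subseteq> A \<and> w = refl_word as"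
  proof induction
    case one
    show ?case by (rule exI[of _ "[]"]) simp
  next
    case (incl h)
    then obtain \<alpha> where "\<alpha> \<in> A" "h = root_refl \<alpha>" by auto
    then show ?case by (intro exI[of _ "[\<alpha>]"]) simp
  next
    case (inv h)
    then obtain \<alpha> where "\<alpha> \<in> A" "h = root_refl \<alpha>" by auto
    then show ?case
      by (intro exI[of _ "[\<alpha>]"]) (simp add: BijGroup_UNIV_inv root_refl_bij root_refl_inv)
  next
    case (eng h1 h2)
    then obtain as bs where "set as \<subseteq> A" "h1 = refl_word as" "set bs \<subseteq> A" "h2 = refl_word bs" by auto
    then show ?case
      by (intro exI[of _ "as @ bs"]) (simp add: refl_word_append refl_word_bij)
  qed
next
  assume "\<exists>as. set as \<subseteq> A \<and> w = refl_word as"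
  then obtain as where as: "set as \<subseteq> A" "w = refl_word as" by auto
  have "refl_word as \<in> generate (BijGroup UNIV) (root_refl ` A)" using as(1)
  proof (induction as)
    case Nil
    show ?case
      using generate.one[of "BijGroup UNIV"] by (simp only: BijGroup_UNIV_simps refl_word_simps)
  next
    case (Cons \<alpha> as)
    then have "root_refl \<alpha> \<otimes>\<^bsub>BijGroup UNIV\<^esub> refl_word as \<in> generate (BijGroup UNIV) (root_refl ` A)"
      by (intro generate.eng[OF generate.incl[OF imageI]]) auto
    then show ?case
      by (simp only: BijGroup_UNIV_simps(3) root_refl_bij refl_word_bij refl_word_simps)
  qed
  then show "w \<in> refl_elems A"
    by (simp add: as refl_group_def carrier_subgroup_generated Int_absorb1 image_subset_iff root_refl_bij)
qed

lemma refl_elems_refl: "\<alpha> \<in> A \<Longrightarrow> root_refl \<alpha> \<in> refl_elems A"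
  unfolding refl_elems_iff by (rule exI[of _ "[\<alpha>]"]) simp

lemma refl_elems_id: "id \<in> refl_elems A"
  unfolding refl_elems_iff by (rule exI[of _ "[]"]) simp

lemma refl_elems_comp: "v \<in> refl_elems A \<Longrightarrow> w \<in> refl_elems A \<Longrightarrow> v \<circ> w \<in> refl_elems A"
  unfolding refl_elems_iff by (metis refl_word_append set_append Un_least)

lemma refl_elems_mono: "A \<subseteq> B \<Longrightarrow> refl_elems A \<subseteq> refl_elems B"
  unfolding subset_iff refl_elems_iff by blast

lemma refl_elems_bij: "w \<in> refl_elems A \<Longrightarrow> bij w"
  by (auto simp: refl_elems_iff refl_word_bij)

lemma refl_elems_linear: "w \<in> refl_elems A \<Longrightarrow> linear w"
  by (auto simp: refl_elems_iff refl_word_linear)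

lemma refl_elems_neg: "w \<in> refl_elems A \<Longrightarrow> w (- v) = - w v"
  by (rule linear_neg[OF refl_elems_linear])

lemma refl_elems_inj_on: "w \<in> refl_elems A \<Longrightarrow> inj_on w S"
  by (rule inj_on_subset[OF bij_is_inj[OF refl_elems_bij]]) auto

lemma refl_elems_inner: "w \<in> refl_elems A \<Longrightarrow> w u \<bullet> w v = u \<bullet> v"
  by (auto simp: refl_elems_iff refl_word_inner)

lemma refl_word_rev: "refl_word (rev as) (refl_word as v) = v"
  by (induction as) (simp_all add: refl_word_append root_refl_idem)

lemma refl_elems_inv:
  assumes "w \<in> refl_elems A"
  shows "winv w \<in> refl_elems A"
proof -
  from assms obtain as where as: "set as \<subseteq> A" "w = refl_word as" by (auto simp: refl_elems_iff)
  have "winv (refl_word as) = refl_word (rev as)"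
    using refl_word_rev[of as] refl_word_rev[of "rev as"]
    by (intro inv_unique_comp) (auto simp: fun_eq_iff)
  then have "winv w = refl_word (rev as)" by (simp add: as)
  moreover have "set (rev as) \<subseteq> A" using as by simp
  ultimately show ?thesis unfolding refl_elems_iff by blast
qed

lemma refl_elems_inv_apply [simp]:
  assumes "w \<in> refl_elems A"
  shows "winv w (w v) = v" "w (winv w v) = v"
  using refl_elems_bij[OF assms] by (simp_all add: bij_is_inj bij_is_surj surj_f_inv_f)

lemma refl_elems_inv_inv:
  assumes "w \<in> refl_elems A"
  shows "winv (winv w) = w"
  using refl_elems_bij[OF assms] by (rule inv_inv_eq)

lemma refl_elems_adjoint:
  assumes "w \<in> refl_elems A"
  shows "w u \<bullet> v = u \<bullet> winv w v"
  using refl_elems_inner[OF assms, of u "winv w v"] assms by simp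

text \<open>Conjugation by the isometry \<open>w\<close> turns the reflection in \<open>b\<close>
  into the reflection in \<open>w b\<close>, hence acts on a word letter by letter.\<close>

lemma refl_elems_conj_group:
  assumes w: "w \<in> refl_elems A" and u: "u \<in> refl_elems B"
  shows "w \<circ> u \<circ> winv w \<in> refl_elems (w ` B)"
proof -
  from u obtain bs where bs: "set bs \<subseteq> B" "u = refl_word bs" by (auto simp: refl_elems_iff)
  have "w \<circ> refl_word bs \<circ> winv w = refl_word (map w bs)" for bs
  proof (induction bs)
    case Nil
    then show ?case using w by (auto simp: fun_eq_iff)
  next
    case (Cons b bs)
    show ?case
    proof
      fix v
      have "w (root_refl b (refl_word bs (winv w v)))
          = root_refl (w b) (w (refl_word bs (winv w v)))"
        by (rule root_refl_conj[OF refl_elems_linear[OF w] refl_elems_inner[OF w]])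
      also have "w (refl_word bs (winv w v)) = refl_word (map w bs) v"
        using fun_cong[OF Cons, of v] by simp
      finally show "(w \<circ> refl_word (b # bs) \<circ> winv w) v = refl_word (map w (b # bs)) v"
        by simp
    qed
  qed
  then show ?thesis unfolding refl_elems_iff using bs by (intro exI[of _ "map w bs"]) auto
qed

section \<open>Root systems and simple reflections\<close>

text \<open>The common form into which both \<open>fix_space\<close> and the members of
  \<open>arrangement_lattice\<close> are translated.\<close>

definition perp :: "'a::euclidean_space set \<Rightarrow> 'a set"
  where "perp K = {v. \<forall>\<alpha>\<in>K. \<alpha> \<bullet> v = 0}"

lemma perp_antimono: "K \<subseteq> J \<Longrightarrow> perp J \<subseteq> perp K"
  by (auto simp: perp_def)

lemma subspace_perp: "subspace (perp K)"
  by (auto simp: subspace_def perp_def inner_add_right)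

lemma fix_space_refl_elems:
  assumes "0 \<notin> K"
  shows "fix_space (refl_elems K) = perp K"
proof (intro equalityI subsetI)
  fix v assume v: "v \<in> fix_space (refl_elems K)"
  have "\<alpha> \<bullet> v = 0" if "\<alpha> \<in> K" for \<alpha>
  proof -
    have "\<alpha> \<noteq> 0" using that assms by auto
    moreover have "root_refl \<alpha> v = v"
      using v refl_elems_refl[OF that] by (auto simp: fix_space_def)
    ultimately show ?thesis by (simp add: root_refl_def inner_commute)
  qed
  then show "v \<in> perp K" by (simp add: perp_def)
next
  fix v assume v: "v \<in> perp K"
  have "refl_word as v = v" if "set as \<subseteq> K" for as
    using that v by (induction as) (auto simp: perp_def root_refl_fix inner_commute)
  then show "v \<in> fix_space (refl_elems K)" by (auto simp: fix_space_def refl_elems_iff)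
qed

lemma refl_elems_perp:
  assumes "0 \<notin> K" "w \<in> refl_elems K" "v \<in> perp K"
  shows "w v = v"
  using assms fix_space_refl_elems[of K] by (auto simp: fix_space_def)

locale based_roots =
  fixes \<Phi> \<Delta> :: "'a::euclidean_space set"
  assumes root_system: "root_system \<Phi>" and root_base: "root_base \<Phi> \<Delta>"
begin

abbreviation W where "W \<equiv> refl_elems \<Phi>"

lemma finite_Phi: "finite \<Phi>" and zero_notin_Phi: "0 \<notin> \<Phi>" and span_Phi: "span \<Phi> = UNIV"
  using root_system by (auto simp: root_system_def)

lemma root_refl_Phi: "\<alpha> \<in> \<Phi> \<Longrightarrow> \<beta> \<in> \<Phi> \<Longrightarrow> root_refl \<alpha> \<beta> \<in> \<Phi>"
  using root_system unfolding root_system_def by blast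

lemma reduced:
  assumes "\<alpha> \<in> \<Phi>" "c *\<^sub>R \<alpha> \<in> \<Phi>"
  shows "c *\<^sub>R \<alpha> = \<alpha> \<or> c *\<^sub>R \<alpha> = - \<alpha>"
proof -
  have "c *\<^sub>R \<alpha> \<in> \<Phi> \<inter> span {\<alpha>}" using assms by (simp add: span_base span_scale)
  then show ?thesis using root_system assms by (auto simp: root_system_def)
qed

lemma uminus_Phi: "\<beta> \<in> \<Phi> \<Longrightarrow> - \<beta> \<in> \<Phi>"
  using root_refl_Phi[of \<beta> \<beta>] root_refl_self[of \<beta>] zero_notin_Phi by metis

lemma Delta_Phi: "\<Delta> \<subseteq> \<Phi>" and indep_Delta: "independent \<Delta>" and span_Delta: "span \<Delta> = UNIV"
  using root_base by (auto simp: root_base_def)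

lemma finite_Delta: "finite \<Delta>"
  using finite_subset[OF Delta_Phi finite_Phi] .

lemma zero_notin_Delta: "0 \<notin> \<Delta>"
  using Delta_Phi zero_notin_Phi by auto

lemma card_Delta: "card \<Delta> = DIM('a)"
  using dim_span_eq_card_independent[OF indep_Delta] span_Delta by simp

section \<open>Dual basis, test points and positive roots\<close>

lemma ex_dual_point: "\<exists>v. \<forall>\<gamma>\<in>\<Delta>. \<gamma> \<bullet> v = f \<gamma>"
proof -
  obtain g where g: "linear g" "\<forall>x\<in>\<Delta>. g x = (f x :: real)"
    using linear_independent_extend[OF indep_Delta, of f] by auto
  have "\<gamma> \<bullet> adjoint g 1 = f \<gamma>" if "\<gamma> \<in> \<Delta>" for \<gamma>
    using adjoint_works[OF g(1), of \<gamma> 1] g(2) that by simp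
  then show ?thesis by blast
qed

text \<open>The basis dual to \<open>\<Delta>\<close>. Coefficients with respect to
  \<open>\<Delta>\<close> become inner products, so positivity of roots is a matter of signs of
  inner products.\<close>

definition coweight :: "'a \<Rightarrow> 'a"
  where "coweight \<alpha> = (SOME v. \<forall>\<gamma>\<in>\<Delta>. \<gamma> \<bullet> v = (if \<gamma> = \<alpha> then 1 else 0))"

lemma inner_coweight: "\<gamma> \<in> \<Delta> \<Longrightarrow> \<gamma> \<bullet> coweight \<alpha> = (if \<gamma> = \<alpha> then 1 else 0)"
  unfolding coweight_def by (rule someI_ex[OF ex_dual_point, rule_format])

text \<open>For \<open>K\<close> inside \<open>\<Delta>\<close>, a point in the relative interior of
  the face of the fundamental chamber on which \<open>K\<close> vanishes; \<open>pt {}\<close> lies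
  in the open chamber.\<close>

definition pt :: "'a set \<Rightarrow> 'a"
  where "pt K = (SOME v. \<forall>\<gamma>\<in>\<Delta>. \<gamma> \<bullet> v = (if \<gamma> \<in> K then 0 else 1))"

lemma inner_pt: "\<gamma> \<in> \<Delta> \<Longrightarrow> \<gamma> \<bullet> pt K = (if \<gamma> \<in> K then 0 else 1)"
  unfolding pt_def by (rule someI_ex[OF ex_dual_point, rule_format])

lemma pt_perp: "K \<subseteq> \<Delta> \<Longrightarrow> pt K \<in> perp K"
  by (auto simp: perp_def inner_pt)

lemma sum_Delta_coweight:
  assumes "\<alpha> \<in> \<Delta>"
  shows "(\<Sum>\<gamma>\<in>\<Delta>. u \<gamma> *\<^sub>R \<gamma>) \<bullet> coweight \<alpha> = u \<alpha>"
proof -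
  have "(\<Sum>\<gamma>\<in>\<Delta>. u \<gamma> *\<^sub>R \<gamma>) \<bullet> coweight \<alpha> = (\<Sum>\<gamma>\<in>\<Delta>. u \<gamma> * (if \<gamma> = \<alpha> then 1 else 0))"
    unfolding inner_sum_left by (intro sum.cong) (auto simp: inner_coweight)
  then show ?thesis using assms finite_Delta by (simp add: if_distrib cong: if_cong)
qed

lemma coweight_expand: "v = (\<Sum>\<alpha>\<in>\<Delta>. (v \<bullet> coweight \<alpha>) *\<^sub>R \<alpha>)"
proof -
  have "v \<in> span \<Delta>" using span_Delta by simp
  then obtain u where u: "v = (\<Sum>\<alpha>\<in>\<Delta>. u \<alpha> *\<^sub>R \<alpha>)"
    using span_finite[OF finite_Delta] by auto
  have "v \<bullet> coweight \<alpha> = u \<alpha>" if "\<alpha> \<in> \<Delta>" for \<alpha>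
    unfolding u by (rule sum_Delta_coweight[OF that])
  then have "(\<Sum>\<alpha>\<in>\<Delta>. (v \<bullet> coweight \<alpha>) *\<^sub>R \<alpha>) = (\<Sum>\<alpha>\<in>\<Delta>. u \<alpha> *\<^sub>R \<alpha>)" by simp
  with u show ?thesis by simp
qed

lemma inner_expand: "v \<bullet> u = (\<Sum>\<alpha>\<in>\<Delta>. (v \<bullet> coweight \<alpha>) * (\<alpha> \<bullet> u))"
proof -
  have "v \<bullet> u = (\<Sum>\<alpha>\<in>\<Delta>. (v \<bullet> coweight \<alpha>) *\<^sub>R \<alpha>) \<bullet> u"
    using coweight_expand[of v] by simp
  then show ?thesis by (simp add: inner_sum_left)
qed

lemma nonneg_comb_iff: "nonneg_comb \<Delta> v \<longleftrightarrow> (\<forall>\<alpha>\<in>\<Delta>. 0 \<le> v \<bullet> coweight \<alpha>)"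
proof
  assume "nonneg_comb \<Delta> v"
  then show "\<forall>\<alpha>\<in>\<Delta>. 0 \<le> v \<bullet> coweight \<alpha>"
    by (auto simp: nonneg_comb_def sum_Delta_coweight)
next
  assume "\<forall>\<alpha>\<in>\<Delta>. 0 \<le> v \<bullet> coweight \<alpha>"
  then show "nonneg_comb \<Delta> v"
    unfolding nonneg_comb_def
    by (intro exI[of _ "\<lambda>\<alpha>. v \<bullet> coweight \<alpha>"] conjI coweight_expand) auto
qed

definition pos :: "'a \<Rightarrow> bool"
  where "pos \<beta> \<longleftrightarrow> \<beta> \<in> \<Phi> \<and> (\<forall>\<alpha>\<in>\<Delta>. 0 \<le> \<beta> \<bullet> coweight \<alpha>)"

lemma pos_cases: "\<beta> \<in> \<Phi> \<Longrightarrow> pos \<beta> \<or> pos (- \<beta>)"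
  using root_base by (auto simp: root_base_def pos_def nonneg_comb_iff uminus_Phi)

lemma pos_Phi: "pos \<beta> \<Longrightarrow> \<beta> \<in> \<Phi>"
  by (simp add: pos_def)

lemma pos_pt_nonneg: "pos \<beta> \<Longrightarrow> 0 \<le> \<beta> \<bullet> pt K"
  by (subst inner_expand) (intro sum_nonneg mult_nonneg_nonneg; auto simp: pos_def inner_pt)

lemma pos_asym: "pos \<beta> \<Longrightarrow> \<not> pos (- \<beta>)"
proof
  assume "pos \<beta>" "pos (- \<beta>)"
  then have "\<forall>\<alpha>\<in>\<Delta>. \<beta> \<bullet> coweight \<alpha> = 0" by (auto simp: pos_def intro: order_antisym)
  then have "\<beta> = 0" using coweight_expand[of \<beta>] by simp
  then show False using \<open>pos \<beta>\<close> zero_notin_Phi by (auto simp: pos_def)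
qed

lemma pos_iff_pt: "\<beta> \<in> \<Phi> \<Longrightarrow> 0 < \<beta> \<bullet> pt K \<Longrightarrow> pos \<beta>"
  using pos_cases[of \<beta>] pos_pt_nonneg[of "- \<beta>" K] by auto

lemma pos_inner_zero:
  assumes "pos \<beta>" "\<beta> \<bullet> u = 0" "\<And>\<gamma>. \<gamma> \<in> \<Delta> \<Longrightarrow> 0 \<le> \<gamma> \<bullet> u" "\<alpha> \<in> \<Delta>"
  shows "(\<beta> \<bullet> coweight \<alpha>) * (\<alpha> \<bullet> u) = 0"
proof -
  have "(\<Sum>\<gamma>\<in>\<Delta>. (\<beta> \<bullet> coweight \<gamma>) * (\<gamma> \<bullet> u)) = 0" using assms(2) inner_expand by metis
  then show ?thesis
    using assms by (subst (asm) sum_nonneg_eq_0_iff) (auto simp: finite_Delta pos_def)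
qed

text \<open>The coefficients of a root have one sign and the simple roots outside \<open>K\<close>
  are 1 at \<open>pt K\<close>, so nothing can cancel.\<close>

lemma pt_zero_coeff:
  assumes "\<beta> \<in> \<Phi>" "\<beta> \<bullet> pt K = 0" "\<alpha> \<in> \<Delta>" "\<alpha> \<notin> K"
  shows "\<beta> \<bullet> coweight \<alpha> = 0"
proof -
  have *: "\<beta> \<bullet> coweight \<alpha> = 0" if "pos \<beta>" "\<beta> \<bullet> pt K = 0" for \<beta>
    using pos_inner_zero[OF that _ assms(3)] assms(3,4) by (simp add: inner_pt)
  from pos_cases[OF assms(1)] show ?thesis
    using *[of \<beta>] *[of "- \<beta>"] assms(2) by auto
qed

text \<open>Together with \<open>pt_perp\<close> this makes the single value at \<open>pt K\<close>
  decide whether a root belongs to the parabolic subsystem of \<open>K\<close>.\<close>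

lemma pt_zero_perp:
  assumes "\<beta> \<in> \<Phi>" "\<beta> \<bullet> pt K = 0" "v \<in> perp K"
  shows "\<beta> \<bullet> v = 0"
  using pt_zero_coeff[OF assms(1,2)] assms(3)
  by (subst inner_expand) (intro sum.neutral; auto simp: perp_def)

lemma pos_pt_empty: "pos \<beta> \<Longrightarrow> 0 < \<beta> \<bullet> pt {}"
proof -
  assume b: "pos \<beta>"
  have "\<beta> \<bullet> pt {} \<noteq> 0"
  proof
    assume "\<beta> \<bullet> pt {} = 0"
    then have "\<forall>\<alpha>\<in>\<Delta>. \<beta> \<bullet> coweight \<alpha> = 0" using pt_zero_coeff[OF pos_Phi[OF b]] by auto
    then have "\<beta> = 0" using coweight_expand[of \<beta>] by simp
    then show False using b zero_notin_Phi by (auto simp: pos_def)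
  qed
  then show ?thesis using pos_pt_nonneg[OF b, of "{}"] by simp
qed

lemma pos_iff: "\<beta> \<in> \<Phi> \<Longrightarrow> pos \<beta> \<longleftrightarrow> 0 \<le> \<beta> \<bullet> pt {}"
  using pos_pt_empty[of "- \<beta>"] pos_pt_nonneg[of \<beta>] pos_cases by force

lemma pos_simple: "\<alpha> \<in> \<Delta> \<Longrightarrow> pos \<alpha>"
  using Delta_Phi by (auto simp: pos_def inner_coweight)

text \<open>The expansion leaves a multiple of \<open>\<alpha>\<close>, and the root system is
  reduced.\<close>

lemma pos_multiple_simple:
  assumes "\<alpha> \<in> \<Delta>" "pos \<beta>" "\<And>\<gamma>. \<gamma> \<in> \<Delta> \<Longrightarrow> \<gamma> \<noteq> \<alpha> \<Longrightarrow> \<beta> \<bullet> coweight \<gamma> = 0"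
  shows "\<beta> = \<alpha>"
proof -
  have "\<beta> = (\<Sum>\<gamma>\<in>\<Delta>. (\<beta> \<bullet> coweight \<gamma>) *\<^sub>R \<gamma>)" by (rule coweight_expand)
  also have "\<dots> = (\<Sum>\<gamma>\<in>\<Delta>. if \<gamma> = \<alpha> then (\<beta> \<bullet> coweight \<alpha>) *\<^sub>R \<alpha> else 0)"
    using assms(3) by (intro sum.cong) auto
  also have "\<dots> = (\<beta> \<bullet> coweight \<alpha>) *\<^sub>R \<alpha>" using assms(1) finite_Delta by simp
  finally have b: "\<beta> = (\<beta> \<bullet> coweight \<alpha>) *\<^sub>R \<alpha>" .
  then have "\<beta> = \<alpha> \<or> \<beta> = - \<alpha>"
    using reduced[of \<alpha> "\<beta> \<bullet> coweight \<alpha>"] assms Delta_Phi pos_Phi by auto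
  then show ?thesis using pos_asym[OF pos_simple[OF assms(1)]] assms(2) by auto
qed

text \<open>The reflection changes only the coefficient at \<open>\<alpha>\<close>. Some other
  coefficient of \<open>\<beta>\<close> is positive and stays so, which excludes a negative
  root.\<close>

lemma simple_refl_pos:
  assumes "\<alpha> \<in> \<Delta>" "pos \<beta>" "\<beta> \<noteq> \<alpha>"
  shows "pos (root_refl \<alpha> \<beta>)"
proof -
  have coeff: "root_refl \<alpha> \<beta> \<bullet> coweight \<gamma> = \<beta> \<bullet> coweight \<gamma>" if "\<gamma> \<noteq> \<alpha>" for \<gamma>
    using that assms(1) by (simp add: root_refl_def inner_diff_left inner_coweight)
  obtain \<gamma> where g: "\<gamma> \<in> \<Delta>" "\<gamma> \<noteq> \<alpha>" "\<beta> \<bullet> coweight \<gamma> \<noteq> 0"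
    using pos_multiple_simple[OF assms(1,2)] assms(3) by auto
  then have "0 < \<beta> \<bullet> coweight \<gamma>" using assms(2) by (auto simp: pos_def order_less_le)
  then have "\<not> pos (- root_refl \<alpha> \<beta>)" using coeff[of \<gamma>] g unfolding pos_def by force
  then show ?thesis
    using pos_cases[of "root_refl \<alpha> \<beta>"] root_refl_Phi[of \<alpha> \<beta>] assms Delta_Phi pos_Phi by auto
qed

lemma negative_roots_iff: "\<beta> \<in> negative_roots \<Phi> \<Delta> \<longleftrightarrow> pos (- \<beta>)"
  using uminus_Phi[of "- \<beta>"] uminus_Phi[of \<beta>]
  by (auto simp: negative_roots_def pos_def nonneg_comb_iff)

section \<open>The action on roots, generation by simple reflections and the exchange
  condition\<close>

lemma W_Phi: "w \<in> W \<Longrightarrow> \<beta> \<in> \<Phi> \<Longrightarrow> w \<beta> \<in> \<Phi>"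
proof -
  have "refl_word as \<beta> \<in> \<Phi>" if "set as \<subseteq> \<Phi>" "\<beta> \<in> \<Phi>" for as
    using that by (induction as) (auto simp: root_refl_Phi)
  then show "w \<in> W \<Longrightarrow> \<beta> \<in> \<Phi> \<Longrightarrow> w \<beta> \<in> \<Phi>" by (auto simp: refl_elems_iff)
qed

lemma W_inv_Phi: "w \<in> W \<Longrightarrow> \<beta> \<in> \<Phi> \<Longrightarrow> winv w \<beta> \<in> \<Phi>"
  using W_Phi refl_elems_inv by blast

lemma W_eqI:
  assumes "w \<in> W" "z \<in> W" "\<And>\<beta>. \<beta> \<in> \<Phi> \<Longrightarrow> w \<beta> = z \<beta>"
  shows "w = z"
proof
  fix v
  show "w v = z v"
    using linear_eq_on_span[OF refl_elems_linear[OF assms(1)] refl_elems_linear[OF assms(2)], of \<Phi>]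
      assms(3) span_Phi by auto
qed

text \<open>Roots span the space, so an element is determined by its restriction to the finite set
  \<open>\<Phi>\<close>.\<close>

lemma finite_W: "finite W"
proof (rule inj_on_finite)
  show "inj_on (\<lambda>w. restrict w \<Phi>) W"
    by (rule inj_onI) (metis W_eqI restrict_apply')
  show "(\<lambda>w. restrict w \<Phi>) ` W \<subseteq> \<Phi> \<rightarrow>\<^sub>E \<Phi>" using W_Phi by auto
  show "finite (\<Phi> \<rightarrow>\<^sub>E \<Phi>)" using finite_Phi by (simp add: finite_PiE)
qed

lemma sub_W: "K \<subseteq> \<Delta> \<Longrightarrow> refl_elems K \<subseteq> W"
  using Delta_Phi by (intro refl_elems_mono) auto

text \<open>Take a positive root of least height in the orbit, where height is the inner product
  with \<open>pt {}\<close>. A simple reflection that lowers the height can only make it negative,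
  so it must be that simple root.\<close>

lemma pos_conj_simple:
  assumes "pos \<beta>"
  shows "\<exists>w\<in>refl_elems \<Delta>. w \<beta> \<in> \<Delta>"
proof -
  define S where "S = {w \<in> refl_elems \<Delta>. pos (w \<beta>)}"
  have "finite S" unfolding S_def using finite_subset[OF sub_W[of \<Delta>] finite_W] by auto
  moreover have "id \<in> S" using assms by (auto simp: S_def refl_elems_id)
  ultimately obtain w where w: "w \<in> S" and least: "\<And>z. z \<in> S \<Longrightarrow> w \<beta> \<bullet> pt {} \<le> z \<beta> \<bullet> pt {}"
    using arg_min_if_finite[of S "\<lambda>z. z \<beta> \<bullet> pt {}"] by (metis empty_iff linorder_not_less)
  define \<gamma> where "\<gamma> = w \<beta>"
  have g: "pos \<gamma>" and wD: "w \<in> refl_elems \<Delta>" using w by (auto simp: S_def \<gamma>_def)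
  \<comment> \<open>Expanding \<open>\<gamma> \<bullet> \<gamma>\<close> over the simple roots
    yields one with positive inner product; reflecting in it lowers the height.\<close>
  have "0 < \<gamma> \<bullet> \<gamma>" using pos_Phi[OF g] zero_notin_Phi by auto
  then have "\<not> (\<forall>\<alpha>\<in>\<Delta>. (\<gamma> \<bullet> coweight \<alpha>) * (\<alpha> \<bullet> \<gamma>) \<le> 0)"
    using inner_expand[of \<gamma> \<gamma>] sum_nonpos[of \<Delta> "\<lambda>\<alpha>. (\<gamma> \<bullet> coweight \<alpha>) * (\<alpha> \<bullet> \<gamma>)"] by force
  then obtain \<alpha> where a: "\<alpha> \<in> \<Delta>" "0 < (\<gamma> \<bullet> coweight \<alpha>) * (\<alpha> \<bullet> \<gamma>)" by force
  then have ag: "0 < \<gamma> \<bullet> \<alpha>" using g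
    by (auto simp: pos_def zero_less_mult_iff inner_commute dest: bspec)
  have "\<gamma> = \<alpha>"
  proof (rule ccontr)
    assume ne: "\<gamma> \<noteq> \<alpha>"
    have "root_refl \<alpha> \<circ> w \<in> S"
      using simple_refl_pos[OF a(1) g ne] refl_elems_comp[OF refl_elems_refl[OF a(1)] wD]
      by (auto simp: S_def \<gamma>_def)
    from least[OF this] have "\<gamma> \<bullet> pt {} \<le> root_refl \<alpha> \<gamma> \<bullet> pt {}" by (simp add: \<gamma>_def)
    moreover have "root_refl \<alpha> \<gamma> \<bullet> pt {} = \<gamma> \<bullet> pt {} - 2 * (\<gamma> \<bullet> \<alpha>) / (\<alpha> \<bullet> \<alpha>)"
      using a(1) by (simp add: root_refl_def inner_diff_left inner_pt)
    moreover have "0 < 2 * (\<gamma> \<bullet> \<alpha>) / (\<alpha> \<bullet> \<alpha>)"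
      using ag a(1) zero_notin_Delta by (intro divide_pos_pos) auto
    ultimately show False by simp
  qed
  then show ?thesis using wD a(1) by (auto simp: \<gamma>_def)
qed

lemma Phi_conj_simple:
  assumes "\<beta> \<in> \<Phi>"
  shows "\<exists>w\<in>refl_elems \<Delta>. \<exists>\<alpha>\<in>\<Delta>. \<beta> = w \<alpha>"
proof -
  have *: "\<exists>w\<in>refl_elems \<Delta>. \<exists>\<alpha>\<in>\<Delta>. \<gamma> = w \<alpha>" if g: "pos \<gamma>" for \<gamma>
  proof -
    obtain w where w: "w \<in> refl_elems \<Delta>" "w \<gamma> \<in> \<Delta>" using pos_conj_simple[OF g] by auto
    then show ?thesis
      by (intro bexI[OF _ refl_elems_inv[OF w(1)]] bexI[OF _ w(2)]) simp
  qed
  from pos_cases[OF assms] show ?thesis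
  proof
    assume "pos (- \<beta>)"
    then obtain w \<alpha> where w: "w \<in> refl_elems \<Delta>" "\<alpha> \<in> \<Delta>" "- \<beta> = w \<alpha>" using * by blast
    have "\<alpha> \<noteq> 0" using w zero_notin_Delta by auto
    then have "(w \<circ> root_refl \<alpha>) \<alpha> = \<beta>"
      using w by (simp add: root_refl_self refl_elems_neg[OF w(1)] flip: w(3))
    moreover have "w \<circ> root_refl \<alpha> \<in> refl_elems \<Delta>"
      using w by (intro refl_elems_comp refl_elems_refl)
    ultimately show ?thesis using w(2) by metis
  qed (rule *)
qed

text \<open>Every root is the image of a simple one under a word in simple reflections, so its
  reflection is a conjugate of a simple reflection by such a word.\<close>

lemma W_simple: "W = refl_elems \<Delta>"
proof
  show "refl_elems \<Delta> \<subseteq> W" by (rule sub_W) simp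
  have root: "root_refl \<beta> \<in> refl_elems \<Delta>" if "\<beta> \<in> \<Phi>" for \<beta>
  proof -
    obtain w \<alpha> where w: "w \<in> refl_elems \<Delta>" "\<alpha> \<in> \<Delta>" "\<beta> = w \<alpha>"
      using Phi_conj_simple[OF \<open>\<beta> \<in> \<Phi>\<close>] by blast
    have "root_refl \<beta> = w \<circ> (root_refl \<alpha> \<circ> winv w)"
    proof
      fix v
      show "root_refl \<beta> v = (w \<circ> (root_refl \<alpha> \<circ> winv w)) v"
        using root_refl_conj[OF refl_elems_linear[OF w(1)] refl_elems_inner[OF w(1)],
            of \<alpha> "winv w v"] w by simp
    qed
    then show ?thesis
      using w by (simp only:) (intro refl_elems_comp refl_elems_refl refl_elems_inv)
  qed
  have "refl_word as \<in> refl_elems \<Delta>" if "set as \<subseteq> \<Phi>" for as using that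
  proof (induction as)
    case Nil
    show ?case using refl_elems_id by (simp only: refl_word_simps)
  next
    case (Cons \<beta> as)
    then show ?case unfolding refl_word_simps by (intro refl_elems_comp root) auto
  qed
  then show "W \<subseteq> refl_elems \<Delta>" by (auto simp: refl_elems_iff[of _ \<Phi>])
qed

text \<open>Follow \<open>\<alpha>\<close> through the word from the right to the letter
  \<open>\<gamma>\<close> at which it turns negative. By \<open>simple_refl_pos\<close> the root
  equals \<open>\<gamma>\<close> just before, so this letter cancels against the reflection in
  \<open>\<alpha>\<close>.\<close>

lemma exchange:
  assumes "set as \<subseteq> \<Delta>" "\<alpha> \<in> \<Delta>" "pos (- refl_word as \<alpha>)"
  shows "\<exists>bs. set bs \<subseteq> \<Delta> \<and> length bs < length as \<and> refl_word as \<circ> root_refl \<alpha> = refl_word bs"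
  using assms
proof (induction as)
  case Nil
  then show ?case using pos_asym[OF pos_simple] by auto
next
  case (Cons \<gamma> as)
  define \<beta> where "\<beta> = refl_word as \<alpha>"
  have w: "refl_word as \<in> W" using Cons.prems Delta_Phi by (auto simp: refl_elems_iff)
  then have b: "\<beta> \<in> \<Phi>" using Cons.prems Delta_Phi by (auto simp: \<beta>_def W_Phi)
  show ?case
  proof (cases "pos (- \<beta>)")
    case True
    then obtain bs where bs: "set bs \<subseteq> \<Delta>" "length bs < length as"
        "refl_word as \<circ> root_refl \<alpha> = refl_word bs"
      using Cons.IH[OF _ Cons.prems(2)] Cons.prems(1) unfolding \<beta>_def
      by (metis set_subset_Cons subset_trans)
    have "refl_word (\<gamma> # as) \<circ> root_refl \<alpha> = refl_word (\<gamma> # bs)"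
      by (simp only: refl_word_simps comp_assoc bs(3))
    moreover have "set (\<gamma> # bs) \<subseteq> \<Delta>" "length (\<gamma> # bs) < length (\<gamma> # as)"
      using bs Cons.prems by auto
    ultimately show ?thesis by blast
  next
    case False
    with b pos_cases have "pos \<beta>" by auto
    moreover have "\<not> pos (root_refl \<gamma> \<beta>)"
      using Cons.prems(3) pos_asym[of "root_refl \<gamma> \<beta>"] by (auto simp: \<beta>_def)
    ultimately have bg: "\<beta> = \<gamma>" using simple_refl_pos[of \<gamma> \<beta>] Cons.prems by auto
    have "refl_word (\<gamma> # as) \<circ> root_refl \<alpha> = refl_word as"
    proof
      fix v
      have "refl_word as (root_refl \<alpha> v) = root_refl \<gamma> (refl_word as v)"
        using root_refl_conj[OF refl_elems_linear[OF w] refl_elems_inner[OF w], of \<alpha> v] bg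
        by (simp add: \<beta>_def)
      then show "(refl_word (\<gamma> # as) \<circ> root_refl \<alpha>) v = refl_word as v"
        by (simp add: root_refl_idem)
    qed
    moreover have "set as \<subseteq> \<Delta>" "length as < length (\<gamma> # as)" using Cons.prems by auto
    ultimately show ?thesis by blast
  qed
qed

text \<open>A shortest nonempty word would send its last letter to a negative root, since otherwise
  \<open>exchange\<close> shortens it. This is simple transitivity on chambers in algebraic
  form.\<close>

lemma W_pos_id:
  assumes "w \<in> W" "\<And>\<alpha>. \<alpha> \<in> \<Delta> \<Longrightarrow> pos (w \<alpha>)"
  shows "w = id"
proof -
  have "\<exists>as. set as \<subseteq> \<Delta> \<and> w = refl_word as" using assms(1) W_simple refl_elems_iff by blast
  then obtain as where as: "set as \<subseteq> \<Delta> \<and> w = refl_word as"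
    and least: "\<And>bs. set bs \<subseteq> \<Delta> \<and> w = refl_word bs \<Longrightarrow> length as \<le> length bs"
    using ex_has_least_nat[of "\<lambda>as. set as \<subseteq> \<Delta> \<and> w = refl_word as" _ length] by blast
  show ?thesis
  proof (cases as rule: rev_cases)
    case Nil
    then show ?thesis using as by (simp only: refl_word_simps)
  next
    case (snoc cs \<alpha>)
    have a: "\<alpha> \<in> \<Delta>" "set cs \<subseteq> \<Delta>" "\<alpha> \<noteq> 0" using as snoc zero_notin_Delta by auto
    have w: "w = refl_word cs \<circ> root_refl \<alpha>"
      using as snoc by (simp add: refl_word_append fun_eq_iff)
    have "w \<alpha> = - refl_word cs \<alpha>"
      using a by (simp add: w root_refl_self linear_neg[OF refl_word_linear])
    then have "pos (- refl_word cs \<alpha>)" using assms(2)[OF a(1)] by simp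
    from exchange[OF a(2,1) this] w obtain bs
      where "set bs \<subseteq> \<Delta>" "length bs < length cs" "w = refl_word bs" by auto
    with least[of bs] snoc show ?thesis by auto
  qed
qed

section \<open>Chambers adjacent to a flat\<close>

lemma perp_expand: "v \<in> perp K \<Longrightarrow> \<beta> \<bullet> v = (\<Sum>\<alpha>\<in>\<Delta> - K. (\<beta> \<bullet> coweight \<alpha>) * (\<alpha> \<bullet> v))"
  by (subst inner_expand)
    (intro sum.mono_neutral_right; auto simp: finite_Delta perp_def)

text \<open>Choose the image of \<open>v\<close> with the largest inner product with
  \<open>pt {}\<close>; a simple root of \<open>K\<close> that is negative on it would give a
  reflection increasing this value.\<close>

lemma dominant_rep:
  assumes K: "K \<subseteq> \<Delta>"
  shows "\<exists>w\<in>refl_elems K. \<forall>\<alpha>\<in>K. 0 \<le> \<alpha> \<bullet> w v"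
proof -
  have "finite (refl_elems K)" using finite_subset[OF sub_W[OF K] finite_W] .
  moreover have "refl_elems K \<noteq> {}" using refl_elems_id by blast
  ultimately obtain w where w: "w \<in> refl_elems K"
    and most: "\<And>z. z \<in> refl_elems K \<Longrightarrow> z v \<bullet> pt {} \<le> w v \<bullet> pt {}"
    using arg_min_if_finite[of "refl_elems K" "\<lambda>z. - (z v \<bullet> pt {})"]
    by (metis linorder_not_less neg_less_iff_less)
  have "0 \<le> \<alpha> \<bullet> w v" if a: "\<alpha> \<in> K" for \<alpha>
  proof (rule ccontr)
    assume neg: "\<not> 0 \<le> \<alpha> \<bullet> w v"
    have "root_refl \<alpha> \<circ> w \<in> refl_elems K"
      using a w by (intro refl_elems_comp refl_elems_refl)
    from most[OF this] have "root_refl \<alpha> (w v) \<bullet> pt {} \<le> w v \<bullet> pt {}" by simp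
    moreover have "root_refl \<alpha> (w v) \<bullet> pt {} = w v \<bullet> pt {} - 2 * (\<alpha> \<bullet> w v) / (\<alpha> \<bullet> \<alpha>)"
      using a K by (auto simp: root_refl_def inner_diff_left inner_pt inner_commute[of "w v" \<alpha>])
    moreover have "2 * (\<alpha> \<bullet> w v) / (\<alpha> \<bullet> \<alpha>) < 0"
      using neg a K zero_notin_Delta by (intro divide_neg_pos) auto
    ultimately show False by simp
  qed
  then show ?thesis using w by auto
qed

text \<open>The second condition selects, among the chambers whose closure contains \<open>v\<close>, the one nearest to the
  fundamental chamber.\<close>

lemma dominant_rep_close:
  "\<exists>w\<in>W. (\<forall>\<alpha>\<in>\<Delta>. 0 \<le> \<alpha> \<bullet> w v) \<and> (\<forall>\<alpha>\<in>\<Delta>. \<alpha> \<bullet> w v = 0 \<longrightarrow> pos (winv w \<alpha>))"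
proof -
  obtain z where z: "z \<in> W" "\<forall>\<alpha>\<in>\<Delta>. 0 \<le> \<alpha> \<bullet> z v"
    using dominant_rep[of \<Delta> v] W_simple by auto
  define J where "J = {\<alpha>\<in>\<Delta>. \<alpha> \<bullet> z v = 0}"
  have J: "J \<subseteq> \<Delta>" by (auto simp: J_def)
  \<comment> \<open>The group of \<open>J\<close> fixes \<open>z v\<close>, so this second
    correction selects the chamber without moving the point already reached.\<close>
  obtain y where y: "y \<in> refl_elems J" "\<forall>\<alpha>\<in>J. 0 \<le> \<alpha> \<bullet> y (z (pt {}))"
    using dominant_rep[OF J, of "z (pt {})"] by auto
  have yW: "y \<in> W" using y sub_W[OF J] by auto
  have yzv: "y (z v) = z v"
    using J zero_notin_Delta by (intro refl_elems_perp[OF _ y(1)]) (auto simp: perp_def J_def)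
  have w: "y \<circ> z \<in> W" using yW z by (intro refl_elems_comp)
  have "pos (winv (y \<circ> z) \<alpha>)" if "\<alpha> \<in> \<Delta>" "\<alpha> \<bullet> z v = 0" for \<alpha>
  proof -
    have "0 \<le> \<alpha> \<bullet> (y \<circ> z) (pt {})" using y that by (auto simp: J_def)
    then have "0 \<le> winv (y \<circ> z) \<alpha> \<bullet> pt {}"
      by (metis refl_elems_adjoint[OF w] inner_commute)
    then show ?thesis using pos_iff W_inv_Phi[OF w] that Delta_Phi by blast
  qed
  then show ?thesis using w z yzv by (intro bexI[of _ "y \<circ> z"]) auto
qed

lemma W_coeff_expand:
  assumes "w \<in> W"
  shows "\<beta> = (\<Sum>\<gamma>\<in>\<Delta>. (w \<beta> \<bullet> coweight \<gamma>) *\<^sub>R winv w \<gamma>)"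
proof -
  have "\<beta> = winv w (w \<beta>)" using assms by simp
  also have "\<dots> = winv w (\<Sum>\<gamma>\<in>\<Delta>. (w \<beta> \<bullet> coweight \<gamma>) *\<^sub>R \<gamma>)"
    using coweight_expand[of "w \<beta>"] by simp
  also have "\<dots> = (\<Sum>\<gamma>\<in>\<Delta>. (w \<beta> \<bullet> coweight \<gamma>) *\<^sub>R winv w \<gamma>)"
    using refl_elems_linear[OF refl_elems_inv[OF assms]] by (simp add: linear_sum linear_scale)
  finally show ?thesis .
qed

text \<open>Simple roots are indecomposable. Applying \<open>winv w\<close> to the expansion of the
  root \<open>w \<alpha>\<close> writes \<open>\<alpha>\<close> as a combination of positive roots
  with coefficients of one sign, so every root that occurs must be \<open>\<alpha>\<close> itself.
  Both \<open>adjacent_exists\<close> and \<open>parabolic_eq\<close> rest on this.\<close>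

lemma simple_image_simple:
  assumes w: "w \<in> W" and a: "\<alpha> \<in> \<Delta>"
    and inv: "\<And>\<gamma>. \<gamma> \<in> \<Delta> \<Longrightarrow> w \<alpha> \<bullet> coweight \<gamma> \<noteq> 0 \<Longrightarrow> pos (winv w \<gamma>)"
  shows "w \<alpha> \<in> \<Delta>"
proof -
  define c where "c \<gamma> = w \<alpha> \<bullet> coweight \<gamma>" for \<gamma>
  define b where "b \<gamma> = winv w \<gamma>" for \<gamma>
  have exp: "\<alpha> = (\<Sum>\<gamma>\<in>\<Delta>. c \<gamma> *\<^sub>R b \<gamma>)" unfolding c_def b_def by (rule W_coeff_expand[OF w])
  have exp': "\<alpha> \<bullet> v = (\<Sum>\<gamma>\<in>\<Delta>. c \<gamma> * (b \<gamma> \<bullet> v))" for v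
    by (subst exp) (simp add: inner_sum_left)
  have bpos: "pos (b \<gamma>)" if "\<gamma> \<in> \<Delta>" "c \<gamma> \<noteq> 0" for \<gamma>
    using inv that by (auto simp: b_def c_def)
  have "w \<alpha> \<in> \<Phi>" using W_Phi[OF w] a Delta_Phi by auto
  have "pos (w \<alpha>)"
  proof (rule ccontr)
    assume "\<not> pos (w \<alpha>)"
    then have "pos (- w \<alpha>)" using pos_cases \<open>w \<alpha> \<in> \<Phi>\<close> by auto
    then have "c \<gamma> \<le> 0" if "\<gamma> \<in> \<Delta>" for \<gamma> using that by (auto simp: pos_def c_def)
    then have "\<alpha> \<bullet> pt {} \<le> 0" unfolding exp'
      using bpos pos_pt_nonneg[of _ "{}"] by (intro sum_nonpos) (metis mult_nonpos_nonneg mult_zero_left order_refl)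
    then show False using pos_pt_empty[OF pos_simple[OF a]] by simp
  qed
  then have c: "0 \<le> c \<gamma>" if "\<gamma> \<in> \<Delta>" for \<gamma> using that by (auto simp: pos_def c_def)
  have "\<exists>\<gamma>\<in>\<Delta>. c \<gamma> \<noteq> 0"
  proof (rule ccontr)
    assume "\<not> (\<exists>\<gamma>\<in>\<Delta>. c \<gamma> \<noteq> 0)"
    then have "\<alpha> = 0" using exp by simp
    then show False using a zero_notin_Delta by simp
  qed
  then obtain \<gamma> where g: "\<gamma> \<in> \<Delta>" "c \<gamma> \<noteq> 0" by auto
  have "b \<gamma> \<bullet> coweight \<delta> = 0" if d: "\<delta> \<in> \<Delta>" "\<delta> \<noteq> \<alpha>" for \<delta>
  proof -
    have "(\<Sum>\<gamma>\<in>\<Delta>. c \<gamma> * (b \<gamma> \<bullet> coweight \<delta>)) = 0"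
      using exp'[of "coweight \<delta>"] a d by (simp add: inner_coweight)
    moreover have "0 \<le> c \<gamma> * (b \<gamma> \<bullet> coweight \<delta>)" if "\<gamma> \<in> \<Delta>" for \<gamma>
    proof (cases "c \<gamma> = 0")
      case False
      then show ?thesis using bpos[OF that False] c[OF that] d by (auto simp: pos_def)
    qed simp
    ultimately have "c \<gamma> * (b \<gamma> \<bullet> coweight \<delta>) = 0"
      using g(1) finite_Delta by (simp add: sum_nonneg_eq_0_iff)
    then show ?thesis using g by simp
  qed
  then have "b \<gamma> = \<alpha>" using pos_multiple_simple[OF a bpos[OF g]] by auto
  then have "w \<alpha> = \<gamma>" using w by (auto simp: b_def)
  then show ?thesis using g by simp
qed

text \<open>A root vanishing at \<open>pt K\<close> is a combination of \<open>K\<close> with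
  coefficients of one sign, so positivity on \<open>K\<close> preserves signs on the whole parabolic
  subsystem.\<close>

lemma pos_Levi:
  assumes "w \<in> W" "\<forall>\<alpha>\<in>K. pos (w \<alpha>)" "K \<subseteq> \<Delta>" "\<beta> \<in> \<Phi>" "\<beta> \<bullet> pt K = 0"
  shows "pos (w \<beta>) \<longleftrightarrow> pos \<beta>"
proof -
  have *: "pos (w \<beta>)" if b: "pos \<beta>" "\<beta> \<bullet> pt K = 0" for \<beta>
  proof -
    have "\<beta> = (\<Sum>\<gamma>\<in>\<Delta>. (\<beta> \<bullet> coweight \<gamma>) *\<^sub>R \<gamma>)" by (rule coweight_expand)
    also have "\<dots> = (\<Sum>\<gamma>\<in>K. (\<beta> \<bullet> coweight \<gamma>) *\<^sub>R \<gamma>)"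
      using assms(3) pt_zero_coeff[OF pos_Phi[OF b(1)] b(2)] finite_Delta
      by (intro sum.mono_neutral_right) auto
    finally have "w \<beta> = (\<Sum>\<gamma>\<in>K. (\<beta> \<bullet> coweight \<gamma>) *\<^sub>R w \<gamma>)"
      using refl_elems_linear[OF assms(1)] by (metis (no_types, lifting) linear_scale linear_sum sum.cong)
    then have "w \<beta> \<bullet> pt {} = (\<Sum>\<gamma>\<in>K. (\<beta> \<bullet> coweight \<gamma>) * (w \<gamma> \<bullet> pt {}))"
      by (simp add: inner_sum_left)
    also have "\<dots> \<ge> 0"
      using assms(2,3) b(1) pos_pt_nonneg[of _ "{}"]
      by (intro sum_nonneg mult_nonneg_nonneg) (auto simp: pos_def)
    finally show ?thesis using pos_iff W_Phi[OF assms(1) pos_Phi[OF b(1)]] by simp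
  qed
  show ?thesis
  proof
    assume wb: "pos (w \<beta>)"
    show "pos \<beta>"
    proof (rule ccontr)
      assume "\<not> pos \<beta>"
      then have "pos (- \<beta>)" using pos_cases assms(4) by auto
      then have "pos (w (- \<beta>))" using assms(5) by (intro *) auto
      then show False using pos_asym[OF wb] refl_elems_neg[OF assms(1)] by simp
    qed
  qed (use * assms(5) in auto)
qed

text \<open>The points in open chambers of the restriction to \<open>perp K\<close>. Roots vanishing
  on all of \<open>perp K\<close> cut out no hyperplane there and are exempt.\<close>

definition generic :: "'a set \<Rightarrow> 'a \<Rightarrow> bool"
  where "generic K v \<longleftrightarrow> v \<in> perp K \<and> (\<forall>\<beta>\<in>\<Phi>. \<beta> \<bullet> v = 0 \<longrightarrow> (\<forall>u\<in>perp K. \<beta> \<bullet> u = 0))"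

text \<open>The condition \<open>w ` K \<subseteq> \<Delta>\<close> says that the chamber sent to the fundamental one by \<open>w\<close> has a face that is
  open in \<open>perp K\<close> and is positive with respect to \<open>K\<close>; the last condition puts \<open>v\<close> into the closure of
  this face.\<close>

definition adjacent :: "'a set \<Rightarrow> 'a \<Rightarrow> ('a \<Rightarrow> 'a) \<Rightarrow> bool"
  where "adjacent K v w \<longleftrightarrow> w \<in> W \<and> w ` K \<subseteq> \<Delta> \<and> (\<forall>\<beta>\<in>\<Phi>. 0 < \<beta> \<bullet> v \<longrightarrow> pos (w \<beta>))"

text \<open>Move \<open>v\<close> into the closed fundamental chamber. The choice of the nearest
  chamber makes \<open>winv w\<close> positive on all simple roots vanishing at \<open>w v\<close>,
  and these contain the supports of the images of \<open>K\<close>, so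
  \<open>simple_image_simple\<close> applies.\<close>

lemma adjacent_exists:
  assumes K: "K \<subseteq> \<Delta>" and v: "v \<in> perp K"
  shows "\<exists>w. adjacent K v w"
proof -
  obtain w where w: "w \<in> W" and dom: "\<And>\<alpha>. \<alpha> \<in> \<Delta> \<Longrightarrow> 0 \<le> \<alpha> \<bullet> w v"
    and close: "\<And>\<alpha>. \<alpha> \<in> \<Delta> \<Longrightarrow> \<alpha> \<bullet> w v = 0 \<Longrightarrow> pos (winv w \<alpha>)"
    using dominant_rep_close[of v] by blast
  have dompos: "0 \<le> \<beta> \<bullet> w v" if "pos \<beta>" for \<beta>
    using that dom by (subst inner_expand) (intro sum_nonneg mult_nonneg_nonneg; auto simp: pos_def)
  have "pos (w \<beta>)" if "\<beta> \<in> \<Phi>" "0 < \<beta> \<bullet> v" for \<beta>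
  proof (rule ccontr)
    assume "\<not> pos (w \<beta>)"
    then have "pos (- w \<beta>)" using pos_cases W_Phi[OF w that(1)] by auto
    from dompos[OF this] that(2) show False by (simp add: refl_elems_inner[OF w])
  qed
  moreover have "w \<alpha> \<in> \<Delta>" if a: "\<alpha> \<in> K" for \<alpha>
  proof (rule simple_image_simple[OF w])
    show aD: "\<alpha> \<in> \<Delta>" using a K by auto
    fix \<gamma> assume g: "\<gamma> \<in> \<Delta>" "w \<alpha> \<bullet> coweight \<gamma> \<noteq> 0"
    have z: "w \<alpha> \<bullet> w v = 0" using a v by (simp add: refl_elems_inner[OF w] perp_def)
    have *: "\<gamma> \<bullet> w v = 0" if b: "pos \<beta>" "\<beta> \<bullet> w v = 0" "\<beta> \<bullet> coweight \<gamma> \<noteq> 0" for \<beta>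
      using pos_inner_zero[OF b(1,2) dom g(1)] b(3) by simp
    have "w \<alpha> \<in> \<Phi>" using W_Phi[OF w] aD Delta_Phi by auto
    then have "\<gamma> \<bullet> w v = 0"
      using *[of "w \<alpha>"] *[of "- w \<alpha>"] z g pos_cases by auto
    then show "pos (winv w \<gamma>)" using close g by auto
  qed
  ultimately show ?thesis using w unfolding adjacent_def by blast
qed

lemma generic_zero:
  assumes "generic K v" "K \<subseteq> \<Delta>" "\<beta> \<in> \<Phi>" "\<beta> \<bullet> v = 0"
  shows "\<beta> \<bullet> pt K = 0"
  using assms pt_perp by (auto simp: generic_def)

text \<open>The sign of \<open>w \<beta>\<close> is forced: by \<open>v\<close> when
  \<open>\<beta> \<bullet> v\<close> is nonzero, and otherwise by positivity on \<open>K\<close>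
  through \<open>pos_Levi\<close>. Elements with equal signs on all roots coincide by
  \<open>W_pos_id\<close>.\<close>

lemma adjacent_unique:
  assumes K: "K \<subseteq> \<Delta>" and v: "generic K v" and w: "adjacent K v w" and z: "adjacent K v z"
  shows "w = z"
proof -
  have wW: "w \<in> W" and zW: "z \<in> W" using w z by (auto simp: adjacent_def)
  have "pos (z (winv w \<alpha>))" if a: "\<alpha> \<in> \<Delta>" for \<alpha>
  proof -
    define \<beta> where "\<beta> = winv w \<alpha>"
    have b: "\<beta> \<in> \<Phi>" using W_inv_Phi[OF wW] a Delta_Phi by (auto simp: \<beta>_def)
    have wb: "w \<beta> = \<alpha>" using wW by (simp add: \<beta>_def)
    have wbpos: "pos (w \<beta>)" using pos_simple[OF a] wb by simp
    have "\<not> \<beta> \<bullet> v < 0"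
    proof
      assume "\<beta> \<bullet> v < 0"
      then have "pos (w (- \<beta>))" using w uminus_Phi[OF b] by (auto simp: adjacent_def)
      then show False
        using pos_asym[OF wbpos] refl_elems_neg[OF wW] by simp
    qed
    then consider "0 < \<beta> \<bullet> v" | "\<beta> \<bullet> v = 0" by linarith
    then have "pos (z \<beta>)"
    proof cases
      case 1
      then show ?thesis using z b by (auto simp: adjacent_def)
    next
      case 2
      then have zero: "\<beta> \<bullet> pt K = 0" using generic_zero[OF v K b] by simp
      have "pos \<beta>"
        using pos_Levi[OF wW _ K b zero] wbpos w pos_simple by (auto simp: adjacent_def)
      then show ?thesis
        using pos_Levi[OF zW _ K b zero] z pos_simple by (auto simp: adjacent_def)
    qed
    then show ?thesis by (simp add: \<beta>_def)
  qed
  then have "z \<circ> winv w = id"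
    using W_pos_id[OF refl_elems_comp[OF zW refl_elems_inv[OF wW]]] by simp
  then have "z (winv w (w v)) = w v" for v by (metis comp_apply id_apply)
  then show ?thesis using wW by (auto simp: fun_eq_iff)
qed

text \<open>The interior point of a face of the fundamental chamber, pulled back by
  \<open>w\<close>. It is a generic point of \<open>perp K\<close> whose adjacent element is
  \<open>w\<close>, which inverts the passage from points to elements.\<close>

definition rep_point :: "'a set \<Rightarrow> ('a \<Rightarrow> 'a) \<Rightarrow> 'a"
  where "rep_point K w = winv w (pt (w ` K))"

lemma inner_rep_point: "w \<in> W \<Longrightarrow> \<beta> \<bullet> rep_point K w = w \<beta> \<bullet> pt (w ` K)"
  by (simp add: rep_point_def refl_elems_adjoint)

lemma rep_point:
  assumes w: "w \<in> W" and K: "K \<subseteq> \<Delta>" "w ` K \<subseteq> \<Delta>"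
  shows generic_rep_point: "generic K (rep_point K w)"
    and adjacent_rep_point: "adjacent K (rep_point K w) w"
proof -
  show "adjacent K (rep_point K w) w"
    using w K pos_iff_pt W_Phi[OF w] by (auto simp: adjacent_def inner_rep_point)
  have "rep_point K w \<in> perp K"
    using K(2) by (auto simp: perp_def inner_rep_point[OF w] inner_pt)
  moreover have "\<beta> \<bullet> u = 0" if b: "\<beta> \<in> \<Phi>" "w \<beta> \<bullet> pt (w ` K) = 0" and u: "u \<in> perp K" for \<beta> u
  proof -
    have "w u \<in> perp (w ` K)" using u by (auto simp: perp_def refl_elems_inner[OF w])
    then have "w \<beta> \<bullet> w u = 0" using pt_zero_perp[OF W_Phi[OF w b(1)] b(2)] by auto
    then show ?thesis by (simp add: refl_elems_inner[OF w])
  qed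
  ultimately show "generic K (rep_point K w)"
    by (auto simp: generic_def inner_rep_point[OF w])
qed

end

section \<open>Moebius functions and characteristic polynomials\<close>

lemma moebius_refl: "moebius L X X = 1"
  by (subst moebius.simps) simp

lemma moebius_sum:
  assumes "finite L" "X \<in> L" "Z \<in> L" "Z \<subseteq> X"
  shows "(\<Sum>Y\<in>{Y\<in>L. Y \<subseteq> X \<and> Z \<subseteq> Y}. moebius L X Y) = (if X = Z then 1 else 0)"
proof (cases "X = Z")
  case True
  then have "{Y\<in>L. Y \<subseteq> X \<and> Z \<subseteq> Y} = {X}" using assms by auto
  then show ?thesis using True by (simp add: moebius_refl)
next
  case False
  have "{Y\<in>L. Y \<subseteq> X \<and> Z \<subseteq> Y} = insert Z {Y\<in>L. Y \<subseteq> X \<and> Z \<subset> Y}" using assms by auto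
  then have "(\<Sum>Y\<in>{Y\<in>L. Y \<subseteq> X \<and> Z \<subseteq> Y}. moebius L X Y)
      = moebius L X Z + (\<Sum>Y\<in>{Y\<in>L. Y \<subseteq> X \<and> Z \<subset> Y}. moebius L X Y)"
    using assms(1) by simp
  then show ?thesis using False assms(1) by (simp add: moebius.simps[of L X Z])
qed

text \<open>The defining recursion only makes the Moebius function a one-sided inverse of the zeta function;
  this is the other side.\<close>

lemma moebius_sum_left:
  assumes L: "finite L" and XL: "X \<in> L" and ZL: "Z \<in> L" and "Z \<subseteq> X"
  shows "(\<Sum>Y\<in>{Y\<in>L. Y \<subseteq> X \<and> Z \<subseteq> Y}. moebius L Y Z) = (if X = Z then 1 else 0)"
  using XL \<open>Z \<subseteq> X\<close>
proof (induction "card {Y\<in>L. Y \<subseteq> X}" arbitrary: X rule: less_induct)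
  case less
  define I where "I = {Y\<in>L. Y \<subseteq> X \<and> Z \<subseteq> Y}"
  define h where "h Y = (\<Sum>U\<in>{U\<in>L. U \<subseteq> Y \<and> Z \<subseteq> U}. moebius L U Z)" for Y
  have finI: "finite I" using L by (simp add: I_def)
  have XI: "X \<in> I" and ZI: "Z \<in> I" using less.prems ZL by (auto simp: I_def)
  have h: "h Y = (if Y = Z then 1 else 0)" if "Y \<in> I - {X}" for Y
    unfolding h_def
  proof (rule less.hyps)
    have "{U\<in>L. U \<subseteq> Y} \<subset> {U\<in>L. U \<subseteq> X}" using that less.prems by (auto simp: I_def)
    then show "card {U\<in>L. U \<subseteq> Y} < card {U\<in>L. U \<subseteq> X}" using L by (intro psubset_card_mono) auto
  qed (use that in \<open>auto simp: I_def\<close>)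
  have "(\<Sum>Y\<in>I. moebius L X Y * h Y)
      = (\<Sum>Y\<in>I. \<Sum>U\<in>{U\<in>I. U \<subseteq> Y}. moebius L X Y * moebius L U Z)"
    unfolding h_def sum_distrib_left by (intro sum.cong) (auto simp: I_def)
  also have "\<dots> = (\<Sum>U\<in>I. \<Sum>Y\<in>{Y\<in>I. U \<subseteq> Y}. moebius L X Y * moebius L U Z)"
    by (rule sum.swap_restrict[OF finI finI])
  also have "\<dots> = (\<Sum>U\<in>I. (\<Sum>Y\<in>{Y\<in>L. Y \<subseteq> X \<and> U \<subseteq> Y}. moebius L X Y) * moebius L U Z)"
    unfolding sum_distrib_right by (intro sum.cong) (auto simp: I_def)
  also have "\<dots> = (\<Sum>U\<in>I. (if X = U then 1 else 0) * moebius L U Z)"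
    using less.prems by (intro sum.cong arg_cong2[of _ _ _ _ "(*)"] moebius_sum[OF L] refl)
      (auto simp: I_def)
  also have "\<dots> = (\<Sum>U\<in>I. if X = U then moebius L X Z else 0)" by (intro sum.cong) auto
  also have "\<dots> = moebius L X Z" using finI XI by simp
  finally have 1: "(\<Sum>Y\<in>I. moebius L X Y * h Y) = moebius L X Z" .
  have "(\<Sum>Y\<in>I. moebius L X Y * h Y) = moebius L X X * h X + (\<Sum>Y\<in>I - {X}. moebius L X Y * h Y)"
    using finI XI by (rule sum.remove)
  also have "(\<Sum>Y\<in>I - {X}. moebius L X Y * h Y) = (\<Sum>Y\<in>I - {X}. if Y = Z then moebius L X Z else 0)"
    by (intro sum.cong) (auto simp: h)
  also have "\<dots> = (if X = Z then 0 else moebius L X Z)" using finI ZI by simp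
  finally have "h X = (if X = Z then 1 else 0)" using 1 by (auto simp: moebius_refl split: if_splits)
  then show ?case by (simp add: h_def)
qed

text \<open>The recursion stays between \<open>Y\<close> and \<open>X\<close>, so only the part of
  the family below \<open>X\<close> has to correspond.\<close>

lemma moebius_iso:
  assumes L: "finite L" "finite L'" and X: "X \<in> L" "X' \<in> L'"
    and bij: "bij_betw f {Y\<in>L. Y \<subseteq> X} {Y\<in>L'. Y \<subseteq> X'}"
    and mono: "\<And>Y Z. Y \<in> L \<Longrightarrow> Y \<subseteq> X \<Longrightarrow> Z \<in> L \<Longrightarrow> Z \<subseteq> X \<Longrightarrow> f Y \<subseteq> f Z \<longleftrightarrow> Y \<subseteq> Z"
    and Y: "Y \<in> L" "Y \<subseteq> X"
  shows "moebius L X Y = moebius L' X' (f Y)"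
  using Y
proof (induction "card {Z\<in>L. Y \<subset> Z}" arbitrary: Y rule: less_induct)
  case less
  let ?I = "{Y\<in>L. Y \<subseteq> X}" and ?I' = "{Y\<in>L'. Y \<subseteq> X'}"
  have img: "f ` ?I = ?I'" and inj: "inj_on f ?I" using bij by (auto simp: bij_betw_def)
  have fX: "f X = X'"
  proof
    show "f X \<subseteq> X'" using img X by blast
    have "X' \<in> f ` ?I" using img X by simp
    then obtain U where U: "U \<in> ?I" "f U = X'" by blast
    then show "X' \<subseteq> f X" using mono[of U X] X by auto
  qed
  show ?case
  proof (cases "Y = X")
    case True
    then show ?thesis using fX by (simp add: moebius_refl)
  next
    case False
    then have ne: "f Y \<noteq> X'" using fX inj less.prems X by (metis (mono_tags, lifting) inj_onD mem_Collect_eq order_refl)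
    have set: "f ` {Z\<in>L. Z \<subseteq> X \<and> Y \<subset> Z} = {Z\<in>L'. Z \<subseteq> X' \<and> f Y \<subset> Z}" (is "f ` ?A = ?B")
    proof (intro equalityI subsetI)
      fix V assume "V \<in> f ` ?A"
      then obtain Z where Z: "Z \<in> L" "Z \<subseteq> X" "Y \<subset> Z" "V = f Z" by auto
      moreover have "V \<in> ?I'" using Z img by blast
      moreover have "f Y \<subseteq> V" "\<not> V \<subseteq> f Y" using Z less.prems mono[of Y Z] mono[of Z Y] by auto
      ultimately show "V \<in> ?B" by auto
    next
      fix V assume V: "V \<in> ?B"
      then have "V \<in> f ` ?I" unfolding img by simp
      then obtain Z where Z: "Z \<in> L" "Z \<subseteq> X" "V = f Z" by blast
      moreover have "Y \<subseteq> Z" using V Z less.prems mono[of Y Z] by blast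
      moreover have "\<not> Z \<subseteq> Y" using V Z less.prems mono[of Z Y] by blast
      ultimately have "Z \<in> ?A" by auto
      then show "V \<in> f ` ?A" using Z(3) by blast
    qed
    have "(\<Sum>Z\<in>?B. moebius L' X' Z) = (\<Sum>Z\<in>?A. moebius L' X' (f Z))"
      unfolding set[symmetric] by (rule sum.reindex[unfolded o_def]) (rule inj_on_subset[OF inj], auto)
    also have "\<dots> = (\<Sum>Z\<in>?A. moebius L X Z)"
    proof (rule sum.cong[OF refl], rule less.hyps[symmetric])
      fix Z assume Z: "Z \<in> ?A"
      then have "{U\<in>L. Z \<subset> U} \<subset> {U\<in>L. Y \<subset> U}" by auto
      then show "card {U\<in>L. Z \<subset> U} < card {U\<in>L. Y \<subset> U}" using L by (intro psubset_card_mono) auto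
    qed auto
    finally show ?thesis using False ne L by (simp add: moebius.simps[of L X Y] moebius.simps[of L' X' "f Y"])
  qed
qed

section \<open>Flats and characteristic polynomials of restrictions\<close>

lemma arrangement_lattice_perp: "arrangement_lattice \<Phi> = perp ` Pow \<Phi>"
proof -
  have "(\<Inter>\<alpha>\<in>A. {v. \<alpha> \<bullet> v = 0}) = perp A" for A :: "'a set" by (auto simp: perp_def)
  then show ?thesis by (simp add: arrangement_lattice_def)
qed

text \<open>After swapping the sums, the first argument of \<open>moebius\<close> runs between
  \<open>Z\<close> and \<open>X\<close> while the second is fixed, so
  \<open>moebius_sum_left\<close> is the version that collapses them.\<close>

lemma upper_char_poly_sum:
  assumes "finite \<Phi>" "X \<in> arrangement_lattice \<Phi>"
  shows "(\<Sum>Y\<in>{Y\<in>arrangement_lattice \<Phi>. Y \<subseteq> X}. upper_char_poly \<Phi> Y x) = x ^ dim X"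
proof -
  define L where "L = arrangement_lattice \<Phi>"
  have L: "finite L" using assms by (simp add: L_def arrangement_lattice_def)
  define I where "I = {Y\<in>L. Y \<subseteq> X}"
  have I: "finite I" "X \<in> I" using L assms by (auto simp: I_def L_def)
  have "(\<Sum>Y\<in>I. upper_char_poly \<Phi> Y x)
      = (\<Sum>Y\<in>I. \<Sum>Z\<in>{Z\<in>I. Z \<subseteq> Y}. of_int (moebius L Y Z) * x ^ dim Z)"
    unfolding upper_char_poly_def Let_def L_def[symmetric]
    by (intro sum.cong) (auto simp: I_def)
  also have "\<dots> = (\<Sum>Z\<in>I. \<Sum>Y\<in>{Y\<in>I. Z \<subseteq> Y}. of_int (moebius L Y Z) * x ^ dim Z)"
    by (rule sum.swap_restrict[OF I(1) I(1)])
  also have "\<dots> = (\<Sum>Z\<in>I. of_int (\<Sum>Y\<in>{Y\<in>L. Y \<subseteq> X \<and> Z \<subseteq> Y}. moebius L Y Z) * x ^ dim Z)"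
    unfolding of_int_sum sum_distrib_right by (intro sum.cong) (auto simp: I_def)
  also have "\<dots> = (\<Sum>Z\<in>I. of_int (if X = Z then 1 else 0) * x ^ dim Z)"
    using assms(2) by (intro sum.cong arg_cong2[of _ _ _ _ "(*)"] arg_cong[of _ _ of_int]
        moebius_sum_left[OF L] refl) (auto simp: I_def L_def)
  also have "\<dots> = (\<Sum>Z\<in>I. if X = Z then x ^ dim X else 0)" by (intro sum.cong) auto
  also have "\<dots> = x ^ dim X" using I by simp
  finally show ?thesis by (simp add: I_def L_def)
qed

lemma upper_char_poly_iso:
  assumes fin: "finite \<Phi>" and X: "X \<in> arrangement_lattice \<Phi>" "X' \<in> arrangement_lattice \<Phi>"
    and f: "linear f" "inj_on f X"
    and img: "image f ` {Y\<in>arrangement_lattice \<Phi>. Y \<subseteq> X} = {Y\<in>arrangement_lattice \<Phi>. Y \<subseteq> X'}"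
  shows "upper_char_poly \<Phi> X x = upper_char_poly \<Phi> X' x"
proof -
  define L where "L = arrangement_lattice \<Phi>"
  have L: "finite L" using assms by (simp add: L_def arrangement_lattice_def)
  have sub: "f ` Y \<subseteq> f ` Z \<longleftrightarrow> Y \<subseteq> Z" if "Y \<subseteq> X" "Z \<subseteq> X" for Y Z
    using inj_on_image_subset_iff[OF f(2)] that by blast
  have inj: "inj_on (image f) {Y\<in>L. Y \<subseteq> X}"
  proof (rule inj_onI)
    fix Y Z assume "Y \<in> {Y\<in>L. Y \<subseteq> X}" "Z \<in> {Y\<in>L. Y \<subseteq> X}" "f ` Y = f ` Z"
    then show "Y = Z" using sub[of Y Z] sub[of Z Y] by blast
  qed
  have bij: "bij_betw (image f) {Y\<in>L. Y \<subseteq> X} {Y\<in>L. Y \<subseteq> X'}"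
    using inj img by (auto simp: bij_betw_def L_def)
  have dim: "dim (f ` Y) = dim Y" if "Y \<in> L" "Y \<subseteq> X" for Y
  proof (rule dim_image_eq[OF f(1)])
    have "subspace Y" using that(1) by (auto simp: L_def arrangement_lattice_perp subspace_perp)
    then have sp: "span Y = Y" by (simp only: span_eq_iff)
    show "inj_on f (span Y)" unfolding sp by (rule inj_on_subset[OF f(2) that(2)])
  qed
  have "(\<Sum>Y\<in>{Y\<in>L. Y \<subseteq> X'}. of_int (moebius L X' Y) * x ^ dim Y)
      = (\<Sum>Y\<in>{Y\<in>L. Y \<subseteq> X}. of_int (moebius L X' (f ` Y)) * x ^ dim (f ` Y))"
    by (rule sum.reindex_bij_betw[OF bij, symmetric])
  also have "\<dots> = (\<Sum>Y\<in>{Y\<in>L. Y \<subseteq> X}. of_int (moebius L X Y) * x ^ dim Y)"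
  proof (rule sum.cong[OF refl])
    fix Y assume Y: "Y \<in> {Y\<in>L. Y \<subseteq> X}"
    have "moebius L X Y = moebius L X' (f ` Y)"
      by (rule moebius_iso[OF L L _ _ bij]) (use X Y sub in \<open>auto simp: L_def\<close>)
    then show "of_int (moebius L X' (f ` Y)) * x ^ dim (f ` Y) = of_int (moebius L X Y) * x ^ dim Y"
      using dim Y by simp
  qed
  finally show ?thesis by (simp add: upper_char_poly_def L_def)
qed

section \<open>Parabolic subgroups\<close>

context based_roots
begin

text \<open>The number \<open>card (tset J K)\<close> is \<open>a(J, K)\<close> in the introduction. It counts the chambers of the
  arrangement restricted to \<open>perp K\<close> on which all elements of \<open>J\<close> are nonnegative.\<close>

definition tset :: "'a set \<Rightarrow> 'a set \<Rightarrow> ('a \<Rightarrow> 'a) set"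
  where "tset J K = {w \<in> W. w ` K \<subseteq> \<Delta> \<and> (\<forall>\<alpha>\<in>J. pos (w \<alpha>))}"

lemma finite_tset: "finite (tset J K)"
  using finite_subset[OF _ finite_W, of "tset J K"] by (auto simp: tset_def)

lemma tset_same: "tset J J = {w \<in> W. w ` J \<subseteq> \<Delta>}"
  using pos_simple by (auto simp: tset_def)

lemma X_set_tset:
  assumes "J \<subseteq> \<Delta>"
  shows "{w \<in> X_set \<Phi> \<Delta> J. w ` K \<subseteq> \<Delta>} = tset J K"
proof -
  have "\<not> pos (- w \<alpha>) \<longleftrightarrow> pos (w \<alpha>)" if "w \<in> W" "\<alpha> \<in> J" for w \<alpha>
    using pos_asym[of "w \<alpha>"] pos_cases[of "w \<alpha>"] W_Phi that assms Delta_Phi by blast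
  moreover have "Des \<Phi> \<Delta> w \<inter> J = {} \<longleftrightarrow> (\<forall>\<alpha>\<in>J. \<not> pos (- w \<alpha>))" for w
    using assms by (auto simp: Des_def negative_roots_iff)
  ultimately have "Des \<Phi> \<Delta> w \<inter> J = {} \<longleftrightarrow> (\<forall>\<alpha>\<in>J. pos (w \<alpha>))" if "w \<in> W" for w
    using that by blast
  then show ?thesis by (auto simp: X_set_def tset_def)
qed

abbreviation cls where "cls \<equiv> conj_class \<Phi> \<Delta>"

lemma conj_class_iff: "K' \<in> cls K \<longleftrightarrow> K \<subseteq> \<Delta> \<and> K' \<subseteq> \<Delta> \<and> (\<exists>w\<in>W. w ` K = K')"
  by (auto simp: conj_class_def base_conj_def)

lemma conj_class_self: "K \<subseteq> \<Delta> \<Longrightarrow> K \<in> cls K"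
  unfolding conj_class_iff by (intro conjI bexI[OF _ refl_elems_id]) auto

lemma finite_conj_class: "finite (cls K)"
  by (rule finite_subset[of _ "Pow \<Delta>"]) (use conj_class_iff in blast, simp add: finite_Delta)

lemma equiv_base_conj: "equiv (Pow \<Delta>) (base_conj \<Phi> \<Delta>)"
proof (rule equivI)
  show "base_conj \<Phi> \<Delta> \<subseteq> Pow \<Delta> \<times> Pow \<Delta>" by (auto simp: base_conj_def)
  show "refl_on (Pow \<Delta>) (base_conj \<Phi> \<Delta>)"
    unfolding refl_on_def base_conj_def
    by (auto intro!: bexI[OF _ refl_elems_id])
  show "sym (base_conj \<Phi> \<Delta>)"
  proof (rule symI)
    fix J K assume "(J, K) \<in> base_conj \<Phi> \<Delta>"
    then obtain w where w: "J \<subseteq> \<Delta>" "K \<subseteq> \<Delta>" "w \<in> W" "w ` J = K" by (auto simp: base_conj_def)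
    then have "winv w ` K = J" by (auto simp: image_image)
    then show "(K, J) \<in> base_conj \<Phi> \<Delta>"
      using w(1-3) refl_elems_inv unfolding base_conj_def by blast
  qed
  show "trans (base_conj \<Phi> \<Delta>)"
  proof (rule transI)
    fix J K I assume "(J, K) \<in> base_conj \<Phi> \<Delta>" "(K, I) \<in> base_conj \<Phi> \<Delta>"
    then obtain w z where "J \<subseteq> \<Delta>" "I \<subseteq> \<Delta>" "w \<in> W" "z \<in> W" "w ` J = K" "z ` K = I"
      by (auto simp: base_conj_def)
    then have "z \<circ> w \<in> W" "(z \<circ> w) ` J = I" by (simp_all only: refl_elems_comp image_comp[symmetric])
    then show "(J, I) \<in> base_conj \<Phi> \<Delta>" using \<open>J \<subseteq> \<Delta>\<close> \<open>I \<subseteq> \<Delta>\<close> unfolding base_conj_def by blast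
  qed
qed

lemma conj_class_eq: "K' \<in> cls K \<Longrightarrow> cls K' = cls K"
  using equiv_class_eq[OF equiv_base_conj, of K K'] by (auto simp: conj_class_def)

lemma conj_class_card:
  assumes "I \<in> cls K"
  shows "card I = card K"
proof -
  obtain w where w: "w \<in> W" "w ` K = I" using assms unfolding conj_class_iff by blast
  show ?thesis unfolding w(2)[symmetric] by (rule card_image[OF refl_elems_inj_on[OF w(1)]])
qed

lemma conj_class_subset: "I \<in> cls K \<Longrightarrow> I \<subseteq> \<Delta>"
  unfolding conj_class_iff by blast

lemma W_perp:
  assumes w: "w \<in> W"
  shows "w ` perp K = perp (w ` K)"
proof (intro equalityI subsetI)
  fix v assume "v \<in> w ` perp K"
  then show "v \<in> perp (w ` K)" by (auto simp: perp_def refl_elems_inner[OF w])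
next
  fix v assume v: "v \<in> perp (w ` K)"
  then have "winv w v \<in> perp K" by (auto simp: perp_def refl_elems_adjoint[OF w, symmetric])
  then show "v \<in> w ` perp K" using w by (intro image_eqI[of _ _ "winv w v"]) auto
qed

lemma card_tset_conj:
  assumes w: "w \<in> W"
  shows "card (tset (w ` J) (w ` K)) = card (tset J K)"
proof -
  have "bij_betw (\<lambda>u. u \<circ> w) (tset (w ` J) (w ` K)) (tset J K)"
  proof (rule bij_betw_byWitness[where f' = "\<lambda>u. u \<circ> winv w"])
    show "\<forall>u\<in>tset (w ` J) (w ` K). u \<circ> w \<circ> winv w = u"
      using w by (auto simp: fun_eq_iff)
    show "\<forall>u\<in>tset J K. u \<circ> winv w \<circ> w = u"
      using w by (auto simp: fun_eq_iff)
    show "(\<lambda>u. u \<circ> w) ` tset (w ` J) (w ` K) \<subseteq> tset J K"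
      using w by (auto simp: tset_def refl_elems_comp)
    show "(\<lambda>u. u \<circ> winv w) ` tset J K \<subseteq> tset (w ` J) (w ` K)"
      using w by (auto simp: tset_def refl_elems_comp refl_elems_inv)
  qed
  then show ?thesis by (rule bij_betw_same_card)
qed

lemma vanish_pt: "K \<subseteq> \<Delta> \<Longrightarrow> \<beta> \<in> \<Phi> \<Longrightarrow> (\<forall>v\<in>perp K. \<beta> \<bullet> v = 0) \<longleftrightarrow> \<beta> \<bullet> pt K = 0"
  using pt_perp pt_zero_perp by blast

lemma simple_vanish: "\<alpha> \<in> \<Delta> \<Longrightarrow> \<alpha> \<bullet> pt K = 0 \<longleftrightarrow> \<alpha> \<in> K"
  by (simp add: inner_pt)

text \<open>The root \<open>winv w \<alpha>\<close> vanishes on \<open>perp J\<close>, so its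
  support lies in \<open>J\<close>, where \<open>w\<close> is positive; apply
  \<open>simple_image_simple\<close> to the inverse.\<close>

lemma simple_pull_back:
  assumes w: "w \<in> W" and J: "J \<subseteq> \<Delta>" "\<forall>\<gamma>\<in>J. pos (w \<gamma>)"
    and a: "\<alpha> \<in> \<Delta>" "\<forall>v\<in>perp J. \<alpha> \<bullet> w v = 0"
  shows "winv w \<alpha> \<in> J"
proof -
  define \<beta> where "\<beta> = winv w \<alpha>"
  have iw: "winv w \<in> W" using refl_elems_inv[OF w] .
  have b: "\<beta> \<in> \<Phi>" using W_inv_Phi[OF w] a Delta_Phi by (auto simp: \<beta>_def)
  have "\<forall>v\<in>perp J. \<beta> \<bullet> v = 0"
    using a(2) by (simp add: \<beta>_def refl_elems_adjoint[OF iw] refl_elems_inv_inv[OF w])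
  then have b0: "\<beta> \<bullet> pt J = 0" using vanish_pt[OF J(1) b] by simp
  have "winv w \<alpha> \<in> \<Delta>"
  proof (rule simple_image_simple[OF iw a(1)])
    fix \<gamma> assume g: "\<gamma> \<in> \<Delta>" "winv w \<alpha> \<bullet> coweight \<gamma> \<noteq> 0"
    then have "\<gamma> \<in> J" using pt_zero_coeff[OF b b0 g(1)] by (auto simp: \<beta>_def)
    then show "pos (winv (winv w) \<gamma>)" using J(2) by (simp add: refl_elems_inv_inv[OF w])
  qed
  then show ?thesis using b0 simple_vanish by (auto simp: \<beta>_def)
qed

text \<open>The images of \<open>J\<close> under \<open>w\<close> and of \<open>K\<close> under
  \<open>z\<close> are both the base of the same positive system, formed by the positive roots that
  vanish on the common flat. A positive system has only one base.\<close>

lemma parabolic_eq: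
  assumes w: "w \<in> W" and z: "z \<in> W" and J: "J \<subseteq> \<Delta>" "\<forall>\<alpha>\<in>J. pos (w \<alpha>)"
    and K: "K \<subseteq> \<Delta>" "\<forall>\<alpha>\<in>K. pos (z \<alpha>)" and eq: "w ` perp J = z ` perp K"
  shows "(winv z \<circ> w) ` J = K"
proof -
  have *: "(winv z \<circ> w) ` J \<subseteq> K"
    if w: "w \<in> W" and z: "z \<in> W" and J: "J \<subseteq> \<Delta>" "\<forall>\<alpha>\<in>J. pos (w \<alpha>)"
    and K: "K \<subseteq> \<Delta>" "\<forall>\<alpha>\<in>K. pos (z \<alpha>)" and eq: "w ` perp J = z ` perp K" for w z J K
  proof
    fix \<beta> assume "\<beta> \<in> (winv z \<circ> w) ` J"
    then obtain \<alpha> where a: "\<alpha> \<in> J" "\<beta> = winv z (w \<alpha>)" by auto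
    have iz: "winv z \<in> W" and iw: "winv w \<in> W"
      using refl_elems_inv w z by auto
    have u: "winv z \<circ> w \<in> W" using iz w by (rule refl_elems_comp)
    have aP: "w \<alpha> \<in> \<Phi>" using W_Phi[OF w] a J Delta_Phi by auto
    have bP: "\<beta> \<in> \<Phi>" using W_inv_Phi[OF z aP] a by simp
    have "\<beta> \<bullet> v = 0" if v: "v \<in> perp K" for v
    proof -
      have "z v \<in> w ` perp J" using eq v by auto
      then obtain u where "u \<in> perp J" "z v = w u" by auto
      then have "w \<alpha> \<bullet> z v = 0" using a by (simp add: refl_elems_inner[OF w] perp_def)
      then show ?thesis by (simp add: a refl_elems_adjoint[OF iz] refl_elems_inv_inv[OF z])
    qed
    then have b0: "\<beta> \<bullet> pt K = 0" using vanish_pt[OF K(1) bP] by auto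
    have "(winv z \<circ> w) \<alpha> \<in> \<Delta>"
    proof (rule simple_image_simple[OF u])
      show "\<alpha> \<in> \<Delta>" using a J by auto
      fix \<gamma> assume g: "\<gamma> \<in> \<Delta>" "(winv z \<circ> w) \<alpha> \<bullet> coweight \<gamma> \<noteq> 0"
      then have gK: "\<gamma> \<in> K" using pt_zero_coeff[OF bP b0 g(1)] a by auto
      define \<delta> where "\<delta> = winv w (z \<gamma>)"
      have zP: "z \<gamma> \<in> \<Phi>" using W_Phi[OF z] g Delta_Phi by auto
      have dP: "\<delta> \<in> \<Phi>" using W_inv_Phi[OF w zP] by (simp add: \<delta>_def)
      have "\<delta> \<bullet> v = 0" if v: "v \<in> perp J" for v
      proof -
        have "w v \<in> z ` perp K" using eq v by auto
        then obtain u where "u \<in> perp K" "w v = z u" by auto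
        then have "z \<gamma> \<bullet> w v = 0" using gK by (simp add: refl_elems_inner[OF z] perp_def)
        then show ?thesis by (simp add: \<delta>_def refl_elems_adjoint[OF iw] refl_elems_inv_inv[OF w])
      qed
      then have "\<delta> \<bullet> pt J = 0" using vanish_pt[OF J(1) dP] by auto
      then have "pos \<delta>" using pos_Levi[OF w J(2,1) dP] K(2) gK w by (simp add: \<delta>_def)
      moreover have "winv (winv z \<circ> w) \<gamma> = \<delta>"
        using refl_elems_inv_apply(1)[OF u, of \<delta>] w z by (simp add: \<delta>_def)
      ultimately show "pos (winv (winv z \<circ> w) \<gamma>)" by simp
    qed
    then show "\<beta> \<in> K" using b0 simple_vanish a by auto
  qed
  show ?thesis
  proof
    show "(winv z \<circ> w) ` J \<subseteq> K" using * assms by blast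
    show "K \<subseteq> (winv z \<circ> w) ` J"
    proof
      fix \<gamma> assume "\<gamma> \<in> K"
      moreover have "(winv w \<circ> z) ` K \<subseteq> J"
        by (rule *) (use assms in auto)
      ultimately have "winv w (z \<gamma>) \<in> J" by auto
      then show "\<gamma> \<in> (winv z \<circ> w) ` J"
        using w z by (intro image_eqI[of _ _ "winv w (z \<gamma>)"]) auto
    qed
  qed
qed

text \<open>Since \<open>z\<close> fixes \<open>pt K\<close>, simple roots outside \<open>K\<close>
  stay positive at this point, which extends positivity from \<open>K\<close> to all of
  \<open>\<Delta>\<close>.\<close>

lemma refl_elems_positive_id:
  assumes K: "K \<subseteq> \<Delta>" and z: "z \<in> refl_elems K" "\<forall>\<alpha>\<in>K. pos (z \<alpha>)"
  shows "z = id"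
proof (rule W_pos_id)
  show zW: "z \<in> W" using z sub_W[OF K] by auto
  fix \<alpha> assume a: "\<alpha> \<in> \<Delta>"
  show "pos (z \<alpha>)"
  proof (cases "\<alpha> \<in> K")
    case False
    have "z (pt K) = pt K"
      using pt_perp[OF K] K zero_notin_Delta by (intro refl_elems_perp[OF _ z(1)]) auto
    then have "z \<alpha> \<bullet> pt K = \<alpha> \<bullet> pt K" using refl_elems_inner[OF zW, of \<alpha> "pt K"] by simp
    then have "0 < z \<alpha> \<bullet> pt K" using a False by (simp add: inner_pt)
    then show ?thesis using pos_iff_pt W_Phi[OF zW] a Delta_Phi by blast
  qed (use z in auto)
qed

section \<open>Normalizers of parabolic subgroups\<close>

lemma normalizer_iff:
  assumes "K \<subseteq> \<Delta>"
  shows "g \<in> normalizer (refl_group \<Phi>) (refl_elems K) \<longleftrightarrow>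
    g \<in> W \<and> (\<lambda>h. g \<circ> h \<circ> winv g) ` refl_elems K = refl_elems K"
proof -
  interpret B: group "BijGroup (UNIV :: 'a set)" by (rule group_BijGroup)
  have mult: "f \<otimes>\<^bsub>refl_group \<Phi>\<^esub> h = f \<circ> h" if "f \<in> W" "h \<in> W" for f h
    using that[THEN refl_elems_bij] by (simp add: refl_group_def)
  have inv: "inv\<^bsub>refl_group \<Phi>\<^esub> f = winv f" if "f \<in> W" for f
  proof -
    have "inv\<^bsub>refl_group \<Phi>\<^esub> f = inv\<^bsub>BijGroup UNIV\<^esub> f"
      using that by (simp add: refl_group_def B.inv_subgroup_generated)
    then show ?thesis using refl_elems_bij[OF that] by (simp add: BijGroup_UNIV_inv)
  qed
  have sub: "refl_elems K \<subseteq> W" using sub_W[OF assms] .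
  have "g <#\<^bsub>refl_group \<Phi>\<^esub> refl_elems K #>\<^bsub>refl_group \<Phi>\<^esub> (inv\<^bsub>refl_group \<Phi>\<^esub> g)
      = (\<lambda>h. g \<circ> h \<circ> winv g) ` refl_elems K" if g: "g \<in> W"
  proof -
    have "g <#\<^bsub>refl_group \<Phi>\<^esub> refl_elems K = (\<lambda>h. g \<circ> h) ` refl_elems K"
      using sub g by (force simp: l_coset_def mult)
    moreover have "A #>\<^bsub>refl_group \<Phi>\<^esub> (inv\<^bsub>refl_group \<Phi>\<^esub> g) = (\<lambda>h. h \<circ> winv g) ` A"
      if "A \<subseteq> W" for A
      using that g by (force simp: r_coset_def inv mult refl_elems_inv)
    moreover have "(\<lambda>h. g \<circ> h) ` refl_elems K \<subseteq> W" using g sub by (auto simp: refl_elems_comp)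
    ultimately show ?thesis by (simp add: image_image)
  qed
  then show ?thesis using sub by (auto simp: normalizer_def stabilizer_def)
qed

text \<open>The normalizer is the semidirect product of \<open>refl_elems K\<close> and the
  stabilizer of \<open>K\<close>. The factors meet trivially by
  \<open>refl_elems_positive_id\<close>.\<close>

lemma card_normalizer:
  assumes K: "K \<subseteq> \<Delta>"
  shows "card (normalizer (refl_group \<Phi>) (refl_elems K)) = card (refl_elems K) * card {u\<in>W. u ` K = K}"
proof -
  let ?N = "normalizer (refl_group \<Phi>) (refl_elems K)" and ?S = "{u\<in>W. u ` K = K}"
  have sub: "refl_elems K \<subseteq> W" using sub_W[OF K] .
  have finK: "finite (refl_elems K)" using finite_subset[OF sub finite_W] .
  have K0: "0 \<notin> K" using K zero_notin_Delta by auto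
  have "bij_betw (\<lambda>(y, u). u \<circ> y) (refl_elems K \<times> ?S) ?N"
    unfolding bij_betw_def
  proof (intro conjI equalityI subsetI)
    show "inj_on (\<lambda>(y, u). u \<circ> y) (refl_elems K \<times> ?S)"
    proof (rule inj_onI, clarify)
      fix y u y' u' assume y: "y \<in> refl_elems K" "y' \<in> refl_elems K" and u: "u \<in> W" "u ` K = K"
        "u' \<in> W" "u' ` K = K" and eq: "u \<circ> y = u' \<circ> y'"
      define z where "z = y' \<circ> winv y"
      have zK: "z \<in> refl_elems K" using y by (auto simp: z_def intro!: refl_elems_comp refl_elems_inv)
      have "u' (z v) = u v" for v
        using fun_cong[OF eq, of "winv y v"] y by (simp add: z_def)
      then have zu: "z v = winv u' (u v)" for v using u by (metis refl_elems_inv_apply(1))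
      have "z \<alpha> \<in> K" if "\<alpha> \<in> K" for \<alpha>
      proof -
        have "u \<alpha> \<in> u' ` K" using u that by blast
        then obtain \<gamma> where "\<gamma> \<in> K" "u \<alpha> = u' \<gamma>" by blast
        then show ?thesis using u by (simp add: zu)
      qed
      then have "z = id" using refl_elems_positive_id[OF K zK] K pos_simple by blast
      then have "y' (winv y v) = v" for v by (metis z_def comp_apply id_apply)
      then have "y' = y" using y by (metis ext refl_elems_inv_apply(1))
      moreover from this have "u' = u" using fun_cong[OF eq] y by (metis comp_apply ext refl_elems_inv_apply(2))
      ultimately show "y = y' \<and> u = u'" by simp
    qed
  next
    fix g assume "g \<in> (\<lambda>(y, u). u \<circ> y) ` (refl_elems K \<times> ?S)"
    then obtain y u where y: "y \<in> refl_elems K" and u: "u \<in> W" "u ` K = K" and g: "g = u \<circ> y" by auto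
    have yW: "y \<in> W" using y sub by auto
    have gW: "g \<in> W" using u yW by (simp only: g refl_elems_comp)
    have ig: "winv g v = winv y (winv u v)" for v
      using refl_elems_inv_apply(1)[OF gW, of "winv y (winv u v)"] yW u by (simp add: g)
    have "(\<lambda>h. g \<circ> h \<circ> winv g) ` refl_elems K \<subseteq> refl_elems K"
    proof clarify
      fix h assume h: "h \<in> refl_elems K"
      have "y \<circ> h \<circ> winv y \<in> refl_elems K"
        using y h by (intro refl_elems_comp refl_elems_inv)
      from refl_elems_conj_group[OF u(1) this]
      have "u \<circ> (y \<circ> h \<circ> winv y) \<circ> winv u \<in> refl_elems K" by (simp only: u)
      moreover have "g \<circ> h \<circ> winv g = u \<circ> (y \<circ> h \<circ> winv y) \<circ> winv u"
        unfolding fun_eq_iff comp_apply ig by (simp add: g)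
      ultimately show "g \<circ> h \<circ> winv g \<in> refl_elems K" by simp
    qed
    moreover have "inj_on (\<lambda>h. g \<circ> h \<circ> winv g) (refl_elems K)"
    proof (rule inj_onI, rule ext)
      fix h h' v assume eq: "g \<circ> h \<circ> winv g = g \<circ> h' \<circ> winv g"
      show "h v = h' v"
        using fun_cong[OF eq, of "g v"] gW by (simp add: inj_eq[OF bij_is_inj[OF refl_elems_bij[OF gW]]])
    qed
    ultimately have "(\<lambda>h. g \<circ> h \<circ> winv g) ` refl_elems K = refl_elems K"
      using finK by (intro endo_inj_surj)
    then show "g \<in> ?N" using gW normalizer_iff[OF K] by simp
  next
    fix g assume "g \<in> ?N"
    then have g: "g \<in> W" and norm: "(\<lambda>h. g \<circ> h \<circ> winv g) ` refl_elems K = refl_elems K"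
      using normalizer_iff[OF K] by auto
    \<comment> \<open>A normalizing element preserves the fixed space of the group, and that space
      is \<open>perp K\<close>.\<close>
    have gperp: "g v \<in> perp K" if v: "v \<in> perp K" for v
    proof -
      have "z (g v) = g v" if z: "z \<in> refl_elems K" for z
      proof -
        obtain h where h: "h \<in> refl_elems K" "z = g \<circ> h \<circ> winv g" using z norm by auto
        then show ?thesis using refl_elems_perp[OF K0 h(1) v] g by simp
      qed
      then show ?thesis using fix_space_refl_elems[OF K0] by (auto simp: fix_space_def)
    qed
    \<comment> \<open>Chosen to make \<open>g \<circ> winv y\<close> positive on \<open>K\<close>.
      It still preserves \<open>perp K\<close>, so comparing it with the identity in
      \<open>parabolic_eq\<close> shows that it permutes \<open>K\<close>.\<close>
    obtain y where y: "y \<in> refl_elems K" "\<forall>\<alpha>\<in>K. 0 \<le> \<alpha> \<bullet> y (winv g (pt {}))"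
      using dominant_rep[OF K] by blast
    have yW: "y \<in> W" using y sub by auto
    define u where "u = g \<circ> winv y"
    have u: "u \<in> W" unfolding u_def using g yW by (intro refl_elems_comp refl_elems_inv)
    have upos: "\<forall>\<alpha>\<in>K. pos (u \<alpha>)"
    proof
      fix \<alpha> assume a: "\<alpha> \<in> K"
      have "u \<alpha> \<bullet> pt {} = \<alpha> \<bullet> y (winv g (pt {}))"
        by (simp add: u_def refl_elems_adjoint[OF g] refl_elems_adjoint[OF refl_elems_inv[OF yW]]
            refl_elems_inv_inv[OF yW])
      then show "pos (u \<alpha>)" using y a pos_iff W_Phi[OF u] K Delta_Phi by (metis subsetD)
    qed
    have "u ` perp K \<subseteq> perp K"
      using gperp refl_elems_perp[OF K0 refl_elems_inv[OF y(1)]] by (auto simp: u_def)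
    moreover have "u ` perp K = perp K"
      using calculation refl_elems_linear[OF u] dim_image_eq[OF refl_elems_linear[OF u] refl_elems_inj_on[OF u]]
      by (intro subspace_dim_equal) (simp_all add: subspace_perp linear_subspace_image)
    ultimately have "(winv id \<circ> u) ` K = K"
      using K pos_simple u upos refl_elems_id by (intro parabolic_eq) auto
    then have "u ` K = K" by (simp add: inv_id)
    moreover have "g = u \<circ> y" using y by (auto simp: u_def fun_eq_iff)
    ultimately show "g \<in> (\<lambda>(y, u). u \<circ> y) ` (refl_elems K \<times> ?S)" using u y by auto
  qed
  from bij_betw_same_card[OF this] show ?thesis by (simp add: card_cartesian_product)
qed

text \<open>Sorted by the image of \<open>K\<close>, the elements form left cosets of the stabilizer
  of \<open>K\<close>, one for each member of the class.\<close>

lemma card_tset_same: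
  assumes K: "K \<subseteq> \<Delta>"
  shows "card (tset K K) = card (cls K) * card {u\<in>W. u ` K = K}"
proof -
  have "tset K K = (\<Union>K'\<in>cls K. {w\<in>W. w ` K = K'})"
    using K by (intro equalityI subsetI; simp add: tset_same conj_class_iff; blast)
  also have "card \<dots> = (\<Sum>K'\<in>cls K. card {w\<in>W. w ` K = K'})"
    using finite_W by (intro card_UN_disjoint) (auto simp: finite_conj_class)
  also have "\<dots> = (\<Sum>K'\<in>cls K. card {u\<in>W. u ` K = K})"
  proof (rule sum.cong[OF refl])
    fix K' assume "K' \<in> cls K"
    then obtain z where z: "z \<in> W" "z ` K = K'" by (auto simp: conj_class_iff)
    have zK: "winv z ` K' = K" using z by (auto simp: image_image)
    have "bij_betw (\<lambda>u. z \<circ> u) {u\<in>W. u ` K = K} {w\<in>W. w ` K = K'}"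
    proof (rule bij_betw_byWitness[where f' = "\<lambda>w. winv z \<circ> w"])
      show "\<forall>u\<in>{u\<in>W. u ` K = K}. winv z \<circ> (z \<circ> u) = u"
        using z by (auto simp: fun_eq_iff)
      show "\<forall>u\<in>{w\<in>W. w ` K = K'}. z \<circ> (winv z \<circ> u) = u"
        using z by (auto simp: fun_eq_iff)
      show "(\<lambda>u. z \<circ> u) ` {u\<in>W. u ` K = K} \<subseteq> {w\<in>W. w ` K = K'}"
      proof clarify
        fix u assume "u \<in> W" "u ` K = K"
        then show "z \<circ> u \<in> W \<and> (z \<circ> u) ` K = K'" using z by (simp only: refl_elems_comp image_comp[symmetric] simp_thms)
      qed
      show "(\<lambda>w. winv z \<circ> w) ` {w\<in>W. w ` K = K'} \<subseteq> {u\<in>W. u ` K = K}"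
      proof (intro image_subsetI CollectI)
        fix w assume "w \<in> {w\<in>W. w ` K = K'}"
        then show "winv z \<circ> w \<in> W \<and> (winv z \<circ> w) ` K = K"
          using z(1) zK by (simp only: mem_Collect_eq refl_elems_comp refl_elems_inv image_comp[symmetric] simp_thms)
      qed
    qed
    then show "card {w\<in>W. w ` K = K'} = card {u\<in>W. u ` K = K}"
      by (rule bij_betw_same_card[symmetric])
  qed
  finally show ?thesis by simp
qed

lemma card_tset_pos:
  assumes "K \<subseteq> \<Delta>"
  shows "0 < card (tset K K)"
proof -
  have "id \<in> tset K K" using assms refl_elems_id by (auto simp: tset_same)
  then show ?thesis using finite_tset card_gt_0_iff by blast
qed

section \<open>Averaging over a conjugacy class\<close>

abbreviation Flats where "Flats \<equiv> arrangement_lattice \<Phi>"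

definition chi :: "real \<Rightarrow> 'a set \<Rightarrow> real"
  where "chi x K = upper_char_poly \<Phi> (perp K) x"

lemma finite_Flats: "finite Flats"
  using finite_Phi by (simp add: arrangement_lattice_def)

lemma perp_Flats: "A \<subseteq> \<Phi> \<Longrightarrow> perp A \<in> Flats"
  by (auto simp: arrangement_lattice_perp)

lemma dim_perp:
  assumes K: "K \<subseteq> \<Delta>"
  shows "dim (perp K) = DIM('a) - card K" and "card K \<le> DIM('a)"
proof -
  have ind: "independent K" using indep_Delta K by (rule independent_mono)
  have "dim {y \<in> UNIV. \<forall>x\<in>span K. orthogonal x y} + dim (span K) = dim (UNIV :: 'a set)"
    by (rule dim_subspace_orthogonal_to_vectors) auto
  moreover have "{y \<in> UNIV. \<forall>x\<in>span K. orthogonal x y} = perp K"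
    by (auto simp: perp_def orthogonal_def span_base)
      (metis inner_commute orthogonal_def orthogonal_to_span)
  moreover have "dim K = card K" using ind by (rule dim_eq_card_independent)
  ultimately show "dim (perp K) = DIM('a) - card K" "card K \<le> DIM('a)" by auto
qed

lemma W_Flats:
  assumes w: "w \<in> W"
  shows "image w ` {Y\<in>Flats. Y \<subseteq> X} = {Y\<in>Flats. Y \<subseteq> w ` X}"
proof (intro equalityI subsetI)
  fix V assume "V \<in> image w ` {Y\<in>Flats. Y \<subseteq> X}"
  then obtain A where A: "A \<subseteq> \<Phi>" "perp A \<subseteq> X" "V = w ` perp A" by (auto simp: arrangement_lattice_perp)
  have "w ` A \<subseteq> \<Phi>" using A W_Phi[OF w] by blast
  then have "V \<in> Flats" using A W_perp[OF w] perp_Flats by metis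
  then show "V \<in> {Y\<in>Flats. Y \<subseteq> w ` X}" using A by auto
next
  fix V assume V: "V \<in> {Y\<in>Flats. Y \<subseteq> w ` X}"
  then obtain A where A: "A \<subseteq> \<Phi>" "V = perp A" by (auto simp: arrangement_lattice_perp)
  have iw: "winv w \<in> W" using refl_elems_inv[OF w] .
  define Y where "Y = winv w ` V"
  have wY: "w ` Y = V" using w by (auto simp: Y_def image_image)
  have "winv w ` A \<subseteq> \<Phi>" using A W_Phi[OF iw] by blast
  then have "Y \<in> Flats" using A W_perp[OF iw] perp_Flats Y_def by metis
  moreover have "Y \<subseteq> X"
  proof
    fix v assume "v \<in> Y"
    then have "w v \<in> w ` X" using wY V by blast
    then show "v \<in> X" using w by (metis imageE refl_elems_inv_apply(1))
  qed
  ultimately show "V \<in> image w ` {Y\<in>Flats. Y \<subseteq> X}" using wY by blast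
qed

lemma upper_char_poly_W:
  assumes w: "w \<in> W" and X: "X \<in> Flats"
  shows "upper_char_poly \<Phi> (w ` X) x = upper_char_poly \<Phi> X x"
proof (rule upper_char_poly_iso[OF finite_Phi X, where f = w, symmetric])
  have "w ` X \<in> image w ` {Y\<in>Flats. Y \<subseteq> X}" using X by blast
  then show "w ` X \<in> Flats" unfolding W_Flats[OF w] by simp
qed (use w W_Flats refl_elems_linear refl_elems_inj_on in auto)

lemma chi_W:
  assumes "w \<in> W" "K \<subseteq> \<Delta>"
  shows "chi x (w ` K) = chi x K"
  using upper_char_poly_W[OF assms(1) perp_Flats, of K x] assms Delta_Phi
  by (auto simp: chi_def W_perp)

text \<open>Take a point of \<open>Y\<close> where as few roots as possible vanish. A root vanishing
  there but not at \<open>u\<close> could be removed from the list by a shift along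
  \<open>u\<close>, and only finitely many shifts would create a new zero.\<close>

lemma ex_generic:
  assumes Y: "subspace Y"
  shows "\<exists>y\<in>Y. \<forall>\<beta>\<in>\<Phi>. \<beta> \<bullet> y = 0 \<longrightarrow> (\<forall>u\<in>Y. \<beta> \<bullet> u = 0)"
proof -
  define Z where "Z y = {\<beta>\<in>\<Phi>. \<beta> \<bullet> y = 0}" for y
  have finZ: "finite (Z y)" for y using finite_Phi by (simp add: Z_def)
  have "0 \<in> Y" using Y by (rule subspace_0)
  then obtain y where y: "y \<in> Y" and least: "\<And>z. z \<in> Y \<Longrightarrow> card (Z y) \<le> card (Z z)"
    using ex_has_least_nat[of "\<lambda>y. y \<in> Y" 0 "\<lambda>y. card (Z y)"] by blast
  have "\<beta> \<bullet> u = 0" if b: "\<beta> \<in> \<Phi>" "\<beta> \<bullet> y = 0" "u \<in> Y" for \<beta> u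
  proof (rule ccontr)
    assume bu: "\<beta> \<bullet> u \<noteq> 0"
    define bad where "bad = insert 0 ((\<lambda>\<gamma>. - (\<gamma> \<bullet> y) / (\<gamma> \<bullet> u)) ` \<Phi>)"
    have "finite bad" using finite_Phi by (simp add: bad_def)
    then obtain t where t: "t \<notin> bad" using ex_new_if_finite infinite_UNIV_char_0 by blast
    have z: "y + t *\<^sub>R u \<in> Y" using Y y b by (simp add: subspace_add subspace_scale)
    have "Z (y + t *\<^sub>R u) \<subseteq> Z y - {\<beta>}"
    proof
      fix \<gamma> assume g: "\<gamma> \<in> Z (y + t *\<^sub>R u)"
      then have eq: "\<gamma> \<bullet> y + t * (\<gamma> \<bullet> u) = 0" and gP: "\<gamma> \<in> \<Phi>" by (auto simp: Z_def inner_add_right)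
      have "\<gamma> \<bullet> u = 0"
      proof (rule ccontr)
        assume "\<gamma> \<bullet> u \<noteq> 0"
        then have "t = - (\<gamma> \<bullet> y) / (\<gamma> \<bullet> u)" using eq by (simp add: field_simps)
        then show False using t gP by (auto simp: bad_def)
      qed
      then show "\<gamma> \<in> Z y - {\<beta>}" using eq gP bu by (auto simp: Z_def)
    qed
    moreover have "\<beta> \<in> Z y" using b by (simp add: Z_def)
    ultimately have "card (Z (y + t *\<^sub>R u)) < card (Z y)" using finZ by (intro psubset_card_mono) auto
    then show False using least[OF z] by simp
  qed
  then show ?thesis using y by blast
qed

definition flat_pairs :: "'a set \<Rightarrow> ('a set \<times> ('a \<Rightarrow> 'a)) set"
  where "flat_pairs Y = {(J, w). J \<subseteq> \<Delta> \<and> w \<in> W \<and> (\<forall>\<alpha>\<in>J. pos (w \<alpha>)) \<and> w ` perp J = Y}"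

text \<open>Move a generic point of \<open>Y\<close> into the closed fundamental chamber and let
  \<open>J\<close> be the simple roots vanishing at the result. The nearest-chamber choice supplies
  the positivity on \<open>J\<close>.\<close>

lemma flat_pairs_nonempty:
  assumes Y: "Y \<in> Flats"
  shows "flat_pairs Y \<noteq> {}"
proof -
  obtain A where A: "A \<subseteq> \<Phi>" "Y = perp A" using Y by (auto simp: arrangement_lattice_perp)
  obtain y where y: "y \<in> Y" and gen: "\<And>\<beta> u. \<beta> \<in> \<Phi> \<Longrightarrow> \<beta> \<bullet> y = 0 \<Longrightarrow> u \<in> Y \<Longrightarrow> \<beta> \<bullet> u = 0"
    using ex_generic[of Y] subspace_perp A by blast
  obtain w where w: "w \<in> W" and dom: "\<And>\<alpha>. \<alpha> \<in> \<Delta> \<Longrightarrow> 0 \<le> \<alpha> \<bullet> w y"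
    and close: "\<And>\<alpha>. \<alpha> \<in> \<Delta> \<Longrightarrow> \<alpha> \<bullet> w y = 0 \<Longrightarrow> pos (winv w \<alpha>)"
    using dominant_rep_close[of y] by blast
  have iw: "winv w \<in> W" using refl_elems_inv[OF w] .
  define J where "J = {\<alpha>\<in>\<Delta>. \<alpha> \<bullet> w y = 0}"
  have J: "J \<subseteq> \<Delta>" by (auto simp: J_def)
  have wY: "w ` Y = perp J"
  proof (intro equalityI subsetI)
    fix v assume "v \<in> w ` Y"
    then obtain u where u: "u \<in> Y" "v = w u" by auto
    have "\<alpha> \<bullet> v = 0" if a: "\<alpha> \<in> J" for \<alpha>
    proof -
      have "winv w \<alpha> \<in> \<Phi>" using W_inv_Phi[OF w] a J Delta_Phi by auto
      moreover have "winv w \<alpha> \<bullet> y = 0"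
        using a by (simp add: J_def refl_elems_adjoint[OF iw] refl_elems_inv_inv[OF w])
      ultimately have "winv w \<alpha> \<bullet> u = 0" using gen u by blast
      then show ?thesis using u by (simp add: refl_elems_adjoint[OF iw] refl_elems_inv_inv[OF w])
    qed
    then show "v \<in> perp J" by (simp add: perp_def)
  next
    fix v assume v: "v \<in> perp J"
    have *: "\<beta> \<bullet> v = 0" if b: "pos \<beta>" "\<beta> \<bullet> w y = 0" for \<beta>
    proof -
      have "(\<beta> \<bullet> coweight \<gamma>) * (\<gamma> \<bullet> v) = 0" if "\<gamma> \<in> \<Delta>" for \<gamma>
        using pos_inner_zero[OF b dom that] that v by (auto simp: J_def perp_def)
      then show ?thesis by (subst inner_expand) (rule sum.neutral, blast)
    qed
    have "w \<beta> \<bullet> v = 0" if b: "\<beta> \<in> A" for \<beta>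
    proof -
      have "w \<beta> \<in> \<Phi>" using W_Phi[OF w] b A by auto
      moreover have "w \<beta> \<bullet> w y = 0" using b y A by (simp add: refl_elems_inner[OF w] perp_def)
      ultimately show ?thesis using *[of "w \<beta>"] *[of "- w \<beta>"] pos_cases by auto
    qed
    then have "winv w v \<in> Y"
      by (simp add: A perp_def refl_elems_adjoint[OF w])
    then show "v \<in> w ` Y" using w by (intro image_eqI[of _ _ "winv w v"]) auto
  qed
  have "winv w ` perp J = Y" using w by (auto simp: wY[symmetric] image_image)
  then have "(J, winv w) \<in> flat_pairs Y"
    using J iw close by (auto simp: flat_pairs_def J_def)
  then show ?thesis by blast
qed

text \<open>The pairs \<open>(J, w)\<close> in \<open>flat_pairs Y\<close> correspond to the chambers of the arrangement restricted to
  \<open>Y\<close>, of which there are \<open>card (tset J J)\<close> for every such \<open>J\<close>.\<close>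

lemma flat_pairs_weight:
  assumes Y: "Y \<in> Flats"
  shows "(\<Sum>(J, w)\<in>flat_pairs Y. 1 / real (card (tset J J))) = 1"
proof -
  obtain J w where Jw: "(J, w) \<in> flat_pairs Y" using flat_pairs_nonempty[OF Y] by auto
  then have J: "J \<subseteq> \<Delta>" and w: "w \<in> W" and pos: "\<forall>\<alpha>\<in>J. pos (w \<alpha>)" and wJ: "w ` perp J = Y"
    by (auto simp: flat_pairs_def)
  let ?f = "\<lambda>u. (u ` J, w \<circ> winv u)"
  have "bij_betw ?f (tset J J) (flat_pairs Y)"
    unfolding bij_betw_def
  proof (intro conjI equalityI subsetI)
    show "inj_on ?f (tset J J)"
    proof (rule inj_onI)
      fix u u' assume u: "u \<in> tset J J" "u' \<in> tset J J" and eq: "?f u = ?f u'"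
      then have uW: "u \<in> W" "u' \<in> W" by (auto simp: tset_def)
      have "w \<circ> winv u = w \<circ> winv u'" using eq by simp
      from fun_cong[OF this] have "w (winv u v) = w (winv u' v)" for v by simp
      then have "winv u v = winv u' v" for v using w by (metis refl_elems_inv_apply(1))
      then have "u (winv u' (u' v)) = u' v" for v using uW by (metis refl_elems_inv_apply(2))
      then show "u = u'" using uW by (simp add: fun_eq_iff)
    qed
    fix p assume "p \<in> ?f ` tset J J"
    then obtain u where u: "u \<in> W" "u ` J \<subseteq> \<Delta>" and p: "p = ?f u" by (auto simp: tset_def)
    have iu: "winv u \<in> W" using refl_elems_inv[OF u(1)] .
    have "(w \<circ> winv u) ` perp (u ` J) = w ` winv u ` u ` perp J"
      by (simp only: W_perp[OF u(1)] image_comp)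
    also have "winv u ` u ` perp J = perp J" using u by (simp add: image_image)
    finally have "(w \<circ> winv u) ` perp (u ` J) = Y" using wJ by simp
    moreover have "w \<circ> winv u \<in> W" using w iu by (rule refl_elems_comp)
    moreover have "\<forall>\<alpha>\<in>u ` J. pos ((w \<circ> winv u) \<alpha>)" using u pos by simp
    ultimately show "p \<in> flat_pairs Y" using u p unfolding flat_pairs_def by blast
  next
    fix p assume "p \<in> flat_pairs Y"
    then obtain I z where p: "p = (I, z)" and I: "I \<subseteq> \<Delta>" "\<forall>\<alpha>\<in>I. pos (z \<alpha>)" and z: "z \<in> W" "z ` perp I = Y"
      by (auto simp: flat_pairs_def)
    \<comment> \<open>The group element that leads from the fixed pair to the given one;
      \<open>parabolic_eq\<close> shows that it carries \<open>J\<close> onto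
      \<open>I\<close>.\<close>
    define u where "u = winv z \<circ> w"
    have uJ: "u ` J = I" unfolding u_def by (rule parabolic_eq) (use J w pos wJ z I in auto)
    have uW: "u \<in> W" unfolding u_def using z w by (intro refl_elems_comp refl_elems_inv)
    have "winv u v = winv w (z v)" for v
      using refl_elems_inv_apply(1)[OF uW, of "winv w (z v)"] w z by (simp add: u_def)
    then have "w \<circ> winv u = z" using w by (simp add: fun_eq_iff)
    then have "?f u = p" using uJ p by simp
    moreover have "u \<in> tset J J" using uW uJ I unfolding tset_same by blast
    ultimately show "p \<in> ?f ` tset J J" by blast
  qed
  then have "(\<Sum>(J, w)\<in>flat_pairs Y. 1 / real (card (tset J J)))
      = (\<Sum>u\<in>tset J J. case ?f u of (J, w) \<Rightarrow> 1 / real (card (tset J J)))"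
    by (rule sum.reindex_bij_betw[symmetric])
  also have "\<dots> = (\<Sum>u\<in>tset J J. 1 / real (card (tset J J)))"
  proof (rule sum.cong[OF refl])
    fix u assume "u \<in> tset J J"
    then have "card (tset (u ` J) (u ` J)) = card (tset J J)"
      by (intro card_tset_conj) (simp add: tset_def)
    then show "(case ?f u of (J, w) \<Rightarrow> 1 / real (card (tset J J))) = 1 / real (card (tset J J))"
      by simp
  qed
  also have "\<dots> = 1" using card_tset_pos[OF J] by simp
  finally show ?thesis .
qed

lemma finite_flat_pairs: "finite (flat_pairs Y)"
  by (rule finite_subset[of _ "Pow \<Delta> \<times> W"])
    (use finite_Delta finite_W in \<open>auto simp: flat_pairs_def\<close>)

text \<open>The left hand side of the identity for \<open>K\<close> in the overview.\<close>

definition restr_sum :: "real \<Rightarrow> 'a set \<Rightarrow> real"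
  where "restr_sum x K =
    (\<Sum>J\<in>{J\<in>Pow \<Delta>. K \<subseteq> J}. chi x J / real (card (tset J J)) * real (card (tset J K)))"

text \<open>Positivity on \<open>J\<close> is what makes the elements of \<open>K\<close> pull back
  into \<open>J\<close> itself and not just to roots of its parabolic subsystem.\<close>

lemma perp_image_subset_iff:
  assumes w: "w \<in> W" and J: "J \<subseteq> \<Delta>" "\<forall>\<alpha>\<in>J. pos (w \<alpha>)" and K: "K \<subseteq> \<Delta>"
  shows "w ` perp J \<subseteq> perp K \<longleftrightarrow> K \<subseteq> w ` J"
proof
  assume "K \<subseteq> w ` J"
  then show "w ` perp J \<subseteq> perp K" unfolding W_perp[OF w] by (rule perp_antimono)
next
  assume sub: "w ` perp J \<subseteq> perp K"
  show "K \<subseteq> w ` J"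
  proof
    fix \<alpha> assume a: "\<alpha> \<in> K"
    have "winv w \<alpha> \<in> J"
      using sub a K by (intro simple_pull_back[OF w J]) (auto simp: perp_def)
    then show "\<alpha> \<in> w ` J" using w by (intro image_eqI[of _ _ "winv w \<alpha>"]) auto
  qed
qed

text \<open>Unlike in \<open>restr_sum\<close>, the counting condition here places \<open>K\<close>
  inside the image of \<open>J\<close>. It says that the image of \<open>perp J\<close> is a flat
  below \<open>perp K\<close>, so the pairs can be sorted by this flat and the value is exact for
  each single \<open>K\<close>.\<close>

lemma restr_sum_flats:
  assumes K: "K \<subseteq> \<Delta>"
  shows "(\<Sum>J\<in>Pow \<Delta>. chi x J / real (card (tset J J)) *
      real (card {w\<in>W. (\<forall>\<alpha>\<in>J. pos (w \<alpha>)) \<and> K \<subseteq> w ` J})) = x ^ dim (perp K)"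
proof -
  define A where "A J = {w\<in>W. (\<forall>\<alpha>\<in>J. pos (w \<alpha>)) \<and> K \<subseteq> w ` J}" for J
  have finA: "finite (A J)" for J using finite_W by (simp add: A_def)
  let ?F = "{Y\<in>Flats. Y \<subseteq> perp K}"
  have Sig: "Sigma (Pow \<Delta>) A = (\<Union>Y\<in>?F. flat_pairs Y)"
  proof (intro equalityI subsetI)
    fix p assume "p \<in> Sigma (Pow \<Delta>) A"
    then obtain J w where p: "p = (J, w)" "J \<subseteq> \<Delta>" "w \<in> W" "\<forall>\<alpha>\<in>J. pos (w \<alpha>)" "K \<subseteq> w ` J"
      by (auto simp: A_def)
    then have "p \<in> flat_pairs (w ` perp J)" "w ` perp J \<subseteq> perp K"
      using perp_image_subset_iff[OF _ _ _ K] by (auto simp: flat_pairs_def)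
    moreover have "w ` J \<subseteq> \<Phi>" using p W_Phi Delta_Phi by blast
    then have "w ` perp J \<in> Flats" using p by (simp add: W_perp perp_Flats)
    ultimately show "p \<in> (\<Union>Y\<in>?F. flat_pairs Y)" by blast
  next
    fix p assume "p \<in> (\<Union>Y\<in>?F. flat_pairs Y)"
    then show "p \<in> Sigma (Pow \<Delta>) A"
      using perp_image_subset_iff[OF _ _ _ K] by (fastforce simp: flat_pairs_def A_def)
  qed
  have "(\<Sum>J\<in>Pow \<Delta>. chi x J / real (card (tset J J)) * real (card (A J)))
      = (\<Sum>J\<in>Pow \<Delta>. \<Sum>w\<in>A J. chi x J / real (card (tset J J)))"
    by (simp add: mult.commute)
  also have "\<dots> = (\<Sum>(J, w)\<in>Sigma (Pow \<Delta>) A. chi x J / real (card (tset J J)))"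
    by (rule sum.Sigma) (auto simp: finite_Delta finA)
  also have "\<dots> = (\<Sum>Y\<in>?F. \<Sum>(J, w)\<in>flat_pairs Y. chi x J / real (card (tset J J)))"
    unfolding Sig
  proof (rule sum.UNION_disjoint)
    show "finite ?F" using finite_Flats by simp
    show "\<forall>Y\<in>?F. finite (flat_pairs Y)" using finite_flat_pairs by blast
    show "\<forall>Y\<in>?F. \<forall>Z\<in>?F. Y \<noteq> Z \<longrightarrow> flat_pairs Y \<inter> flat_pairs Z = {}" by (auto simp: flat_pairs_def)
  qed
  also have "\<dots> = (\<Sum>Y\<in>?F. upper_char_poly \<Phi> Y x * (\<Sum>(J, w)\<in>flat_pairs Y. 1 / real (card (tset J J))))"
  proof (rule sum.cong[OF refl])
    fix Y assume "Y \<in> ?F"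
    have "chi x J = upper_char_poly \<Phi> Y x" if "(J, w) \<in> flat_pairs Y" for J w
      using that upper_char_poly_W[OF _ perp_Flats, of w J x] Delta_Phi by (auto simp: flat_pairs_def chi_def)
    then show "(\<Sum>(J, w)\<in>flat_pairs Y. chi x J / real (card (tset J J)))
        = upper_char_poly \<Phi> Y x * (\<Sum>(J, w)\<in>flat_pairs Y. 1 / real (card (tset J J)))"
      unfolding sum_distrib_left by (intro sum.cong) auto
  qed
  also have "\<dots> = (\<Sum>Y\<in>?F. upper_char_poly \<Phi> Y x)"
    by (intro sum.cong) (auto simp: flat_pairs_weight)
  also have "\<dots> = x ^ dim (perp K)"
    using K Delta_Phi by (intro upper_char_poly_sum finite_Phi perp_Flats) auto
  finally show ?thesis by (simp add: A_def)
qed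

text \<open>For fixed \<open>J\<close>, keep \<open>w\<close> and replace the class member
  \<open>I\<close> by its image under \<open>w\<close>. This stays in the class and turns the count
  in \<open>restr_sum\<close> into the one in \<open>restr_sum_flats\<close>.\<close>

theorem restr_sum_average:
  assumes K: "K \<subseteq> \<Delta>"
  shows "(\<Sum>I\<in>cls K. restr_sum x I) = real (card (cls K)) * x ^ (DIM('a) - card K)"
proof -
  define h where "h J = chi x J / real (card (tset J J))" for J
  define A where "A J I = {w\<in>W. (\<forall>\<alpha>\<in>J. pos (w \<alpha>)) \<and> I \<subseteq> w ` J}" for J I
  have fin: "finite (cls K)" by (rule finite_conj_class)
  have finJ: "finite (Pow \<Delta>)" using finite_Delta by simp
  have swap: "(\<Sum>I\<in>{I\<in>cls K. I \<subseteq> J}. card (tset J I)) = (\<Sum>I\<in>cls K. card (A J I))" if J: "J \<subseteq> \<Delta>" for J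
  proof -
    have "(\<Sum>I\<in>{I\<in>cls K. I \<subseteq> J}. card (tset J I)) = card (SIGMA I:{I\<in>cls K. I \<subseteq> J}. tset J I)"
      using fin finite_tset by (subst card_SigmaI) auto
    moreover have bij: "bij_betw (\<lambda>(I, w). (w ` I, w)) (SIGMA I:{I\<in>cls K. I \<subseteq> J}. tset J I) (SIGMA I:cls K. A J I)"
    proof (rule bij_betw_byWitness[where f' = "\<lambda>(I, w). (winv w ` I, w)"])
      show "\<forall>p\<in>(SIGMA I:{I\<in>cls K. I \<subseteq> J}. tset J I).
          (\<lambda>(I, w). (winv w ` I, w)) ((\<lambda>(I, w). (w ` I, w)) p) = p"
        by (auto simp: tset_def image_image)
      show "\<forall>p\<in>(SIGMA I:cls K. A J I).
          (\<lambda>(I, w). (w ` I, w)) ((\<lambda>(I, w). (winv w ` I, w)) p) = p"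
        by (auto simp: A_def image_image)
      have trans: "w ` I \<in> cls K" if "I \<in> cls K" "w \<in> W" "w ` I \<subseteq> \<Delta>" for I w
      proof -
        have "w ` I \<in> cls I" using that unfolding conj_class_iff by blast
        then show ?thesis using conj_class_eq[OF that(1)] by simp
      qed
      show "(\<lambda>(I, w). (w ` I, w)) ` (SIGMA I:{I\<in>cls K. I \<subseteq> J}. tset J I) \<subseteq> (SIGMA I:cls K. A J I)"
        using trans by (auto simp: tset_def A_def)
      show "(\<lambda>(I, w). (winv w ` I, w)) ` (SIGMA I:cls K. A J I)
          \<subseteq> (SIGMA I:{I\<in>cls K. I \<subseteq> J}. tset J I)"
      proof (rule image_subsetI)
        fix p assume "p \<in> (SIGMA I:cls K. A J I)"
        then obtain I w where p: "p = (I, w)" and I: "I \<in> cls K" and "w \<in> A J I" by blast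
        then have w: "w \<in> W" "\<forall>\<alpha>\<in>J. pos (w \<alpha>)" "I \<subseteq> w ` J" by (auto simp: A_def)
        have sub: "winv w ` I \<subseteq> J"
        proof clarify
          fix \<alpha> assume "\<alpha> \<in> I"
          then obtain \<gamma> where "\<gamma> \<in> J" "\<alpha> = w \<gamma>" using w by blast
          then show "winv w \<alpha> \<in> J" using w by simp
        qed
        moreover have "winv w ` I \<in> cls K"
          using trans[OF I refl_elems_inv[OF w(1)]] sub J by blast
        moreover have "w ` winv w ` I = I" using w by (simp add: image_image)
        ultimately show "(\<lambda>(I, w). (winv w ` I, w)) p \<in> (SIGMA I:{I\<in>cls K. I \<subseteq> J}. tset J I)"
          using w I p by (simp add: tset_def conj_class_iff)
      qed
    qed
    moreover have "card (SIGMA I:cls K. A J I) = (\<Sum>I\<in>cls K. card (A J I))"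
      using fin finite_W by (subst card_SigmaI) (auto simp: A_def)
    ultimately show ?thesis using bij_betw_same_card[OF bij] by simp
  qed
  have "(\<Sum>I\<in>cls K. restr_sum x I)
      = (\<Sum>I\<in>cls K. \<Sum>J\<in>{J\<in>Pow \<Delta>. I \<subseteq> J}. h J * real (card (tset J I)))"
    by (simp add: restr_sum_def h_def)
  also have "\<dots> = (\<Sum>J\<in>Pow \<Delta>. \<Sum>I\<in>{I\<in>cls K. I \<subseteq> J}. h J * real (card (tset J I)))"
    by (rule sum.swap_restrict[OF fin finJ])
  also have "\<dots> = (\<Sum>J\<in>Pow \<Delta>. h J * real (\<Sum>I\<in>{I\<in>cls K. I \<subseteq> J}. card (tset J I)))"
    by (simp add: sum_distrib_left)
  also have "\<dots> = (\<Sum>J\<in>Pow \<Delta>. h J * real (\<Sum>I\<in>cls K. card (A J I)))"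
    using swap by (intro sum.cong) auto
  also have "\<dots> = (\<Sum>J\<in>Pow \<Delta>. \<Sum>I\<in>cls K. h J * real (card (A J I)))"
    by (simp add: sum_distrib_left)
  also have "\<dots> = (\<Sum>I\<in>cls K. \<Sum>J\<in>Pow \<Delta>. h J * real (card (A J I)))"
    by (rule sum.swap)
  also have "\<dots> = (\<Sum>I\<in>cls K. x ^ (DIM('a) - card K))"
  proof (rule sum.cong[OF refl])
    fix I assume I: "I \<in> cls K"
    note sub = conj_class_subset[OF I]
    show "(\<Sum>J\<in>Pow \<Delta>. h J * real (card (A J I))) = x ^ (DIM('a) - card K)"
      using restr_sum_flats[OF sub, of x] dim_perp[OF sub] conj_class_card[OF I]
      by (simp add: h_def A_def)
  qed
  finally show ?thesis by simp
qed

corollary restr_sum_eq: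
  assumes K: "K \<subseteq> \<Delta>" and const: "\<And>I. I \<in> cls K \<Longrightarrow> restr_sum x I = restr_sum x K"
  shows "restr_sum x K = x ^ (DIM('a) - card K)"
proof -
  have "(\<Sum>I\<in>cls K. restr_sum x I) = real (card (cls K)) * restr_sum x K" using const by simp
  moreover have "card (cls K) \<noteq> 0" using conj_class_self[OF K] finite_conj_class by auto
  ultimately show ?thesis using restr_sum_average[OF K, of x] by simp
qed

end

section \<open>Reduction to restricted arrangements\<close>

text \<open>Forward substitution along inclusion: the row of \<open>I\<close> is computed from the
  rows of its proper subsets. The value 0 at infinite sets secures termination.\<close>

function triangular_solve :: "('a set \<Rightarrow> 'a set \<Rightarrow> real) \<Rightarrow> 'a set \<Rightarrow> 'a set \<Rightarrow> real"
  where "triangular_solve A I J =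
    (if finite I
     then ((if I = J then 1 else 0) - (\<Sum>K\<in>{K. K \<subset> I}. A I K * triangular_solve A K J)) / A I I
     else 0)"
  by auto
termination
  by (relation "Wellfounded.measure (\<lambda>(A, I, J). card I)") (auto intro: psubset_card_mono)

declare triangular_solve.simps [simp del]

lemma triangular_solve_support:
  assumes "triangular_solve A I J \<noteq> 0"
  shows "J \<subseteq> I"
proof (rule ccontr)
  assume "\<not> J \<subseteq> I"
  then have "triangular_solve A I J = 0"
  proof (induction "card I" arbitrary: I rule: less_induct)
    case less
    show ?case
    proof (cases "finite I")
      case True
      have "triangular_solve A K J = 0" if "K \<subset> I" for K
        using that True less.prems by (intro less.hyps) (auto intro: psubset_card_mono)
      then show ?thesis using less.prems by (subst triangular_solve.simps) auto
    qed (simp add: triangular_solve.simps)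
  qed
  then show False using assms by simp
qed

lemma triangular_inverse_exists:
  fixes A :: "'a set \<Rightarrow> 'a set \<Rightarrow> real"
  assumes D: "finite D" and diag: "\<And>J. J \<subseteq> D \<Longrightarrow> A J J \<noteq> 0"
    and tri: "\<And>J K. \<not> K \<subseteq> J \<Longrightarrow> A J K = 0"
  shows "\<exists>B. is_matrix_inverse_on (Pow D) A B \<and> (\<forall>J K. \<not> K \<subseteq> J \<longrightarrow> B J K = 0)"
proof -
  define B where "B J K = (if J \<subseteq> D \<and> K \<subseteq> D then triangular_solve A J K else 0)" for J K
  have finD: "finite (Pow D)" using D by simp
  have split: "(\<Sum>K\<in>Pow D. A I K * f K) = A I I * f I + (\<Sum>K\<in>{K. K \<subset> I}. A I K * f K)"
    if I: "I \<subseteq> D" for I and f :: "'a set \<Rightarrow> real"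
  proof -
    have "(\<Sum>K\<in>Pow D. A I K * f K) = (\<Sum>K\<in>Pow I. A I K * f K)"
      using I finD tri by (intro sum.mono_neutral_right) auto
    also have "Pow I = insert I {K. K \<subset> I}" by auto
    also have "(\<Sum>K\<in>insert I {K. K \<subset> I}. A I K * f K) = A I I * f I + (\<Sum>K\<in>{K. K \<subset> I}. A I K * f K)"
      using finite_subset[OF I D] finite_subset[of "{K. K \<subset> I}" "Pow I"] by (intro sum.insert) auto
    finally show ?thesis .
  qed
  have right: "(\<Sum>K\<in>Pow D. A I K * B K J) = (if I = J then 1 else 0)" if I: "I \<subseteq> D" and J: "J \<subseteq> D" for I J
  proof -
    have "(\<Sum>K\<in>{K. K \<subset> I}. A I K * B K J) = (\<Sum>K\<in>{K. K \<subset> I}. A I K * triangular_solve A K J)"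
      using I J by (intro sum.cong) (auto simp: B_def)
    moreover have "A I I * B I J
        = (if I = J then 1 else 0) - (\<Sum>K\<in>{K. K \<subset> I}. A I K * triangular_solve A K J)"
      using I J diag[OF I] finite_subset[OF I D] by (simp add: B_def triangular_solve.simps[of A I J])
    ultimately show ?thesis using split[OF I, of "\<lambda>K. B K J"] by simp
  qed
  \<comment> \<open>\<open>C\<close> is the product of \<open>B\<close> and \<open>A\<close> in the
    order not covered by \<open>right\<close>. Multiplying by \<open>A\<close> on the left gives
    \<open>A\<close> again, and triangularity with nonzero diagonal then allows \<open>A\<close> to
    be cancelled by induction on the row.\<close>
  define C where "C I J = (\<Sum>K\<in>Pow D. B I K * A K J)" for I J
  have C: "C I J = (if I = J then 1 else 0)" if "I \<subseteq> D" and J: "J \<subseteq> D" for I J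
    using that(1)
  proof (induction "card I" arbitrary: I rule: less_induct)
    case less
    note I = less.prems
    define \<delta> where "\<delta> K = (if K = J then 1 else 0 :: real)" for K
    have "(\<Sum>K\<in>Pow D. A I K * C K J) = (\<Sum>K\<in>Pow D. \<Sum>L\<in>Pow D. A I K * B K L * A L J)"
      by (simp add: C_def sum_distrib_left mult.assoc)
    also have "\<dots> = (\<Sum>L\<in>Pow D. \<Sum>K\<in>Pow D. A I K * B K L * A L J)"
      by (rule sum.swap)
    also have "\<dots> = (\<Sum>L\<in>Pow D. (\<Sum>K\<in>Pow D. A I K * B K L) * A L J)"
      by (simp add: sum_distrib_right)
    also have "\<dots> = (\<Sum>L\<in>Pow D. if L = I then A I J else 0)"
      using right[OF I] by (intro sum.cong) auto
    also have "\<dots> = A I J" using I finD by simp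
    also have "\<dots> = (\<Sum>K\<in>Pow D. if K = J then A I J else 0)" using J finD by simp
    also have "\<dots> = (\<Sum>K\<in>Pow D. A I K * \<delta> K)" by (intro sum.cong) (auto simp: \<delta>_def)
    finally have "A I I * C I J + (\<Sum>K\<in>{K. K \<subset> I}. A I K * C K J)
        = A I I * \<delta> I + (\<Sum>K\<in>{K. K \<subset> I}. A I K * \<delta> K)"
      by (simp only: split[OF I])
    moreover have "(\<Sum>K\<in>{K. K \<subset> I}. A I K * C K J) = (\<Sum>K\<in>{K. K \<subset> I}. A I K * \<delta> K)"
    proof (rule sum.cong[OF refl])
      fix K assume K: "K \<in> {K. K \<subset> I}"
      then have "card K < card I" using finite_subset[OF I D] by (auto intro: psubset_card_mono)
      then have "C K J = \<delta> K" unfolding \<delta>_def using K I by (intro less.hyps) auto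
      then show "A I K * C K J = A I K * \<delta> K" by simp
    qed
    ultimately have "C I J = \<delta> I" using diag[OF I] by simp
    then show ?case by (simp add: \<delta>_def)
  qed
  have "is_matrix_inverse_on (Pow D) A B"
    unfolding is_matrix_inverse_on_def using right C by (auto simp: B_def C_def)
  moreover have "\<forall>J K. \<not> K \<subseteq> J \<longrightarrow> B J K = 0"
    using triangular_solve_support[of A] unfolding B_def by metis
  ultimately show ?thesis by blast
qed

section \<open>Comparison of the coefficients of H and M\<close>

context based_roots
begin

text \<open>The support statement allows the sums over \<open>Pow J\<close> in \<open>e_elem\<close>
  to be extended to \<open>Pow \<Delta>\<close>.\<close>

lemma beta_coeff:
  shows is_inverse_beta_coeff: "is_matrix_inverse_on (Pow \<Delta>) (mu_coeff \<Phi> \<Delta>) (beta_coeff \<Phi> \<Delta>)"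
    and beta_coeff_support: "\<not> K \<subseteq> J \<Longrightarrow> beta_coeff \<Phi> \<Delta> J K = 0"
proof -
  have "mu_coeff \<Phi> \<Delta> J J \<noteq> 0" if "J \<subseteq> \<Delta>" for J
  proof -
    have "card (cls J) \<noteq> 0" using conj_class_self[OF that] finite_conj_class by auto
    then show ?thesis using card_tset_pos[OF that] by (simp add: mu_coeff_def X_set_tset[OF that])
  qed
  then obtain B where B: "is_matrix_inverse_on (Pow \<Delta>) (mu_coeff \<Phi> \<Delta>) B" "\<forall>J K. \<not> K \<subseteq> J \<longrightarrow> B J K = 0"
    using triangular_inverse_exists[OF finite_Delta, of "mu_coeff \<Phi> \<Delta>"] by (auto simp: mu_coeff_def)
  then have "beta_coeff \<Phi> \<Delta> = B"
    unfolding beta_coeff_def using finite_Delta by (intro matrix_inverse_on_eqI) auto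
  then show "is_matrix_inverse_on (Pow \<Delta>) (mu_coeff \<Phi> \<Delta>) (beta_coeff \<Phi> \<Delta>)"
    and "\<not> K \<subseteq> J \<Longrightarrow> beta_coeff \<Phi> \<Delta> J K = 0" using B by auto
qed

lemma conj_classes_eq:
  assumes "\<Lambda> \<in> conj_classes \<Phi> \<Delta>" "J \<in> \<Lambda>"
  shows "J \<subseteq> \<Delta>" "\<Lambda> = cls J" "class_rank \<Lambda> = card J"
proof -
  obtain K where K: "K \<subseteq> \<Delta>" "\<Lambda> = cls K"
    using assms(1) by (auto simp: conj_classes_def quotient_def conj_class_def)
  show J: "J \<subseteq> \<Delta>" using assms(2) unfolding K(2) conj_class_iff by blast
  show L: "\<Lambda> = cls J" using conj_class_eq assms(2) K by simp
  show "class_rank \<Lambda> = card J"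
    unfolding class_rank_def L
    by (rule the_equality) (use conj_class_card in blast, use conj_class_self[OF J] in auto)
qed

lemma sum_conj_classes: "(\<Sum>\<Lambda>\<in>conj_classes \<Phi> \<Delta>. \<Sum>J\<in>\<Lambda>. g J) = (\<Sum>J\<in>Pow \<Delta>. g J)"
proof -
  have U: "\<Union> (conj_classes \<Phi> \<Delta>) = Pow \<Delta>"
    unfolding conj_classes_def by (rule Union_quotient[OF equiv_base_conj])
  have "sum g (\<Union> (conj_classes \<Phi> \<Delta>)) = sum (sum g) (conj_classes \<Phi> \<Delta>)"
  proof (rule sum.Union_disjoint[unfolded o_def])
    show "\<forall>A\<in>conj_classes \<Phi> \<Delta>. finite A"
      using U finite_Delta by (metis Union_upper finite_Pow_iff finite_subset)
    show "\<forall>A\<in>conj_classes \<Phi> \<Delta>. \<forall>B\<in>conj_classes \<Phi> \<Delta>. A \<noteq> B \<longrightarrow> A \<inter> B = {}"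
      unfolding conj_classes_def using quotient_disj[OF equiv_base_conj] by blast
  qed
  then show ?thesis by (simp add: U)
qed

text \<open>The row vector \<open>h\<close> contains the coefficients of the \<open>x_elem\<close>
  in H, and \<open>v\<close> the weight that M gives to each row of \<open>beta_coeff\<close>. Up to
  a factor, \<open>restr\<close> says that \<open>h\<close> times \<open>mu_coeff\<close> is
  \<open>v\<close>; multiplying by the inverse matrix turns this into the equality of the
  coefficients.\<close>

theorem H_eq_M:
  assumes x: "x \<noteq> 0" and w: "w \<in> W"
    and restr: "\<And>K. K \<subseteq> \<Delta> \<Longrightarrow> restr_sum x K = x ^ (DIM('a) - card K)"
  shows "H_measure \<Phi> \<Delta> x w = M_measure \<Phi> \<Delta> x w"
proof -
  define n where "n = DIM('a)"
  define h where "h J = chi x J / (x ^ n * real (card (tset J J)))" for J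
  let ?\<mu> = "mu_coeff \<Phi> \<Delta>" and ?\<beta> = "beta_coeff \<Phi> \<Delta>" and ?x = "\<lambda>K. x_elem \<Phi> \<Delta> K w"
  define v where "v J = 1 / (real (card (cls J)) * x ^ card J)" for J
  have finD: "finite (Pow \<Delta>)" using finite_Delta by simp
  have v: "v K = (\<Sum>J\<in>Pow \<Delta>. h J * ?\<mu> J K)" if K: "K \<subseteq> \<Delta>" for K
  proof -
    have "(\<Sum>J\<in>Pow \<Delta>. h J * ?\<mu> J K)
        = (\<Sum>J\<in>{J\<in>Pow \<Delta>. K \<subseteq> J}. h J * (real (card (tset J K)) / real (card (cls K))))"
      using finD by (intro sum.mono_neutral_cong_right) (auto simp: mu_coeff_def X_set_tset)
    also have "\<dots> = restr_sum x K / (x ^ n * real (card (cls K)))"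
      unfolding restr_sum_def sum_divide_distrib by (intro sum.cong) (auto simp: h_def)
    also have "\<dots> = v K"
    proof -
      have "x ^ n = x ^ (n - card K) * x ^ card K"
        using dim_perp(2)[OF K] by (simp add: n_def flip: power_add)
      then show ?thesis using restr[OF K] x by (simp add: v_def n_def field_simps)
    qed
    finally show ?thesis by simp
  qed
  have v\<beta>: "(\<Sum>J\<in>Pow \<Delta>. v J * ?\<beta> J K) = h K" if K: "K \<subseteq> \<Delta>" for K
  proof -
    have "(\<Sum>J\<in>Pow \<Delta>. v J * ?\<beta> J K) = (\<Sum>J\<in>Pow \<Delta>. \<Sum>I\<in>Pow \<Delta>. h I * (?\<mu> I J * ?\<beta> J K))"
      by (simp add: v sum_distrib_right mult.assoc)
    also have "\<dots> = (\<Sum>I\<in>Pow \<Delta>. \<Sum>J\<in>Pow \<Delta>. h I * (?\<mu> I J * ?\<beta> J K))"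
      by (rule sum.swap)
    also have "\<dots> = (\<Sum>I\<in>Pow \<Delta>. h I * (if I = K then 1 else 0))"
      unfolding sum_distrib_left[symmetric]
      using is_inverse_beta_coeff K by (intro sum.cong) (auto simp: is_matrix_inverse_on_def)
    also have "\<dots> = h K" using K finD by (simp add: if_distrib cong: if_cong)
    finally show ?thesis .
  qed
  have x_elem: "?x K = (if K \<inter> Des \<Phi> \<Delta> w = {} then 1 else 0)" for K
    using w by (auto simp: x_elem_def X_set_def indicator_def)
  have Pow: "Pow (\<Delta> - Des \<Phi> \<Delta> w) = {K\<in>Pow \<Delta>. K \<inter> Des \<Phi> \<Delta> w = {}}" by auto
  have "M_measure \<Phi> \<Delta> x w = (\<Sum>\<Lambda>\<in>conj_classes \<Phi> \<Delta>. \<Sum>J\<in>\<Lambda>. v J * (\<Sum>K\<in>Pow \<Delta>. ?\<beta> J K * ?x K))"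
    unfolding M_measure_def
  proof (rule sum.cong[OF refl])
    fix \<Lambda> assume L: "\<Lambda> \<in> conj_classes \<Phi> \<Delta>"
    have "1 / real (card \<Lambda>) / x ^ class_rank \<Lambda> * (\<Sum>K\<in>Pow J. ?\<beta> J K * ?x K)
        = v J * (\<Sum>K\<in>Pow \<Delta>. ?\<beta> J K * ?x K)" if J: "J \<in> \<Lambda>" for J
    proof -
      have "(\<Sum>K\<in>Pow J. ?\<beta> J K * ?x K) = (\<Sum>K\<in>Pow \<Delta>. ?\<beta> J K * ?x K)"
        using conj_classes_eq(1)[OF L J] finD beta_coeff_support by (intro sum.mono_neutral_left) auto
      moreover have "1 / real (card \<Lambda>) / x ^ class_rank \<Lambda> = v J"
        unfolding v_def conj_classes_eq(3)[OF L J] using conj_classes_eq(2)[OF L J] by simp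
      ultimately show ?thesis by simp
    qed
    then show "e_elem \<Phi> \<Delta> \<Lambda> w / x ^ class_rank \<Lambda> = (\<Sum>J\<in>\<Lambda>. v J * (\<Sum>K\<in>Pow \<Delta>. ?\<beta> J K * ?x K))"
      by (simp add: e_elem_def sum_distrib_left sum_divide_distrib)
  qed
  also have "\<dots> = (\<Sum>J\<in>Pow \<Delta>. v J * (\<Sum>K\<in>Pow \<Delta>. ?\<beta> J K * ?x K))" by (rule sum_conj_classes)
  also have "\<dots> = (\<Sum>J\<in>Pow \<Delta>. \<Sum>K\<in>Pow \<Delta>. v J * ?\<beta> J K * ?x K)"
    by (simp add: sum_distrib_left mult.assoc)
  also have "\<dots> = (\<Sum>K\<in>Pow \<Delta>. \<Sum>J\<in>Pow \<Delta>. v J * ?\<beta> J K * ?x K)" by (rule sum.swap)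
  also have "\<dots> = (\<Sum>K\<in>Pow \<Delta>. h K * ?x K)" by (simp add: v\<beta> flip: sum_distrib_right)
  also have "\<dots> = (\<Sum>K\<in>Pow (\<Delta> - Des \<Phi> \<Delta> w). h K)"
    unfolding Pow using finD by (intro sum.mono_neutral_cong_right) (auto simp: x_elem)
  also have "\<dots> = H_measure \<Phi> \<Delta> x w"
    unfolding H_measure_def
  proof (rule sum.cong[OF refl])
    fix K assume "K \<in> Pow (\<Delta> - Des \<Phi> \<Delta> w)"
    then have K: "K \<subseteq> \<Delta>" by auto
    have "0 < card (refl_elems K)"
      using finite_subset[OF sub_W[OF K] finite_W] refl_elems_id by (auto simp: card_gt_0_iff)
    moreover have "upper_char_poly \<Phi> (fix_space (refl_elems K)) x = chi x K"
      using fix_space_refl_elems[of K] K zero_notin_Delta subsetD unfolding chi_def by metis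
    ultimately show "h K = real (card (refl_elems K)) * upper_char_poly \<Phi> (fix_space (refl_elems K)) x /
        (x ^ DIM('a) * real (card (normalizer (refl_group \<Phi>) (refl_elems K))) * real (card (cls K)))"
      by (simp add: h_def n_def card_normalizer[OF K] card_tset_same[OF K])
  qed
  finally show ?thesis by simp
qed

section \<open>Isomorphisms of restricted arrangements and small rank\<close>

text \<open>\<open>\<phi>\<close> carries the arrangement restricted to \<open>perp K\<close> to the one restricted to \<open>perp K'\<close>, and the walls
  of the fundamental chamber, which are given by \<open>\<Delta> - K\<close>, to those given by \<open>\<pi>\<close>.\<close>

definition restr_hom :: "'a set \<Rightarrow> 'a set \<Rightarrow> ('a \<Rightarrow> 'a) \<Rightarrow> ('a \<Rightarrow> 'a) \<Rightarrow> bool"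
  where "restr_hom K K' \<phi> \<pi> \<longleftrightarrow> linear \<phi> \<and> \<phi> ` perp K \<subseteq> perp K' \<and>
    (\<forall>\<beta>\<in>\<Phi>. (\<forall>v\<in>perp K. \<beta> \<bullet> v = 0) \<or> (\<exists>\<beta>'\<in>\<Phi>. \<exists>c>0. \<forall>v\<in>perp K. \<beta> \<bullet> v = c * (\<beta>' \<bullet> \<phi> v))) \<and>
    (\<forall>\<alpha>\<in>\<Delta> - K. \<pi> \<alpha> \<in> \<Delta> - K' \<and> (\<exists>c>0. \<forall>v\<in>perp K. \<alpha> \<bullet> v = c * (\<pi> \<alpha> \<bullet> \<phi> v)))"

definition restr_iso ::
    "'a set \<Rightarrow> 'a set \<Rightarrow> ('a \<Rightarrow> 'a) \<Rightarrow> ('a \<Rightarrow> 'a) \<Rightarrow> ('a \<Rightarrow> 'a) \<Rightarrow> ('a \<Rightarrow> 'a) \<Rightarrow> bool"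
  where "restr_iso K K' \<phi> \<psi> \<pi> \<rho> \<longleftrightarrow> restr_hom K K' \<phi> \<pi> \<and> restr_hom K' K \<psi> \<rho> \<and>
    (\<forall>v\<in>perp K. \<psi> (\<phi> v) = v) \<and> (\<forall>v\<in>perp K'. \<phi> (\<psi> v) = v) \<and>
    (\<forall>\<alpha>\<in>\<Delta> - K. \<rho> (\<pi> \<alpha>) = \<alpha>) \<and> (\<forall>\<alpha>\<in>\<Delta> - K'. \<pi> (\<rho> \<alpha>) = \<alpha>)"

lemma restr_hom_root:
  assumes "restr_hom K K' \<phi> \<pi>" "\<beta> \<in> \<Phi>" "\<not> (\<forall>v\<in>perp K. \<beta> \<bullet> v = 0)"
  obtains \<beta>' c where "\<beta>' \<in> \<Phi>" "c > 0" "\<forall>v\<in>perp K. \<beta> \<bullet> v = c * (\<beta>' \<bullet> \<phi> v)"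
proof -
  have "\<exists>\<beta>'\<in>\<Phi>. \<exists>c>0. \<forall>v\<in>perp K. \<beta> \<bullet> v = c * (\<beta>' \<bullet> \<phi> v)"
    using assms(1)[unfolded restr_hom_def, THEN conjunct2, THEN conjunct2, THEN conjunct1,
        THEN bspec, OF assms(2)]
  proof
    assume "\<forall>v\<in>perp K. \<beta> \<bullet> v = 0"
    with assms(3) show ?thesis by contradiction
  qed
  then show ?thesis using that by auto
qed

lemma restr_hom_simple:
  assumes "restr_hom K K' \<phi> \<pi>" "\<alpha> \<in> \<Delta> - K"
  obtains c where "\<pi> \<alpha> \<in> \<Delta> - K'" "c > 0" "\<forall>v\<in>perp K. \<alpha> \<bullet> v = c * (\<pi> \<alpha> \<bullet> \<phi> v)"
proof -
  have "\<pi> \<alpha> \<in> \<Delta> - K' \<and> (\<exists>c>0. \<forall>v\<in>perp K. \<alpha> \<bullet> v = c * (\<pi> \<alpha> \<bullet> \<phi> v))"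
    using assms(1)[unfolded restr_hom_def, THEN conjunct2, THEN conjunct2, THEN conjunct2,
        rule_format, OF assms(2)] .
  then show ?thesis using that by auto
qed

lemma restr_iso_hom: "restr_iso K K' \<phi> \<psi> \<pi> \<rho> \<Longrightarrow> restr_hom K K' \<phi> \<pi>"
  by (simp add: restr_iso_def)

lemma restr_iso_image:
  assumes "restr_iso K K' \<phi> \<psi> \<pi> \<rho>" "S \<subseteq> \<Delta> - K"
  shows "\<pi> ` S \<subseteq> \<Delta> - K'" "\<rho> ` \<pi> ` S = S"
proof -
  show "\<pi> ` S \<subseteq> \<Delta> - K'"
  proof
    fix \<beta> assume "\<beta> \<in> \<pi> ` S"
    then obtain \<alpha> where "\<alpha> \<in> \<Delta> - K" "\<beta> = \<pi> \<alpha>" using assms(2) by auto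
    then show "\<beta> \<in> \<Delta> - K'" using restr_hom_simple[OF restr_iso_hom[OF assms(1)]] by metis
  qed
  have "\<rho> (\<pi> \<alpha>) = \<alpha>" if "\<alpha> \<in> S" for \<alpha> using assms that by (auto simp: restr_iso_def)
  then show "\<rho> ` \<pi> ` S = S" by (simp add: image_image)
qed

lemma restr_iso_sym: "restr_iso K K' \<phi> \<psi> \<pi> \<rho> \<Longrightarrow> restr_iso K' K \<psi> \<phi> \<rho> \<pi>"
  by (simp add: restr_iso_def)

text \<open>Adding \<open>S\<close> passes to a smaller flat, where the same map still works;
  injectivity of \<open>\<pi>\<close> keeps the remaining walls apart from the image of
  \<open>S\<close>.\<close>

lemma restr_hom_extend:
  assumes hom: "restr_hom K K' \<phi> \<pi>" and inj: "inj_on \<pi> (\<Delta> - K)" and S: "S \<subseteq> \<Delta> - K"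
  shows "restr_hom (K \<union> S) (K' \<union> \<pi> ` S) \<phi> \<pi>"
  unfolding restr_hom_def
proof (intro conjI ballI)
  have sub: "perp (K \<union> S) \<subseteq> perp K" by (rule perp_antimono) simp
  show "linear \<phi>" using hom by (simp add: restr_hom_def)
  show "\<phi> ` perp (K \<union> S) \<subseteq> perp (K' \<union> \<pi> ` S)"
  proof
    fix u assume "u \<in> \<phi> ` perp (K \<union> S)"
    then obtain v where v: "v \<in> perp (K \<union> S)" "u = \<phi> v" by auto
    have "\<pi> \<alpha> \<bullet> u = 0" if a: "\<alpha> \<in> S" for \<alpha>
    proof -
      obtain c where c: "c > 0" "\<forall>v\<in>perp K. \<alpha> \<bullet> v = c * (\<pi> \<alpha> \<bullet> \<phi> v)"
        using restr_hom_simple[OF hom subsetD[OF S a]] by metis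
      moreover have "\<alpha> \<bullet> v = 0" using v a by (simp add: perp_def)
      ultimately show ?thesis using v sub by auto
    qed
    moreover have "u \<in> perp K'" using hom v sub by (auto simp: restr_hom_def)
    ultimately show "u \<in> perp (K' \<union> \<pi> ` S)" by (auto simp: perp_def)
  qed
  fix \<beta> assume b: "\<beta> \<in> \<Phi>"
  show "(\<forall>v\<in>perp (K \<union> S). \<beta> \<bullet> v = 0) \<or>
      (\<exists>\<beta>'\<in>\<Phi>. \<exists>c>0. \<forall>v\<in>perp (K \<union> S). \<beta> \<bullet> v = c * (\<beta>' \<bullet> \<phi> v))"
  proof (cases "\<forall>v\<in>perp K. \<beta> \<bullet> v = 0")
    case True
    then show ?thesis using sub by auto
  next
    case False
    then obtain \<beta>' c where "\<beta>' \<in> \<Phi>" "c > 0" "\<forall>v\<in>perp K. \<beta> \<bullet> v = c * (\<beta>' \<bullet> \<phi> v)"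
      using restr_hom_root[OF hom b] by metis
    then show ?thesis using sub by (intro disjI2 bexI[of _ \<beta>'] exI[of _ c]) auto
  qed
next
  have sub: "perp (K \<union> S) \<subseteq> perp K" by (rule perp_antimono) simp
  fix \<alpha> assume a: "\<alpha> \<in> \<Delta> - (K \<union> S)"
  have "\<pi> \<alpha> \<notin> \<pi> ` S" using inj a S by (auto dest: inj_onD)
  moreover obtain c where c: "\<pi> \<alpha> \<in> \<Delta> - K'" "c > 0" "\<forall>v\<in>perp K. \<alpha> \<bullet> v = c * (\<pi> \<alpha> \<bullet> \<phi> v)"
    using restr_hom_simple[OF hom, of \<alpha>] a by (metis Diff_iff Un_iff)
  ultimately show "\<pi> \<alpha> \<in> \<Delta> - (K' \<union> \<pi> ` S)" by simp
  show "\<exists>c>0. \<forall>v\<in>perp (K \<union> S). \<alpha> \<bullet> v = c * (\<pi> \<alpha> \<bullet> \<phi> v)"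
    using c sub by (intro exI[of _ c]) auto
qed

lemma restr_iso_extend:
  assumes iso: "restr_iso K K' \<phi> \<psi> \<pi> \<rho>" and S: "S \<subseteq> \<Delta> - K"
  shows "restr_iso (K \<union> S) (K' \<union> \<pi> ` S) \<phi> \<psi> \<pi> \<rho>"
proof -
  have inj: "inj_on \<pi> (\<Delta> - K)" "inj_on \<rho> (\<Delta> - K')"
    using iso by (auto simp: restr_iso_def intro: inj_on_inverseI)
  note S' = restr_iso_image(1)[OF iso S]
  have "\<rho> ` \<pi> ` S = S" by (rule restr_iso_image(2)[OF iso S])
  then have "restr_hom (K' \<union> \<pi> ` S) (K \<union> S) \<psi> \<rho>"
    using restr_hom_extend[OF _ inj(2) S', of K \<psi>] iso by (simp add: restr_iso_def)
  moreover have "restr_hom (K \<union> S) (K' \<union> \<pi> ` S) \<phi> \<pi>"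
    using restr_hom_extend[OF _ inj(1) S] iso by (simp add: restr_iso_def)
  moreover have "perp (K \<union> S) \<subseteq> perp K" "perp (K' \<union> \<pi> ` S) \<subseteq> perp K'"
    by (rule perp_antimono, simp)+
  ultimately show ?thesis using iso unfolding restr_iso_def by auto
qed

lemma restr_iso_generic:
  assumes iso: "restr_iso K K' \<phi> \<psi> \<pi> \<rho>" and v: "generic K v"
  shows "generic K' (\<phi> v)"
  unfolding generic_def
proof (intro conjI ballI impI)
  have vK: "v \<in> perp K" using v by (simp add: generic_def)
  then show "\<phi> v \<in> perp K'" using iso by (auto simp: restr_iso_def restr_hom_def)
  fix \<beta> u assume b: "\<beta> \<in> \<Phi>" "\<beta> \<bullet> \<phi> v = 0" and u: "u \<in> perp K'"
  have uK: "\<psi> u \<in> perp K" using iso u by (auto simp: restr_iso_def restr_hom_def)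
  show "\<beta> \<bullet> u = 0"
  proof (cases "\<forall>v\<in>perp K'. \<beta> \<bullet> v = 0")
    case False
    then obtain \<beta>' c where c: "\<beta>' \<in> \<Phi>" "c > 0" "\<forall>v\<in>perp K'. \<beta> \<bullet> v = c * (\<beta>' \<bullet> \<psi> v)"
      using restr_hom_root[OF restr_iso_hom[OF restr_iso_sym[OF iso]] b(1)] by metis
    have "\<psi> (\<phi> v) = v" using iso vK by (simp add: restr_iso_def)
    then have "\<beta>' \<bullet> v = 0" using c b \<open>\<phi> v \<in> perp K'\<close> by auto
    then have "\<beta>' \<bullet> \<psi> u = 0" using v c uK by (auto simp: generic_def)
    then show ?thesis using c u by simp
  qed (use u in auto)
qed

text \<open>Replace \<open>w\<close> by its representative point, move this point by
  \<open>\<phi>\<close> and take the adjacent element. Points in different chambers remain in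
  different chambers, so this is injective; the reverse inequality comes from the inverse
  isomorphism.\<close>

lemma restr_iso_tset_le:
  assumes iso: "restr_iso K K' \<phi> \<psi> \<pi> \<rho>" and K: "K \<subseteq> \<Delta>" "K' \<subseteq> \<Delta>" and S: "S \<subseteq> \<Delta> - K"
  shows "card (tset (K \<union> S) K) \<le> card (tset (K' \<union> \<pi> ` S) K')"
proof -
  define g where "g w = (SOME w'. adjacent K' (\<phi> (rep_point K w)) w')" for w
  have gen: "generic K (rep_point K w)" "generic K' (\<phi> (rep_point K w))" "adjacent K (rep_point K w) w"
    if "w \<in> tset (K \<union> S) K" for w
    using that K generic_rep_point[of w K] adjacent_rep_point[of w K] restr_iso_generic[OF iso]
    by (auto simp: tset_def)
  have g: "adjacent K' (\<phi> (rep_point K w)) (g w)" if "w \<in> tset (K \<union> S) K" for w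
    unfolding g_def using adjacent_exists[OF K(2)] gen(2)[OF that] someI_ex by (metis generic_def)
  show ?thesis
  proof (rule card_inj_on_le)
    show "finite (tset (K' \<union> \<pi> ` S) K')" by (rule finite_tset)
    show "g ` tset (K \<union> S) K \<subseteq> tset (K' \<union> \<pi> ` S) K'"
    proof
      fix z assume "z \<in> g ` tset (K \<union> S) K"
      then obtain w where w: "w \<in> tset (K \<union> S) K" "z = g w" by auto
      define v where "v = rep_point K w"
      have v: "v \<in> perp K" using gen(1)[OF w(1)] by (simp add: v_def generic_def)
      have z: "adjacent K' (\<phi> v) z" using g[OF w(1)] w by (simp add: v_def)
      have "pos (z (\<pi> \<alpha>))" if a: "\<alpha> \<in> S" for \<alpha>
      proof -
        have aD: "\<alpha> \<in> \<Delta>" "\<alpha> \<notin> K" using a S by auto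
        have "\<alpha> \<bullet> v \<noteq> 0"
          using generic_zero[OF gen(1)[OF w(1)] K(1), of \<alpha>] aD Delta_Phi simple_vanish
          by (auto simp: v_def)
        moreover have "0 \<le> \<alpha> \<bullet> v"
          using w(1) a pos_pt_nonneg unfolding v_def by (auto simp: inner_rep_point tset_def)
        ultimately have "0 < \<alpha> \<bullet> v" by simp
        moreover obtain c where "c > 0" "\<forall>v\<in>perp K. \<alpha> \<bullet> v = c * (\<pi> \<alpha> \<bullet> \<phi> v)" "\<pi> \<alpha> \<in> \<Delta>"
          using restr_hom_simple[OF restr_iso_hom[OF iso] subsetD[OF S a]] by (metis Diff_iff)
        ultimately have "0 < \<pi> \<alpha> \<bullet> \<phi> v" "\<pi> \<alpha> \<in> \<Phi>"
          using v Delta_Phi by (auto simp: zero_less_mult_iff)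
        then show ?thesis using z by (simp add: adjacent_def)
      qed
      then show "z \<in> tset (K' \<union> \<pi> ` S) K'"
        using z pos_simple unfolding adjacent_def tset_def by blast
    qed
    show "inj_on g (tset (K \<union> S) K)"
    proof (rule inj_onI)
      fix w z assume w: "w \<in> tset (K \<union> S) K" and z: "z \<in> tset (K \<union> S) K" and eq: "g w = g z"
      define v where "v = rep_point K w"
      define u where "u = rep_point K z"
      have vK: "v \<in> perp K" and uK: "u \<in> perp K"
        using gen(1)[OF w] gen(1)[OF z] by (auto simp: v_def u_def generic_def)
      \<comment> \<open>Equal adjacent elements force the images of \<open>v\<close> and
        \<open>u\<close> to lie on the same side of every restricted hyperplane, hence
        \<open>v\<close> and \<open>u\<close> themselves.\<close>
      have "pos (z \<beta>)" if b: "\<beta> \<in> \<Phi>" "0 < \<beta> \<bullet> v" for \<beta>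
      proof -
        have nz: "\<not> (\<forall>v\<in>perp K. \<beta> \<bullet> v = 0)" using b vK by (metis less_irrefl)
        then obtain \<beta>' c where c: "\<beta>' \<in> \<Phi>" "c > 0" "\<forall>v\<in>perp K. \<beta> \<bullet> v = c * (\<beta>' \<bullet> \<phi> v)"
          using restr_hom_root[OF restr_iso_hom[OF iso] b(1)] by metis
        have "0 < \<beta>' \<bullet> \<phi> v" using c b vK by (auto simp: zero_less_mult_iff)
        then have gpos: "pos (g w \<beta>')" using g[OF w] c by (auto simp: adjacent_def v_def)
        have "\<not> \<beta> \<bullet> u < 0"
        proof
          assume "\<beta> \<bullet> u < 0"
          then have "0 < (- \<beta>') \<bullet> \<phi> u" using c uK by (auto simp: mult_less_0_iff)
          then have "pos (g z (- \<beta>'))" using g[OF z] uminus_Phi[OF c(1)] by (auto simp: adjacent_def u_def)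
          moreover have "g z (- \<beta>') = - g w \<beta>'"
            using g[OF w] eq refl_elems_neg by (auto simp: adjacent_def)
          ultimately show False using pos_asym[OF gpos] by simp
        qed
        moreover have "\<beta> \<bullet> u \<noteq> 0" using gen(1)[OF z] nz b by (auto simp: generic_def u_def)
        ultimately have "0 < \<beta> \<bullet> u" by simp
        then show ?thesis using gen(3)[OF z] b by (auto simp: adjacent_def u_def)
      qed
      then have "adjacent K v z" using z by (auto simp: adjacent_def tset_def)
      then show "w = z"
        using adjacent_unique[OF K(1) gen(1)[OF w] gen(3)[OF w]] by (simp add: v_def)
    qed
  qed
qed

lemma restr_iso_tset:
  assumes iso: "restr_iso K K' \<phi> \<psi> \<pi> \<rho>" and K: "K \<subseteq> \<Delta>" "K' \<subseteq> \<Delta>" and S: "S \<subseteq> \<Delta> - K"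
  shows "card (tset (K \<union> S) K) = card (tset (K' \<union> \<pi> ` S) K')"
proof (rule antisym)
  show "card (tset (K \<union> S) K) \<le> card (tset (K' \<union> \<pi> ` S) K')"
    by (rule restr_iso_tset_le[OF assms])
  note S' = restr_iso_image(1)[OF iso S]
  have "\<rho> ` \<pi> ` S = S" by (rule restr_iso_image(2)[OF iso S])
  then show "card (tset (K' \<union> \<pi> ` S) K') \<le> card (tset (K \<union> S) K)"
    using restr_iso_tset_le[OF restr_iso_sym[OF iso] K(2,1) S'] by simp
qed

text \<open>The image is cut out by all roots vanishing on it: a point in their common kernel pulls
  back into \<open>Y\<close>, because each root of \<open>A\<close> that is nonzero on
  \<open>perp K\<close> corresponds to one of them.\<close>

lemma restr_iso_Flats:
  assumes iso: "restr_iso K K' \<phi> \<psi> \<pi> \<rho>" and K: "K' \<subseteq> \<Delta>" and Y: "Y \<in> Flats" "Y \<subseteq> perp K"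
  shows "\<phi> ` Y \<in> Flats" "\<phi> ` Y \<subseteq> perp K'"
proof -
  obtain A where A: "A \<subseteq> \<Phi>" "Y = perp A" using Y by (auto simp: arrangement_lattice_perp)
  show sub: "\<phi> ` Y \<subseteq> perp K'" using iso Y by (auto simp: restr_iso_def restr_hom_def)
  define A' where "A' = {\<beta>\<in>\<Phi>. \<forall>u\<in>\<phi> ` Y. \<beta> \<bullet> u = 0}"
  have K'A: "K' \<subseteq> A'" using sub K Delta_Phi by (auto simp: A'_def perp_def)
  have eq: "\<phi> ` Y = perp A'"
  proof (intro equalityI subsetI)
    fix u assume u: "u \<in> perp A'"
    then have uK: "u \<in> perp K'" using perp_antimono[OF K'A] by auto
    have pK: "\<psi> u \<in> perp K" using iso uK by (auto simp: restr_iso_def restr_hom_def)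
    have "\<beta> \<bullet> \<psi> u = 0" if b: "\<beta> \<in> A" for \<beta>
    proof (cases "\<forall>v\<in>perp K. \<beta> \<bullet> v = 0")
      case False
      then obtain \<beta>' c where c: "\<beta>' \<in> \<Phi>" "c > 0" "\<forall>v\<in>perp K. \<beta> \<bullet> v = c * (\<beta>' \<bullet> \<phi> v)"
        using restr_hom_root[OF restr_iso_hom[OF iso]] b A by (metis subsetD)
      have "\<beta>' \<bullet> \<phi> y = 0" if y: "y \<in> Y" for y
      proof -
        have "\<beta> \<bullet> y = 0" using y b by (auto simp: A perp_def)
        then show ?thesis using c y Y by auto
      qed
      then have "\<beta>' \<in> A'" using c by (auto simp: A'_def)
      then have "\<beta>' \<bullet> u = 0" using u by (auto simp: perp_def)
      then show ?thesis using c pK iso uK by (auto simp: restr_iso_def)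
    qed (use pK in auto)
    then have "\<psi> u \<in> Y" by (simp add: A perp_def)
    moreover have "\<phi> (\<psi> u) = u" using iso uK by (simp add: restr_iso_def)
    ultimately show "u \<in> \<phi> ` Y" by force
  qed (auto simp: A'_def perp_def)
  show "\<phi> ` Y \<in> Flats" unfolding eq by (rule perp_Flats) (auto simp: A'_def)
qed

lemma restr_iso_chi:
  assumes iso: "restr_iso K K' \<phi> \<psi> \<pi> \<rho>" and K: "K \<subseteq> \<Delta>" "K' \<subseteq> \<Delta>"
  shows "chi x K = chi x K'"
  unfolding chi_def
proof (rule upper_char_poly_iso[OF finite_Phi, where f = \<phi>])
  show "perp K \<in> Flats" "perp K' \<in> Flats" using K Delta_Phi by (auto intro!: perp_Flats)
  show "linear \<phi>" using iso by (simp add: restr_iso_def restr_hom_def)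
  show "inj_on \<phi> (perp K)" using iso by (auto simp: restr_iso_def intro: inj_on_inverseI)
  show "(`) \<phi> ` {Y \<in> Flats. Y \<subseteq> perp K} = {Y \<in> Flats. Y \<subseteq> perp K'}"
  proof (intro equalityI subsetI)
    fix Y assume "Y \<in> (`) \<phi> ` {Y \<in> Flats. Y \<subseteq> perp K}"
    then show "Y \<in> {Y \<in> Flats. Y \<subseteq> perp K'}" using restr_iso_Flats[OF iso K(2)] by auto
  next
    fix Y assume "Y \<in> {Y \<in> Flats. Y \<subseteq> perp K'}"
    then have Y: "Y \<in> Flats" "Y \<subseteq> perp K'" by auto
    then have "\<psi> ` Y \<in> {Y \<in> Flats. Y \<subseteq> perp K}"
      using restr_iso_Flats[OF restr_iso_sym[OF iso] K(1)] by simp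
    moreover have "\<phi> (\<psi> u) = u" if "u \<in> Y" for u using iso Y that by (auto simp: restr_iso_def)
    then have "\<phi> ` \<psi> ` Y = Y" by (simp add: image_image)
    ultimately show "Y \<in> (`) \<phi> ` {Y \<in> Flats. Y \<subseteq> perp K}" by (metis imageI)
  qed
qed

text \<open>The index sets are matched by applying \<open>\<pi>\<close> to the part of
  \<open>J\<close> outside \<open>K\<close>. By \<open>restr_iso_extend\<close> the isomorphism
  restricts to each smaller flat, so all three factors of a summand agree.\<close>

lemma restr_iso_restr_sum:
  assumes iso: "restr_iso K K' \<phi> \<psi> \<pi> \<rho>" and K: "K \<subseteq> \<Delta>" "K' \<subseteq> \<Delta>"
  shows "restr_sum x K = restr_sum x K'"
proof -
  have map: "K' \<union> \<pi> ` (J - K) \<in> {J\<in>Pow \<Delta>. K' \<subseteq> J} \<and> K \<union> \<rho> ` ((K' \<union> \<pi> ` (J - K)) - K') = J"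
    if iso: "restr_iso K K' \<phi> \<psi> \<pi> \<rho>" and K: "K \<subseteq> \<Delta>" "K' \<subseteq> \<Delta>" and J: "J \<in> {J\<in>Pow \<Delta>. K \<subseteq> J}"
    for K K' \<phi> \<psi> \<pi> \<rho> J
  proof -
    have JK: "J - K \<subseteq> \<Delta> - K" using J by auto
    note sub = restr_iso_image(1)[OF iso JK]
    from sub have "(K' \<union> \<pi> ` (J - K)) - K' = \<pi> ` (J - K)" by auto
    moreover have "\<rho> ` \<pi> ` (J - K) = J - K" by (rule restr_iso_image(2)[OF iso JK])
    ultimately show ?thesis using sub K J by auto
  qed
  show ?thesis
    unfolding restr_sum_def
  proof (rule sum.reindex_bij_witness[where i = "\<lambda>J. K \<union> \<rho> ` (J - K')" and j = "\<lambda>J. K' \<union> \<pi> ` (J - K)"])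
    fix J assume J: "J \<in> {J\<in>Pow \<Delta>. K \<subseteq> J}"
    show "K \<union> \<rho> ` ((K' \<union> \<pi> ` (J - K)) - K') = J" "K' \<union> \<pi> ` (J - K) \<in> {J\<in>Pow \<Delta>. K' \<subseteq> J}"
      using map[OF iso K J] by auto
    have S: "J - K \<subseteq> \<Delta> - K" and JK: "K \<union> (J - K) = J" using J by auto
    define J' where "J' = K' \<union> \<pi> ` (J - K)"
    have J': "J' \<subseteq> \<Delta>" using map[OF iso K J] by (auto simp: J'_def)
    have iso': "restr_iso J J' \<phi> \<psi> \<pi> \<rho>" using restr_iso_extend[OF iso S] by (simp only: JK J'_def)
    have "card (tset J K) = card (tset J' K')"
      using restr_iso_tset[OF iso K S] by (simp only: JK J'_def)
    \<comment> \<open>Imposing no wall in \<open>restr_iso_tset\<close> counts all chambers of the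
      restriction to \<open>perp J\<close>.\<close>
    moreover have "card (tset J J) = card (tset J' J')"
      using restr_iso_tset[OF iso' _ J', of "{}"] J by simp
    moreover have "chi x J = chi x J'" using restr_iso_chi[OF iso' _ J'] J by simp
    ultimately show "chi x (K' \<union> \<pi> ` (J - K)) / real (card (tset (K' \<union> \<pi> ` (J - K)) (K' \<union> \<pi> ` (J - K)))) *
        real (card (tset (K' \<union> \<pi> ` (J - K)) K'))
      = chi x J / real (card (tset J J)) * real (card (tset J K))"
      by (simp only: J'_def)
  next
    fix J assume J: "J \<in> {J\<in>Pow \<Delta>. K' \<subseteq> J}"
    show "K' \<union> \<pi> ` ((K \<union> \<rho> ` (J - K')) - K) = J" "K \<union> \<rho> ` (J - K') \<in> {J\<in>Pow \<Delta>. K \<subseteq> J}"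
      using map[OF restr_iso_sym[OF iso] K(2,1) J] by auto
  qed
qed

section \<open>Restrictions of dimension at most two\<close>

lemma tset_Delta:
  assumes "K \<subseteq> \<Delta>"
  shows "tset \<Delta> K = {id}"
  using W_pos_id assms pos_simple refl_elems_id by (auto simp: tset_def)

text \<open>A chamber on which every wall of the fundamental one is negative must contain
  \<open>- pt K\<close>, so its element is the one adjacent to this point.\<close>

lemma card_tset_negative:
  assumes K: "K \<subseteq> \<Delta>"
  shows "card {w\<in>tset K K. \<forall>\<alpha>\<in>\<Delta> - K. \<not> pos (w \<alpha>)} = 1"
proof -
  have gen: "generic K (- pt K)"
    using K pt_perp pt_zero_perp by (auto simp: generic_def perp_def)
  have "{w\<in>tset K K. \<forall>\<alpha>\<in>\<Delta> - K. \<not> pos (w \<alpha>)} = {w. adjacent K (- pt K) w}"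
  proof (intro equalityI subsetI)
    fix w assume "w \<in> {w\<in>tset K K. \<forall>\<alpha>\<in>\<Delta> - K. \<not> pos (w \<alpha>)}"
    then have w: "w \<in> W" "w ` K \<subseteq> \<Delta>" and neg: "\<And>\<alpha>. \<alpha> \<in> \<Delta> - K \<Longrightarrow> \<not> pos (w \<alpha>)"
      by (auto simp: tset_def)
    have "pos (w \<beta>)" if b: "\<beta> \<in> \<Phi>" "0 < \<beta> \<bullet> - pt K" for \<beta>
    proof -
      have "\<not> pos \<beta>" using pos_pt_nonneg[of \<beta> K] b by auto
      then have nb: "pos (- \<beta>)" using pos_cases b by auto
      have r: "generic K (rep_point K w)" using generic_rep_point[OF w(1) K w(2)] .
      have "\<alpha> \<bullet> rep_point K w \<le> 0" if "\<alpha> \<in> \<Delta> - K" for \<alpha>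
      proof -
        have "pos (- w \<alpha>)" using neg[OF that] pos_cases W_Phi[OF w(1)] that Delta_Phi by blast
        then show ?thesis using pos_pt_nonneg[of "- w \<alpha>" "w ` K"] by (simp add: inner_rep_point[OF w(1)])
      qed
      \<comment> \<open>The coefficients of the negative root \<open>\<beta>\<close> are
        nonpositive, and so are the simple roots outside \<open>K\<close> at the representative
        point.\<close>
      then have "0 \<le> \<beta> \<bullet> rep_point K w"
        using r nb unfolding generic_def
        by (subst perp_expand[of _ K]) (auto simp: pos_def intro!: sum_nonneg mult_nonpos_nonpos)
      moreover have "\<beta> \<bullet> rep_point K w \<noteq> 0" using generic_zero[OF r K b(1)] b(2) by auto
      ultimately have "0 < w \<beta> \<bullet> pt (w ` K)" by (simp add: inner_rep_point[OF w(1)])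
      then show ?thesis using pos_iff_pt W_Phi[OF w(1) b(1)] by blast
    qed
    then show "w \<in> {w. adjacent K (- pt K) w}" using w by (simp add: adjacent_def)
  next
    fix w assume "w \<in> {w. adjacent K (- pt K) w}"
    then have w: "w \<in> W" "w ` K \<subseteq> \<Delta>" and adj: "\<And>\<beta>. \<beta> \<in> \<Phi> \<Longrightarrow> 0 < \<beta> \<bullet> - pt K \<Longrightarrow> pos (w \<beta>)"
      by (auto simp: adjacent_def)
    have "\<not> pos (w \<alpha>)" if a: "\<alpha> \<in> \<Delta> - K" for \<alpha>
    proof -
      have "pos (w (- \<alpha>))" using a Delta_Phi uminus_Phi by (intro adj) (auto simp: inner_pt)
      then show ?thesis using pos_asym[of "w \<alpha>"] refl_elems_neg[OF w(1)] by auto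
    qed
    then show "w \<in> {w\<in>tset K K. \<forall>\<alpha>\<in>\<Delta> - K. \<not> pos (w \<alpha>)}" using w by (simp add: tset_same)
  qed
  moreover obtain w where "adjacent K (- pt K) w" using adjacent_exists[OF K, of "- pt K"] gen
    unfolding generic_def by blast
  then have "{w. adjacent K (- pt K) w} = {w}" using adjacent_unique[OF K gen] by blast
  ultimately show ?thesis by simp
qed

text \<open>The class of \<open>\<Delta>\<close> is a singleton, so the averaged identity determines
  the polynomial.\<close>

lemma restr_sum_codim0: "restr_sum x \<Delta> = chi x \<Delta>" "chi x \<Delta> = 1"
proof -
  have "{J\<in>Pow \<Delta>. \<Delta> \<subseteq> J} = {\<Delta>}" by auto
  then show 1: "restr_sum x \<Delta> = chi x \<Delta>" by (simp add: restr_sum_def tset_Delta)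
  have "I = \<Delta>" if I: "I \<in> cls \<Delta>" for I
  proof -
    have "I \<subseteq> \<Delta>" by (rule conj_class_subset[OF I])
    then show ?thesis using conj_class_card[OF I] finite_Delta by (simp add: card_subset_eq)
  qed
  then have "restr_sum x \<Delta> = x ^ (DIM('a) - card \<Delta>)" by (intro restr_sum_eq) auto
  then show "chi x \<Delta> = 1" using 1 by (simp add: card_Delta)
qed

lemma chi_conj_class: "I \<in> cls K \<Longrightarrow> chi x I = chi x K"
  using chi_W unfolding conj_class_iff by blast

lemma card_tset_conj_class: "I \<in> cls K \<Longrightarrow> card (tset I I) = card (tset K K)"
  using card_tset_conj unfolding conj_class_iff by blast

lemma card_Delta_diff: "K \<subseteq> \<Delta> \<Longrightarrow> card (\<Delta> - K) = DIM('a) - card K"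
  using finite_subset[OF _ finite_Delta] by (simp add: card_Diff_subset card_Delta)

text \<open>Only \<open>K\<close> and \<open>\<Delta>\<close> contain \<open>K\<close>, so the sum
  is \<open>chi x K + 1\<close>, which is constant on the class. The identity then holds and yields
  \<open>chi\<close>. The two chambers are the fundamental ray and its opposite.\<close>

lemma restr_sum_codim1:
  assumes K: "K \<subseteq> \<Delta>" and d: "card (\<Delta> - K) = 1"
  shows "restr_sum x K = x" "chi x K = x - 1" "card (tset K K) = 2"
proof -
  have *: "restr_sum x I = chi x I + 1" if I: "I \<subseteq> \<Delta>" "card (\<Delta> - I) = 1" for I
  proof -
    obtain \<gamma> where g: "\<Delta> - I = {\<gamma>}" using I(2) card_1_singletonE by blast
    then have D: "\<Delta> = insert \<gamma> I" using I(1) by auto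
    have "{J\<in>Pow \<Delta>. I \<subseteq> J} = {I, \<Delta>}"
    proof (intro equalityI subsetI)
      fix J assume "J \<in> {J\<in>Pow \<Delta>. I \<subseteq> J}"
      then show "J \<in> {I, \<Delta>}" using D by (cases "\<gamma> \<in> J") auto
    qed (use I in auto)
    moreover have "I \<noteq> \<Delta>" using g by auto
    ultimately show ?thesis
      using I(1) card_tset_pos[OF I(1)] by (simp add: restr_sum_def tset_Delta restr_sum_codim0)
  qed
  have const: "restr_sum x I = restr_sum x K" if I: "I \<in> cls K" for I
  proof -
    have "I \<subseteq> \<Delta>" by (rule conj_class_subset[OF I])
    moreover have "card (\<Delta> - I) = 1"
      using d card_Delta_diff[OF \<open>I \<subseteq> \<Delta>\<close>] card_Delta_diff[OF K] conj_class_card[OF I] by simp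
    ultimately show ?thesis using *[of I] *[OF K d] chi_conj_class[OF I] by simp
  qed
  have "restr_sum x K = x ^ (DIM('a) - card K)" using K const by (rule restr_sum_eq)
  then show 1: "restr_sum x K = x" using d card_Delta_diff[OF K] by simp
  show "chi x K = x - 1" using 1 *[OF K d] by simp
  obtain \<gamma> where g: "\<Delta> - K = {\<gamma>}" using d card_1_singletonE by blast
  let ?N = "{w\<in>tset K K. \<forall>\<alpha>\<in>\<Delta> - K. \<not> pos (w \<alpha>)}"
  have "tset K K = ?N \<union> tset \<Delta> K" "?N \<inter> tset \<Delta> K = {}"
  proof -
    have D: "\<Delta> = insert \<gamma> K" using g K by auto
    have "tset \<Delta> K = {w\<in>tset K K. pos (w \<gamma>)}" by (subst D) (auto simp: tset_def)
    moreover have "?N = {w\<in>tset K K. \<not> pos (w \<gamma>)}" by (simp add: g)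
    ultimately show "tset K K = ?N \<union> tset \<Delta> K" "?N \<inter> tset \<Delta> K = {}" by auto
  qed
  then have "card (tset K K) = card ?N + card (tset \<Delta> K)"
    using card_Un_disjoint[of ?N "tset \<Delta> K"] finite_tset by simp
  then show "card (tset K K) = 2" using card_tset_negative[OF K] tset_Delta[OF K] by simp
qed

text \<open>The individual counts for the two walls may vary within the class, but only their sum
  enters, and this sum is the number of all chambers, which is a class invariant.\<close>

lemma restr_sum_codim2:
  assumes K: "K \<subseteq> \<Delta>" and d: "card (\<Delta> - K) = 2"
  shows "restr_sum x K = x ^ 2"
proof -
  have *: "restr_sum x I = chi x I + (x - 1) / 2 * real (card (tset I I)) + 1"
    if I: "I \<subseteq> \<Delta>" "card (\<Delta> - I) = 2" for I
  proof -
    obtain \<beta> \<gamma> where g: "\<Delta> - I = {\<beta>, \<gamma>}" "\<beta> \<noteq> \<gamma>" using I(2) card_2_iff by metis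
    have ne: "\<beta> \<notin> I" "\<gamma> \<notin> I" "\<beta> \<in> \<Delta>" "\<gamma> \<in> \<Delta>" using g by auto
    have D: "\<Delta> = insert \<beta> (insert \<gamma> I)" using g I by auto
    have "{J\<in>Pow \<Delta>. I \<subseteq> J} = {I, insert \<beta> I, insert \<gamma> I, \<Delta>}"
    proof (intro equalityI subsetI)
      fix J assume J: "J \<in> {J\<in>Pow \<Delta>. I \<subseteq> J}"
      then show "J \<in> {I, insert \<beta> I, insert \<gamma> I, \<Delta>}"
        using D by (cases "\<beta> \<in> J"; cases "\<gamma> \<in> J") auto
    qed (use I ne in auto)
    moreover have "distinct [I, insert \<beta> I, insert \<gamma> I, \<Delta>]" using ne g(2) D by auto
    ultimately have sum: "restr_sum x I = chi x I
        + chi x (insert \<beta> I) / real (card (tset (insert \<beta> I) (insert \<beta> I))) * real (card (tset (insert \<beta> I) I))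
        + chi x (insert \<gamma> I) / real (card (tset (insert \<gamma> I) (insert \<gamma> I))) * real (card (tset (insert \<gamma> I) I))
        + 1"
      using I(1) card_tset_pos[OF I(1)] by (simp add: restr_sum_def tset_Delta restr_sum_codim0)
    have "\<Delta> - insert \<beta> I = {\<gamma>}" "\<Delta> - insert \<gamma> I = {\<beta>}" using g by auto
    then have eqs: "chi x (insert \<beta> I) = x - 1" "chi x (insert \<gamma> I) = x - 1"
        "card (tset (insert \<beta> I) (insert \<beta> I)) = 2" "card (tset (insert \<gamma> I) (insert \<gamma> I)) = 2"
      using restr_sum_codim1[of "insert \<beta> I"] restr_sum_codim1[of "insert \<gamma> I"] I ne by auto
    then have sum': "restr_sum x I = chi x I
        + (x - 1) / 2 * (real (card (tset (insert \<beta> I) I)) + real (card (tset (insert \<gamma> I) I))) + 1"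
      using sum unfolding eqs by (simp add: field_simps)
    let ?N = "{w\<in>tset I I. \<forall>\<alpha>\<in>\<Delta> - I. \<not> pos (w \<alpha>)}"
    let ?B = "tset (insert \<beta> I) I" and ?C = "tset (insert \<gamma> I) I"
    have sets: "?N = {w\<in>tset I I. \<not> pos (w \<beta>) \<and> \<not> pos (w \<gamma>)}" "?B = {w\<in>tset I I. pos (w \<beta>)}"
      "?C = {w\<in>tset I I. pos (w \<gamma>)}"
      by (simp add: g, auto simp: tset_def)
    have all: "tset \<Delta> I = {w\<in>tset I I. pos (w \<beta>) \<and> pos (w \<gamma>)}" by (subst D) (auto simp: tset_def)
    have T: "tset I I = ?N \<union> (?B \<union> ?C)" and N: "?N \<inter> (?B \<union> ?C) = {}" and BC: "?B \<inter> ?C = tset \<Delta> I"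
      unfolding sets all by auto
    have "card (tset I I) = card ?N + card (?B \<union> ?C)"
      unfolding T[symmetric]
      using card_Un_disjoint[OF _ _ N, unfolded T[symmetric]] finite_tset by simp
    \<comment> \<open>Exactly one chamber is positive on both walls and exactly one on neither, so
      the double count and the omission balance.\<close>
    moreover have "card ?B + card ?C = card (?B \<union> ?C) + card (tset \<Delta> I)"
      using card_Un_Int[of ?B ?C] finite_tset BC by simp
    ultimately have "card ?B + card ?C = card (tset I I)"
      using card_tset_negative[OF I(1)] tset_Delta[OF I(1)] by simp
    then show ?thesis using sum' by (simp flip: of_nat_add)
  qed
  have const: "restr_sum x I = restr_sum x K" if I: "I \<in> cls K" for I
  proof -
    have "I \<subseteq> \<Delta>" by (rule conj_class_subset[OF I])
    moreover have "card (\<Delta> - I) = 2"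
      using d card_Delta_diff[OF \<open>I \<subseteq> \<Delta>\<close>] card_Delta_diff[OF K] conj_class_card[OF I] by simp
    ultimately show ?thesis
      using *[of I] *[OF K d] chi_conj_class[OF I] card_tset_conj_class[OF I] by simp
  qed
  have "restr_sum x K = x ^ (DIM('a) - card K)" using K const by (rule restr_sum_eq)
  then show ?thesis using d card_Delta_diff[OF K] by simp
qed

theorem restr_sum_small_rank:
  assumes "DIM('a) \<le> 3" and K: "K \<subseteq> \<Delta>"
  shows "restr_sum x K = x ^ (DIM('a) - card K)"
proof (cases "K = {}")
  case True
  have "I = {}" if "I \<in> cls {}" for I using that unfolding conj_class_iff by blast
  then show ?thesis using True by (intro restr_sum_eq) auto
next
  case False
  then have "0 < card K" using finite_subset[OF K finite_Delta] by (simp add: card_gt_0_iff)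
  then consider "card (\<Delta> - K) = 0" | "card (\<Delta> - K) = 1" | "card (\<Delta> - K) = 2"
    using assms(1) card_Delta_diff[OF K] by linarith
  then show ?thesis
  proof cases
    case 1
    then have "K = \<Delta>" using K finite_Delta by auto
    then show ?thesis using restr_sum_codim0 by (simp add: card_Delta)
  next
    case 2
    then show ?thesis using restr_sum_codim1[OF K] card_Delta_diff[OF K] by simp
  next
    case 3
    then show ?thesis using restr_sum_codim2[OF K] card_Delta_diff[OF K] by simp
  qed
qed

end

section \<open>Types A and B\<close>

lemma ex_order_iso:
  fixes C D :: "nat set"
  assumes "finite C" "finite D" "card C = card D"
  shows "\<exists>h. bij_betw h C D \<and> (\<forall>i\<in>C. \<forall>j\<in>C. h i \<le> h j \<longleftrightarrow> i \<le> j)"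
proof -
  obtain f where f: "bij_betw f {..<card C} C" "strict_mono_on {..<card C} f"
    using ex_bij_betw_strict_mono_card[OF assms(1)] .
  obtain g where g: "bij_betw g {..<card C} D" "strict_mono_on {..<card C} g"
    using ex_bij_betw_strict_mono_card[OF assms(2)] assms(3) by metis
  let ?k = "inv_into {..<card C} f"
  have k: "bij_betw ?k C {..<card C}" using f(1) by (rule bij_betw_inv_into)
  have "g (?k i) \<le> g (?k j) \<longleftrightarrow> i \<le> j" if ij: "i \<in> C" "j \<in> C" for i j
  proof -
    have kk: "?k i \<in> {..<card C}" "?k j \<in> {..<card C}" using k ij bij_betwE by blast+
    have "f (?k i) = i" "f (?k j) = j" using f(1) ij by (auto simp: bij_betw_inv_into_right)
    then show ?thesis
      using strict_mono_on_less_eq[OF f(2) kk] strict_mono_on_less_eq[OF g(2) kk] by simp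
  qed
  moreover have "bij_betw (g \<circ> ?k) C D" using k g(1) by (rule bij_betw_trans)
  ultimately show ?thesis by (intro exI[of _ "g \<circ> ?k"]) simp
qed

abbreviation (in based_roots) n where "n \<equiv> card \<Delta>"

text \<open>Types A and B are treated together: in suitable coordinates \<open>e\<close> the reflecting hyperplanes are
  those orthogonal to \<open>e i - \<sigma> e j\<close>, where \<open>\<sigma> = 1\<close> in type A and \<open>\<sigma> = \<plusminus>1\<close> in type B. Since
  \<open>e (card \<Delta>) = 0\<close>, this includes the roots proportional to \<open>e i\<close>. On the kernel of \<open>K\<close>, the vector \<open>e i\<close>
  only depends on the number of simple roots outside \<open>K\<close> from position \<open>i\<close> on.\<close>

locale chain_roots = based_roots +
  fixes b :: "nat \<Rightarrow> 'a" and s :: "nat \<Rightarrow> real" and signs :: "real set"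
    and a e :: "nat \<Rightarrow> 'a"
  assumes bij_b: "bij_betw b {..<card \<Delta>} \<Delta>" and s_pos: "\<And>i. 0 < s i"
    and a: "a = (\<lambda>i. s i *\<^sub>R b i)" and e: "e = (\<lambda>i. sum a {i..<card \<Delta>})"
    and root_line: "\<And>\<beta>. \<beta> \<in> \<Phi> \<Longrightarrow>
      \<exists>i\<le>card \<Delta>. \<exists>j\<le>card \<Delta>. \<exists>\<sigma>\<in>signs. \<exists>c. \<beta> = c *\<^sub>R (e i - \<sigma> *\<^sub>R e j)"
    and line_root: "\<And>i j \<sigma>. i \<le> card \<Delta> \<Longrightarrow> j \<le> card \<Delta> \<Longrightarrow> \<sigma> \<in> signs \<Longrightarrow>
      e i - \<sigma> *\<^sub>R e j = 0 \<or> (\<exists>\<beta>\<in>\<Phi>. \<exists>c. e i - \<sigma> *\<^sub>R e j = c *\<^sub>R \<beta>)"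
begin

section \<open>Linear maps between restrictions in chain coordinates\<close>

definition idx :: "'a set \<Rightarrow> nat set"
  where "idx K = {i. i < n \<and> b i \<notin> K}"

definition dual :: "nat \<Rightarrow> 'a"
  where "dual i = (1 / s i) *\<^sub>R coweight (b i)"

text \<open>On \<open>perp K\<close> the values of \<open>a i\<close> for \<open>i\<close> in
  \<open>idx K\<close> are coordinates; the map hands them over to the positions
  \<open>h i\<close>.\<close>

definition block_map :: "'a set \<Rightarrow> (nat \<Rightarrow> nat) \<Rightarrow> 'a \<Rightarrow> 'a"
  where "block_map K h v = (\<Sum>i\<in>idx K. (a i \<bullet> v) *\<^sub>R dual (h i))"

definition simple_map :: "(nat \<Rightarrow> nat) \<Rightarrow> 'a \<Rightarrow> 'a"
  where "simple_map h \<alpha> = b (h (inv_into {..<n} b \<alpha>))"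

lemma b_Delta: "i < n \<Longrightarrow> b i \<in> \<Delta>"
  using bij_b bij_betwE by blast

lemma b_inv: "i < n \<Longrightarrow> inv_into {..<n} b (b i) = i"
  using bij_b by (simp add: bij_betw_inv_into_left)

lemma b_cases:
  assumes "\<alpha> \<in> \<Delta>"
  obtains i where "i < n" "\<alpha> = b i"
  using assms bij_b by (auto simp: bij_betw_def)

lemma b_eq: "i < n \<Longrightarrow> j < n \<Longrightarrow> b i = b j \<longleftrightarrow> i = j"
  using bij_b by (auto simp: bij_betw_def inj_on_eq_iff)

lemma finite_idx: "finite (idx K)"
  by (simp add: idx_def)

lemma a_dual:
  assumes "i < n" "j < n"
  shows "a i \<bullet> dual j = (if i = j then 1 else 0)"
proof -
  have "s j \<noteq> 0" using s_pos[of j] by simp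
  then show ?thesis using assms b_Delta by (simp add: a dual_def inner_coweight b_eq)
qed

lemma a_perp: "v \<in> perp K \<Longrightarrow> b i \<in> K \<Longrightarrow> a i \<bullet> v = 0"
  by (simp add: a perp_def)

lemma linear_block_map: "linear (block_map K h)"
  unfolding block_map_def
  by (rule linearI)
    (simp_all add: inner_add_right scaleR_add_left sum.distrib scaleR_sum_right)

context
  fixes K K' :: "'a set" and h
  assumes K: "K \<subseteq> \<Delta>" "K' \<subseteq> \<Delta>"
    and h: "bij_betw h (idx K) (idx K')"
    and mono: "\<And>i j. i \<in> idx K \<Longrightarrow> j \<in> idx K \<Longrightarrow> h i \<le> h j \<longleftrightarrow> i \<le> j"
begin

lemma h_idx: "i \<in> idx K \<Longrightarrow> h i \<in> idx K'"
  using h bij_betwE by blast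

lemma a_block_map: "i \<in> idx K \<Longrightarrow> a (h i) \<bullet> block_map K h v = a i \<bullet> v"
proof -
  assume i: "i \<in> idx K"
  have "a (h i) \<bullet> block_map K h v = (\<Sum>j\<in>idx K. (a j \<bullet> v) * (a (h i) \<bullet> dual (h j)))"
    by (simp add: block_map_def inner_sum_right)
  also have "\<dots> = (\<Sum>j\<in>idx K. if j = i then a i \<bullet> v else 0)"
  proof (rule sum.cong[OF refl])
    fix j assume j: "j \<in> idx K"
    have "h i = h j \<longleftrightarrow> i = j" using h i j by (auto simp: bij_betw_def inj_on_eq_iff)
    moreover have "h i < n" "h j < n" using h_idx i j by (auto simp: idx_def)
    ultimately show "(a j \<bullet> v) * (a (h i) \<bullet> dual (h j)) = (if j = i then a i \<bullet> v else 0)"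
      by (auto simp: a_dual)
  qed
  also have "\<dots> = a i \<bullet> v" using i finite_idx by simp
  finally show ?thesis .
qed

lemma block_map_perp: "block_map K h v \<in> perp K'"
proof -
  have "\<alpha> \<bullet> block_map K h v = 0" if al: "\<alpha> \<in> K'" for \<alpha>
  proof -
    obtain i where i: "i < n" "\<alpha> = b i" using b_cases al K by blast
    have "a i \<bullet> dual (h j) = 0" if "j \<in> idx K" for j
      using h_idx[OF that] i al by (auto simp: idx_def a_dual)
    then have "a i \<bullet> block_map K h v = 0" by (simp add: block_map_def inner_sum_right)
    then show ?thesis using i s_pos[of i] by (simp add: a)
  qed
  then show ?thesis by (simp add: perp_def)
qed

lemma e_restrict:
  assumes "v \<in> perp K"
  shows "e i \<bullet> v = (\<Sum>k\<in>{k\<in>idx K. i \<le> k}. a k \<bullet> v)"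
  unfolding e inner_sum_left
  using assms a_perp by (intro sum.mono_neutral_right) (auto simp: idx_def)

text \<open>On \<open>perp K\<close>, \<open>e i\<close> is the sum of the coordinates over an upper
  segment of \<open>idx K\<close>. An order isomorphism carries upper segments to upper
  segments.\<close>

lemma e_block_map:
  assumes i: "i \<le> n"
  shows "\<exists>i'\<le>n. \<forall>v\<in>perp K. e i \<bullet> v = e i' \<bullet> block_map K h v"
proof -
  define S where "S = {k\<in>idx K. i \<le> k}"
  have fin: "finite S" using finite_idx by (simp add: S_def)
  \<comment> \<open>For an empty segment \<open>e i\<close> vanishes on \<open>perp K\<close>, and
    the index \<open>n\<close> represents it because \<open>e n\<close> is an empty sum.\<close>
  define i' where "i' = (if S = {} then n else h (Min S))"
  have h_img: "h ` S = {k\<in>idx K'. i' \<le> k}"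
  proof (cases "S = {}")
    case True
    then show ?thesis by (auto simp: i'_def idx_def)
  next
    case False
    then have m: "Min S \<in> S" using fin by simp
    then have mK: "Min S \<in> idx K" "i \<le> Min S" by (auto simp: S_def)
    have S: "k \<in> S \<longleftrightarrow> i' \<le> h k" if k: "k \<in> idx K" for k
    proof -
      have "i' \<le> h k \<longleftrightarrow> Min S \<le> k" using False mono[OF mK(1) k] by (simp add: i'_def)
      moreover have "k \<in> S \<longleftrightarrow> Min S \<le> k" using k mK Min_le[OF fin] by (auto simp: S_def)
      ultimately show ?thesis by simp
    qed
    have "S = {k\<in>idx K. i' \<le> h k}" using S by (auto simp: S_def)
    moreover have "idx K' = h ` idx K" using h by (simp add: bij_betw_def)
    ultimately show ?thesis by (simp only:) auto
  qed
  have inj: "inj_on h S" using h by (auto simp: bij_betw_def S_def intro: inj_on_subset)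
  have i'n: "i' \<le> n"
  proof (cases "S = {}")
    case False
    then have "Min S \<in> S" using fin by simp
    then have "h (Min S) \<in> idx K'" by (intro h_idx) (simp add: S_def)
    then show ?thesis using False by (simp add: i'_def idx_def)
  qed (simp add: i'_def)
  have "e i \<bullet> v = e i' \<bullet> block_map K h v" if v: "v \<in> perp K" for v
  proof -
    have "e i' \<bullet> block_map K h v = (\<Sum>k\<in>{k\<in>idx K'. i' \<le> k}. a k \<bullet> block_map K h v)"
      unfolding e inner_sum_left
      using block_map_perp a_perp by (intro sum.mono_neutral_right) (auto simp: idx_def)
    also have "\<dots> = (\<Sum>k\<in>S. a (h k) \<bullet> block_map K h v)"
      unfolding h_img[symmetric] by (simp add: sum.reindex[OF inj])
    also have "\<dots> = (\<Sum>k\<in>S. a k \<bullet> v)" by (intro sum.cong refl a_block_map) (simp add: S_def)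
    also have "\<dots> = e i \<bullet> v" unfolding S_def by (rule e_restrict[OF v, symmetric])
    finally show ?thesis by simp
  qed
  then show ?thesis using i'n by blast
qed

lemma simple_map_b: "i < n \<Longrightarrow> simple_map h (b i) = b (h i)"
  by (simp add: simple_map_def b_inv)

text \<open>Both indices of a root are moved by \<open>e_block_map\<close> and the sign
  \<open>\<sigma>\<close> is kept, so the family of hyperplanes described by
  \<open>root_line\<close> and \<open>line_root\<close> is respected.\<close>

lemma restr_hom_block_map: "restr_hom K K' (block_map K h) (simple_map h)"
  unfolding restr_hom_def
proof (intro conjI ballI)
  show "linear (block_map K h)" by (rule linear_block_map)
  show "block_map K h ` perp K \<subseteq> perp K'" using block_map_perp by auto
next
  fix \<beta> assume "\<beta> \<in> \<Phi>"
  then obtain i j \<sigma> c where ij: "i \<le> n" "j \<le> n" "\<sigma> \<in> signs" "\<beta> = c *\<^sub>R (e i - \<sigma> *\<^sub>R e j)"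
    using root_line by blast
  obtain i' where i': "i' \<le> n" "\<forall>v\<in>perp K. e i \<bullet> v = e i' \<bullet> block_map K h v"
    using e_block_map[OF ij(1)] by blast
  obtain j' where j': "j' \<le> n" "\<forall>v\<in>perp K. e j \<bullet> v = e j' \<bullet> block_map K h v"
    using e_block_map[OF ij(2)] by blast
  have b: "\<beta> \<bullet> v = c * ((e i' - \<sigma> *\<^sub>R e j') \<bullet> block_map K h v)" if "v \<in> perp K" for v
    using ij i' j' that by (simp add: inner_diff_left)
  show "(\<forall>v\<in>perp K. \<beta> \<bullet> v = 0) \<or>
      (\<exists>\<beta>'\<in>\<Phi>. \<exists>c>0. \<forall>v\<in>perp K. \<beta> \<bullet> v = c * (\<beta>' \<bullet> block_map K h v))"
    using line_root[OF i'(1) j'(1) ij(3)]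
  proof
    assume "e i' - \<sigma> *\<^sub>R e j' = 0"
    then show ?thesis using b by simp
  next
    assume "\<exists>\<beta>\<in>\<Phi>. \<exists>c. e i' - \<sigma> *\<^sub>R e j' = c *\<^sub>R \<beta>"
    then obtain \<beta>' d where d: "\<beta>' \<in> \<Phi>" "e i' - \<sigma> *\<^sub>R e j' = d *\<^sub>R \<beta>'" by auto
    have bd: "\<beta> \<bullet> v = (c * d) * (\<beta>' \<bullet> block_map K h v)" if "v \<in> perp K" for v
      using b[OF that] d(2) by simp
    consider "c * d = 0" | "c * d > 0" | "- (c * d) > 0" by linarith
    then show ?thesis
    proof cases
      case 1
      then show ?thesis using bd by (intro disjI1) auto
    next
      case 2
      then show ?thesis using bd d(1) by blast
    next
      \<comment> \<open>\<open>restr_hom\<close> requires a positive factor, so the sign is absorbed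
        by the opposite root.\<close>
      case 3
      have "\<forall>v\<in>perp K. \<beta> \<bullet> v = - (c * d) * (- \<beta>' \<bullet> block_map K h v)" using bd by simp
      then show ?thesis using 3 uminus_Phi[OF d(1)] by blast
    qed
  qed
next
  fix \<alpha> assume al: "\<alpha> \<in> \<Delta> - K"
  then obtain i where i: "i < n" "\<alpha> = b i" using b_cases by blast
  then have iK: "i \<in> idx K" using al by (simp add: idx_def)
  have hi: "h i < n" "b (h i) \<notin> K'" using h_idx[OF iK] by (auto simp: idx_def)
  show "simple_map h \<alpha> \<in> \<Delta> - K'" using hi i b_Delta by (simp add: simple_map_b)
  have "\<alpha> \<bullet> v = s (h i) / s i * (simple_map h \<alpha> \<bullet> block_map K h v)" for v
    using a_block_map[OF iK, of v] i s_pos[of i] by (simp add: a simple_map_b field_simps)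
  moreover have "0 < s (h i) / s i" using s_pos by simp
  ultimately show "\<exists>c>0. \<forall>v\<in>perp K. \<alpha> \<bullet> v = c * (simple_map h \<alpha> \<bullet> block_map K h v)" by blast
qed

end

lemma eq_by_Delta:
  assumes "\<And>\<alpha>. \<alpha> \<in> \<Delta> \<Longrightarrow> \<alpha> \<bullet> u = \<alpha> \<bullet> v"
  shows "u = v"
proof -
  have "(u - v) \<bullet> (u - v) = 0"
    by (subst inner_expand) (rule sum.neutral, simp add: inner_diff_right assms)
  then show ?thesis by simp
qed

lemma block_map_inverse:
  assumes K: "K \<subseteq> \<Delta>" "K' \<subseteq> \<Delta>" and h: "bij_betw h (idx K) (idx K')" "bij_betw h' (idx K') (idx K)"
    and inv: "\<And>i. i \<in> idx K \<Longrightarrow> h' (h i) = i"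
    and mono: "\<And>i j. i \<in> idx K \<Longrightarrow> j \<in> idx K \<Longrightarrow> h i \<le> h j \<longleftrightarrow> i \<le> j"
      "\<And>i j. i \<in> idx K' \<Longrightarrow> j \<in> idx K' \<Longrightarrow> h' i \<le> h' j \<longleftrightarrow> i \<le> j"
    and v: "v \<in> perp K"
  shows "block_map K' h' (block_map K h v) = v"
proof (rule eq_by_Delta)
  fix \<alpha> assume "\<alpha> \<in> \<Delta>"
  then obtain i where i: "i < n" "\<alpha> = b i" using b_cases by blast
  have "a i \<bullet> block_map K' h' (block_map K h v) = a i \<bullet> v"
  proof (cases "b i \<in> K")
    case True
    then show ?thesis
      using a_perp[OF v True] a_perp[OF block_map_perp[OF K(2,1) h(2) mono(2)] True] by simp
  next
    case False
    then have iK: "i \<in> idx K" using i by (simp add: idx_def)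
    have hi: "h i \<in> idx K'" using h(1) iK bij_betwE by blast
    have "a (h' (h i)) \<bullet> block_map K' h' (block_map K h v) = a (h i) \<bullet> block_map K h v"
      by (rule a_block_map[OF K(2,1) h(2) mono(2) hi])
    also have "\<dots> = a i \<bullet> v" by (rule a_block_map[OF K h(1) mono(1) iK])
    finally show ?thesis by (simp add: inv[OF iK])
  qed
  then show "\<alpha> \<bullet> block_map K' h' (block_map K h v) = \<alpha> \<bullet> v"
    using i s_pos[of i] by (simp add: a)
qed

theorem chain_restr_iso:
  assumes K: "K \<subseteq> \<Delta>" "K' \<subseteq> \<Delta>" and card: "card K = card K'"
  shows "\<exists>\<phi> \<psi> \<pi> \<rho>. restr_iso K K' \<phi> \<psi> \<pi> \<rho>"
proof -
  have card_idx: "card (idx J) = n - card J" if "J \<subseteq> \<Delta>" for J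
  proof -
    have "b ` idx J = \<Delta> - J" using bij_b by (auto simp: idx_def bij_betw_def)
    moreover have "inj_on b (idx J)" using bij_b by (auto simp: idx_def bij_betw_def intro: inj_on_subset)
    ultimately have "card (idx J) = card (\<Delta> - J)" by (metis card_image)
    then show ?thesis using that finite_subset[OF that finite_Delta] by (simp add: card_Diff_subset)
  qed
  obtain h where h: "bij_betw h (idx K) (idx K')" "\<And>i j. i \<in> idx K \<Longrightarrow> j \<in> idx K \<Longrightarrow> h i \<le> h j \<longleftrightarrow> i \<le> j"
    using ex_order_iso[OF finite_idx finite_idx, of K K'] card_idx[OF K(1)] card_idx[OF K(2)] card by auto
  define h' where "h' = inv_into (idx K) h"
  have h'bij: "bij_betw h' (idx K') (idx K)" unfolding h'_def using h(1) by (rule bij_betw_inv_into)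
  have hh': "h' (h i) = i" if "i \<in> idx K" for i
    using h(1) that by (simp add: h'_def bij_betw_inv_into_left)
  have h'h: "h (h' i) = i" if "i \<in> idx K'" for i
    using h(1) that by (simp add: h'_def bij_betw_inv_into_right)
  have h'in: "h' i \<in> idx K" if "i \<in> idx K'" for i using h'bij that bij_betwE by blast
  have h'mono: "h' i \<le> h' j \<longleftrightarrow> i \<le> j" if "i \<in> idx K'" "j \<in> idx K'" for i j
    using h(2)[OF h'in h'in, of i j] that by (simp add: h'h)
  have simple: "simple_map g' (simple_map g \<alpha>) = \<alpha>"
    if al: "\<alpha> \<in> \<Delta> - I" and g: "bij_betw g (idx I) (idx I')" and inv: "\<And>i. i \<in> idx I \<Longrightarrow> g' (g i) = i"
    for g g' I I' \<alpha>
  proof -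
    obtain i where i: "i < n" "\<alpha> = b i" using b_cases al by blast
    then have iI: "i \<in> idx I" using al by (simp add: idx_def)
    then have "g i \<in> idx I'" using g bij_betwE by blast
    then have "g i < n" by (simp add: idx_def)
    then show ?thesis using i inv[OF iI] by (simp add: simple_map_def b_inv)
  qed
  have "restr_iso K K' (block_map K h) (block_map K' h') (simple_map h) (simple_map h')"
    unfolding restr_iso_def
    using restr_hom_block_map[OF K h] restr_hom_block_map[OF K(2,1) h'bij h'mono]
      block_map_inverse[OF K h(1) h'bij hh' h(2) h'mono]
      block_map_inverse[OF K(2,1) h'bij h(1) h'h h'mono h(2)]
      simple[OF _ h(1) hh'] simple[OF _ h'bij h'h]
    by blast
  then show ?thesis by blast
qed

theorem chain_restr_sum:
  assumes K: "K \<subseteq> \<Delta>"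
  shows "restr_sum x K = x ^ (DIM('a) - card K)"
proof (rule restr_sum_eq[OF K])
  fix I assume I: "I \<in> cls K"
  then have "I \<subseteq> \<Delta>" by (rule conj_class_subset)
  then show "restr_sum x I = restr_sum x K"
    using chain_restr_iso[OF _ K conj_class_card[OF I]] restr_iso_restr_sum K by blast
qed

end

section \<open>From the Coxeter matrix to inner products\<close>

lemma BijGroup_pow:
  assumes "bij f"
  shows "f [^]\<^bsub>BijGroup UNIV\<^esub> (k::nat) = f ^^ k"
proof -
  interpret G: group "BijGroup (UNIV :: 'a set)" by (rule group_BijGroup)
  show ?thesis
  proof (induction k)
    case 0
    show ?case using G.nat_pow_0[of f] by (simp only: BijGroup_UNIV_simps funpow.simps)
  next
    case (Suc k)
    have "bij (f ^^ k)" using assms by (rule bij_fn)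
    then show ?case
      using Suc G.nat_pow_Suc[of f k] assms by (simp only: BijGroup_UNIV_simps funpow_Suc_right)
  qed
qed

lemma BijGroup_ord:
  assumes "bij f"
  shows "f ^^ k = id \<longleftrightarrow> group.ord (BijGroup UNIV) f dvd k"
proof -
  interpret G: group "BijGroup (UNIV :: 'a set)" by (rule group_BijGroup)
  show ?thesis
    using G.pow_eq_id[of f k] assms by (simp only: BijGroup_pow BijGroup_UNIV_simps mem_Collect_eq)
qed

context based_roots
begin

text \<open>The reflected root is positive, and its coefficient at \<open>\<alpha>\<close> is a
  negative multiple of \<open>\<alpha> \<bullet> \<beta>\<close>.\<close>

lemma simple_obtuse:
  assumes "\<alpha> \<in> \<Delta>" "\<beta> \<in> \<Delta>" "\<alpha> \<noteq> \<beta>"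
  shows "\<alpha> \<bullet> \<beta> \<le> 0"
proof -
  have "pos (root_refl \<alpha> \<beta>)" using assms by (intro simple_refl_pos pos_simple) auto
  then have "0 \<le> root_refl \<alpha> \<beta> \<bullet> coweight \<alpha>" using assms by (simp add: pos_def)
  also have "root_refl \<alpha> \<beta> \<bullet> coweight \<alpha> = - (2 * (\<alpha> \<bullet> \<beta>) / (\<alpha> \<bullet> \<alpha>))"
    using assms by (simp add: root_refl_def inner_diff_left inner_coweight inner_commute[of \<beta> \<alpha>])
  finally have le: "2 * (\<alpha> \<bullet> \<beta>) / (\<alpha> \<bullet> \<alpha>) \<le> 0" by simp
  show ?thesis
  proof (rule ccontr)
    assume "\<not> \<alpha> \<bullet> \<beta> \<le> 0"
    then have "0 < 2 * (\<alpha> \<bullet> \<beta>) / (\<alpha> \<bullet> \<alpha>)"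
      using assms zero_notin_Delta by (intro divide_pos_pos) auto
    with le show False by simp
  qed
qed

text \<open>The product of the two reflections acts on the plane spanned by \<open>\<alpha>\<close> and \<open>\<beta>\<close> by an explicit
  matrix of determinant 1 and trace \<open>t - 2\<close>, where \<open>t\<close> is four times the squared cosine of the angle.\<close>

lemma coxeter_m_inner:
  assumes al: "\<alpha> \<in> \<Delta>" and be: "\<beta> \<in> \<Delta>" and ne: "\<alpha> \<noteq> \<beta>"
  shows "coxeter_m \<alpha> \<beta> = 2 \<Longrightarrow> \<alpha> \<bullet> \<beta> = 0"
    and "coxeter_m \<alpha> \<beta> = 3 \<Longrightarrow> 4 * (\<alpha> \<bullet> \<beta>)\<^sup>2 = (\<alpha> \<bullet> \<alpha>) * (\<beta> \<bullet> \<beta>)"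
    and "coxeter_m \<alpha> \<beta> = 4 \<Longrightarrow> 2 * (\<alpha> \<bullet> \<beta>)\<^sup>2 = (\<alpha> \<bullet> \<alpha>) * (\<beta> \<bullet> \<beta>)"
proof -
  define f where "f = root_refl \<alpha> \<circ> root_refl \<beta>"
  define a where "a = 2 * (\<alpha> \<bullet> \<beta>) / (\<beta> \<bullet> \<beta>)"
  define b where "b = 2 * (\<alpha> \<bullet> \<beta>) / (\<alpha> \<bullet> \<alpha>)"
  define t where "t = a * b"
  have A: "0 < \<alpha> \<bullet> \<alpha>" and B: "0 < \<beta> \<bullet> \<beta>" using al be zero_notin_Delta by auto
  have tt: "t * ((\<alpha> \<bullet> \<alpha>) * (\<beta> \<bullet> \<beta>)) = 4 * (\<alpha> \<bullet> \<beta>)\<^sup>2"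
    using A B by (simp add: t_def a_def b_def power2_eq_square)
  have bij: "bij f" unfolding f_def by (intro bij_comp root_refl_bij)
  have lin: "linear f" unfolding f_def by (intro linear_compose root_refl_linear)
  have r1: "root_refl \<beta> \<alpha> = \<alpha> - a *\<^sub>R \<beta>" "root_refl \<alpha> \<beta> = \<beta> - b *\<^sub>R \<alpha>"
    by (simp_all add: root_refl_def a_def b_def inner_commute[of \<beta> \<alpha>])
  have r2: "root_refl \<beta> \<beta> = - \<beta>" "root_refl \<alpha> \<alpha> = - \<alpha>"
    using al be zero_notin_Delta by (auto intro!: root_refl_self)
  have fa: "f \<alpha> = (t - 1) *\<^sub>R \<alpha> - a *\<^sub>R \<beta>"
    by (simp add: f_def r1 r2 linear_diff[OF root_refl_linear] linear_scale[OF root_refl_linear]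
        t_def algebra_simps)
  have fb: "f \<beta> = b *\<^sub>R \<alpha> - \<beta>"
    by (simp add: f_def r1 r2 linear_neg[OF root_refl_linear])
  have step: "f (x *\<^sub>R \<alpha> + y *\<^sub>R \<beta>) = (x * (t - 1) + y * b) *\<^sub>R \<alpha> + (- (x * a) - y) *\<^sub>R \<beta>" for x y
    by (simp add: linear_add[OF lin] linear_scale[OF lin] fa fb algebra_simps)
  have coeff: "x = 0 \<and> y = 1" if "x *\<^sub>R \<alpha> + y *\<^sub>R \<beta> = \<beta>" for x y
  proof -
    have "(x *\<^sub>R \<alpha> + y *\<^sub>R \<beta>) \<bullet> coweight \<alpha> = \<beta> \<bullet> coweight \<alpha>"
      "(x *\<^sub>R \<alpha> + y *\<^sub>R \<beta>) \<bullet> coweight \<beta> = \<beta> \<bullet> coweight \<beta>" using that by simp_all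
    then show ?thesis using al be ne by (simp add: inner_add_left inner_coweight)
  qed
  have f0: "\<beta> = 0 *\<^sub>R \<alpha> + 1 *\<^sub>R \<beta>" by simp
  \<comment> \<open>The coordinates of the second and third iterates of \<open>\<beta>\<close>,
    found by repeated use of \<open>step\<close>.\<close>
  define x2 y2 x3 y3 where "x2 = b * (t - 2)" and "y2 = 1 - t"
    and "x3 = b * (t - 1) * (t - 3)" and "y3 = 3 * t - t * t - 1"
  have f2: "(f ^^ 2) \<beta> = x2 *\<^sub>R \<alpha> + y2 *\<^sub>R \<beta>"
  proof -
    have "(f ^^ 2) \<beta> = f (b *\<^sub>R \<alpha> + (-1) *\<^sub>R \<beta>)" by (simp add: eval_nat_numeral fb)
    also have "\<dots> = x2 *\<^sub>R \<alpha> + y2 *\<^sub>R \<beta>"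
      unfolding step by (simp add: x2_def y2_def t_def algebra_simps)
    finally show ?thesis .
  qed
  have f3: "(f ^^ 3) \<beta> = x3 *\<^sub>R \<alpha> + y3 *\<^sub>R \<beta>"
  proof -
    have "(f ^^ 3) \<beta> = f ((f ^^ 2) \<beta>)" by (simp add: eval_nat_numeral)
    also have "\<dots> = (x2 * (t - 1) + y2 * b) *\<^sub>R \<alpha> + (- (x2 * a) - y2) *\<^sub>R \<beta>" unfolding f2 step ..
    also have "x2 * (t - 1) + y2 * b = x3" by (simp add: x2_def y2_def x3_def algebra_simps)
    also have "- (x2 * a) - y2 = y3" by (simp add: x2_def y2_def y3_def t_def algebra_simps)
    finally show ?thesis .
  qed
  have f4: "(f ^^ 4) \<beta> = (x3 * (t - 1) + y3 * b) *\<^sub>R \<alpha> + (- (x3 * a) - y3) *\<^sub>R \<beta>"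
  proof -
    have "(f ^^ 4) \<beta> = f ((f ^^ 3) \<beta>)" by (simp add: eval_nat_numeral)
    then show ?thesis unfolding f3 step .
  qed
  have pow: "(f ^^ k) \<beta> = \<beta>" if "coxeter_m \<alpha> \<beta> = k" for k
    using that BijGroup_ord[OF bij, of k] by (simp add: coxeter_m_def f_def)
  have b0: "t = 0" if "b = 0" using that by (simp add: t_def)
  have t0: "\<alpha> \<bullet> \<beta> = 0" if "t = 0" using tt that by simp
  show "\<alpha> \<bullet> \<beta> = 0" if "coxeter_m \<alpha> \<beta> = 2"
    using coeff[of x2 y2] pow[OF that] f2 t0 by (simp add: y2_def)
  show "4 * (\<alpha> \<bullet> \<beta>)\<^sup>2 = (\<alpha> \<bullet> \<alpha>) * (\<beta> \<bullet> \<beta>)" if "coxeter_m \<alpha> \<beta> = 3"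
  proof -
    have x3: "x3 = 0" and y3: "y3 = 1" using coeff[of x3 y3] pow[OF that] f3 by simp_all
    have "(t - 1) * (t - 2) = 0" using y3 by (simp add: y3_def algebra_simps)
    \<comment> \<open>The value 2 belongs to order 4; it would make \<open>x3\<close> equal to
      \<open>- b\<close>, which is then nonzero.\<close>
    moreover have "t \<noteq> 2" using x3 b0 by (auto simp: x3_def)
    ultimately have "t = 1" by simp
    then show ?thesis using tt by simp
  qed
  show "2 * (\<alpha> \<bullet> \<beta>)\<^sup>2 = (\<alpha> \<bullet> \<alpha>) * (\<beta> \<bullet> \<beta>)" if m: "coxeter_m \<alpha> \<beta> = 4"
  proof -
    have x4: "x3 * (t - 1) + y3 * b = 0" and y4: "- (x3 * a) - y3 = 1"
      using coeff[of "x3 * (t - 1) + y3 * b" "- (x3 * a) - y3"] pow[OF m] f4 by simp_all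
    have "- (x3 * a) - y3 - 1 = - t * (t - 2) * (t - 3)"
      by (simp add: x3_def y3_def t_def algebra_simps)
    then have y: "t * (t - 2) * (t - 3) = 0" using y4 by simp
    have x: "b * ((t - 2) * (t * t - 4 * t + 2)) = 0"
      using x4 by (simp add: x3_def y3_def algebra_simps)
    \<comment> \<open>The candidates 0, 2 and 3 belong to orders 2, 4 and 6. For 0 the reflections
      commute and the order divides 2.\<close>
    have "t \<noteq> 0"
    proof
      assume "t = 0"
      then have "\<alpha> \<bullet> \<beta> = 0" by (rule t0)
      then have refl: "root_refl \<alpha> \<beta> = \<beta>" "root_refl \<beta> \<alpha> = \<alpha>"
        by (simp_all add: root_refl_def inner_commute[of \<beta> \<alpha>])
      have "f (f v) = v" for v
      proof -
        have "root_refl \<alpha> (root_refl \<beta> u) = root_refl \<beta> (root_refl \<alpha> u)" for u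
          using root_refl_conj[OF root_refl_linear[of \<alpha>] root_refl_inner, of \<beta> u] refl by simp
        then show ?thesis by (simp add: f_def root_refl_idem)
      qed
      then have "f ^^ 2 = id" by (simp add: eval_nat_numeral fun_eq_iff)
      then have "4 dvd (2::nat)" using BijGroup_ord[OF bij, of 2] m by (simp add: coxeter_m_def f_def)
      then show False by simp
    qed
    \<comment> \<open>At 3 the \<open>\<alpha>\<close>-coordinate of the fourth iterate is
      \<open>- b\<close> and does not vanish.\<close>
    moreover have "t \<noteq> 3"
    proof
      assume "t = 3"
      then have "b = 0" using x by simp
      then show False using b0 \<open>t = 3\<close> by simp
    qed
    ultimately have "t = 2" using y by simp
    then show ?thesis using tt by simp
  qed
qed

text \<open>With the lengths normalized, the angle condition says that the inner product has square
  1; obtuseness selects the sign.\<close>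

lemma scaled_inner:
  assumes "\<alpha> \<in> \<Delta>" "\<beta> \<in> \<Delta>" "\<alpha> \<noteq> \<beta>" "c * (\<alpha> \<bullet> \<beta>)\<^sup>2 = (\<alpha> \<bullet> \<alpha>) * (\<beta> \<bullet> \<beta>)" "0 < p" "0 < q"
    and "(p *\<^sub>R \<alpha> \<bullet> p *\<^sub>R \<alpha>) * (q *\<^sub>R \<beta> \<bullet> q *\<^sub>R \<beta>) = c" "c \<noteq> 0"
  shows "p *\<^sub>R \<alpha> \<bullet> q *\<^sub>R \<beta> = -1"
proof -
  define r where "r = p *\<^sub>R \<alpha> \<bullet> q *\<^sub>R \<beta>"
  have "c * r\<^sup>2 = p * p * (q * q) * (c * (\<alpha> \<bullet> \<beta>)\<^sup>2)"
    by (simp add: r_def power2_eq_square algebra_simps)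
  also have "\<dots> = c" using assms(7) unfolding assms(4) by (simp add: algebra_simps)
  finally have "r\<^sup>2 = 1" using assms(8) by simp
  moreover have "r \<le> 0"
    using simple_obtuse[OF assms(1-3)] assms(5,6) by (simp add: r_def mult_le_0_iff)
  ultimately show ?thesis unfolding r_def[symmetric] by (auto simp: power2_eq_1_iff)
qed

end

text \<open>A tridiagonal Gram matrix common to both types. For \<open>l = 2\<close> the
  \<open>e i\<close> are the differences of the \<open>i\<close>-th and the last standard basis
  vector in the usual model of type A; for \<open>l = 1\<close> those with \<open>i < n\<close> form
  the orthonormal basis of the usual model of type B.\<close>

locale gram_roots = based_roots +
  fixes b :: "nat \<Rightarrow> 'a" and s :: "nat \<Rightarrow> real" and a e :: "nat \<Rightarrow> 'a" and l :: real
  assumes bij_b: "bij_betw b {..<card \<Delta>} \<Delta>" and s_pos: "\<And>i. 0 < s i"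
    and a: "a = (\<lambda>i. s i *\<^sub>R b i)" and e: "e = (\<lambda>i. sum a {i..<card \<Delta>})"
    and diag: "\<And>i. i < card \<Delta> \<Longrightarrow> a i \<bullet> a i = (if Suc i = card \<Delta> then l else 2)"
    and adj: "\<And>i. Suc i < card \<Delta> \<Longrightarrow> a i \<bullet> a (Suc i) = -1"
    and far: "\<And>i j. i < card \<Delta> \<Longrightarrow> j < card \<Delta> \<Longrightarrow> i \<noteq> j \<Longrightarrow> Suc i \<noteq> j \<Longrightarrow> Suc j \<noteq> i \<Longrightarrow> a i \<bullet> a j = 0"
    and l: "0 < l"
begin

lemma n_pos: "0 < n"
  by (simp add: card_Delta)

lemma refl_b: "root_refl (b k) = root_refl (a k)"
  using root_refl_scale[of "s k" "b k"] s_pos[of k] by (simp add: a)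

lemma e_n: "e n = 0"
  by (simp add: e)

lemma e_Suc: "i < n \<Longrightarrow> e i = a i + e (Suc i)"
  by (simp add: e sum.atLeast_Suc_lessThan)

lemma a_e: "i < n \<Longrightarrow> a i = e i - e (Suc i)"
  using e_Suc by simp

text \<open>The first summand is the orthonormal pattern, cut off at \<open>i = n\<close> because
  \<open>e n = 0\<close>. The second is the correction from the length of the last vector and
  vanishes for \<open>l = 1\<close>.\<close>

lemma e_a:
  assumes k: "k < n" and "i \<le> n"
  shows "e i \<bullet> a k = (if i = k then 1 else if i = Suc k \<and> i < n then -1 else 0)
    + (if Suc k = n \<and> i \<le> k then l - 1 else 0)"
  using assms(2)
proof (induction i rule: inc_induct)
  case base
  then show ?case using k by (simp add: e_n)
next
  case (step i)
  have i: "e i \<bullet> a k = a i \<bullet> a k + e (Suc i) \<bullet> a k" using step by (simp add: e_Suc inner_add_left)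
  consider "i = k" | "i = Suc k" | "Suc i = k" | "i \<noteq> k" "i \<noteq> Suc k" "Suc i \<noteq> k" by blast
  then show ?case
  proof cases
    case 1
    then show ?thesis using i step diag[of k] by auto
  next
    case 2
    then show ?thesis using i step adj[of k] by (auto simp: inner_commute)
  next
    case 3
    then show ?thesis using i step adj[of i] k by auto
  next
    case 4
    then show ?thesis using i step far[of i k] k by auto
  qed
qed

definition sw :: "nat \<Rightarrow> nat \<Rightarrow> nat"
  where "sw k i = (if i = k then Suc k else if i = Suc k then k else i)"

lemma sw_le: "k < n \<Longrightarrow> i \<le> n \<Longrightarrow> sw k i \<le> n"
  by (simp add: sw_def)

lemma refl_a: "k < n \<Longrightarrow> root_refl (a k) v = v - (2 * (v \<bullet> a k) / (if Suc k = n then l else 2)) *\<^sub>R a k"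
  by (simp add: root_refl_def diag)

lemma refl_e:
  assumes "Suc k < n" "i \<le> n"
  shows "root_refl (a k) (e i) = e (sw k i)"
  using assms e_a[of k i] refl_a[of k "e i"] a_e[of k] by (auto simp: sw_def)

text \<open>By \<open>Phi_conj_simple\<close> all roots arise from simple roots by simple
  reflections, so this is an induction over the orbit.\<close>

lemma Phi_induct:
  assumes b: "\<And>k. k < n \<Longrightarrow> P (b k)" and r: "\<And>k v. k < n \<Longrightarrow> P v \<Longrightarrow> P (root_refl (a k) v)"
    and "\<beta> \<in> \<Phi>"
  shows "P \<beta>"
proof -
  have D: "\<exists>k<n. \<alpha> = b k" if "\<alpha> \<in> \<Delta>" for \<alpha> using that bij_b by (auto simp: bij_betw_def)
  obtain w \<alpha> where w: "w \<in> refl_elems \<Delta>" "\<alpha> \<in> \<Delta>" "\<beta> = w \<alpha>"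
    using Phi_conj_simple[OF assms(3)] by blast
  obtain as where as: "set as \<subseteq> \<Delta>" "w = refl_word as" using w(1) by (auto simp: refl_elems_iff)
  have "P (refl_word as \<alpha>)" using as(1)
  proof (induction as)
    case Nil
    then show ?case using D[OF w(2)] b by auto
  next
    case (Cons \<gamma> as)
    then obtain k where "k < n" "\<gamma> = b k" using D[of \<gamma>] by auto
    then show ?case using Cons r by (simp add: refl_b)
  qed
  then show ?thesis using w as by simp
qed

text \<open>The alternative demanded by \<open>line_root\<close> in
  \<open>chain_roots\<close>.\<close>

definition on_line :: "'a \<Rightarrow> bool"
  where "on_line v \<longleftrightarrow> v = 0 \<or> (\<exists>\<beta>\<in>\<Phi>. \<exists>c. v = c *\<^sub>R \<beta>)"

lemma on_line_scale: "on_line v \<Longrightarrow> on_line (c *\<^sub>R v)"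
  unfolding on_line_def by (metis scaleR_scaleR scaleR_zero_right)

lemma on_line_minus: "on_line (u - v) \<Longrightarrow> on_line (v - u)"
  using on_line_scale[of "u - v" "-1"] by simp

lemma b_Phi: "i < n \<Longrightarrow> b i \<in> \<Phi>"
  using bij_b bij_betwE Delta_Phi by blast

lemma on_line_a: "i < n \<Longrightarrow> on_line (a i)"
  using b_Phi unfolding on_line_def a by blast

lemma on_line_refl:
  assumes "i < n" "on_line v"
  shows "on_line (root_refl (a i) v)"
  using assms(2) unfolding on_line_def
proof
  assume "\<exists>\<beta>\<in>\<Phi>. \<exists>c. v = c *\<^sub>R \<beta>"
  then obtain \<beta> c where b: "\<beta> \<in> \<Phi>" "v = c *\<^sub>R \<beta>" by auto
  have "root_refl (a i) v = c *\<^sub>R root_refl (b i) \<beta>"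
    by (simp add: b linear_scale[OF root_refl_linear] refl_b)
  then show "root_refl (a i) v = 0 \<or> (\<exists>\<beta>\<in>\<Phi>. \<exists>c. root_refl (a i) v = c *\<^sub>R \<beta>)"
    using root_refl_Phi[OF b_Phi[OF assms(1)] b(1)] by blast
qed (simp add: linear_0[OF root_refl_linear])

lemma refl_diff: "root_refl \<alpha> (u - c *\<^sub>R v) = root_refl \<alpha> u - c *\<^sub>R root_refl \<alpha> v"
  by (simp add: linear_diff[OF root_refl_linear] linear_scale[OF root_refl_linear])

lemma b_e: "k < n \<Longrightarrow> b k = (1 / s k) *\<^sub>R (e k - 1 *\<^sub>R e (Suc k))"
proof -
  assume k: "k < n"
  have "e k - 1 *\<^sub>R e (Suc k) = s k *\<^sub>R b k" using a_e[OF k] by (simp add: a)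
  then show ?thesis using s_pos[of k] by simp
qed

text \<open>Reflecting in \<open>a j\<close> turns \<open>e i - e j\<close> into
  \<open>e i - e (Suc j)\<close>. At the last vector this depends on \<open>l = 2\<close>; for
  \<open>l = 1\<close> that reflection gives \<open>e i + e j\<close>.\<close>

lemma on_line_diff_up:
  assumes "i < j" "j < n \<or> j = n \<and> l = 2"
  shows "on_line (e i - e j)"
  using assms
proof (induction j)
  case (Suc j)
  show ?case
  proof (cases "i = j")
    case True
    then show ?thesis using on_line_a[of i] a_e[of i] Suc by auto
  next
    case False
    then have ij: "i < j" using Suc.prems by simp
    have j: "j < n" using Suc.prems by auto
    have "on_line (root_refl (a j) (e i - e j))" using Suc.IH ij j by (intro on_line_refl) auto
    moreover have "root_refl (a j) (e i - e j) = e i - e (Suc j)"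
    proof (cases "Suc j = n")
      case True
      then have "l = 2" using Suc.prems by auto
      then have "(e i - e j) \<bullet> a j = -1"
        using e_a[OF j, of i] e_a[OF j, of j] ij j True by (simp add: inner_diff_left)
      then have "root_refl (a j) (e i - e j) = e i - e j + a j"
        using refl_a[OF j, of "e i - e j"] True \<open>l = 2\<close> by simp
      then show ?thesis by (simp add: a_e[OF j])
    next
      case False
      then have "Suc j < n" using j by simp
      then show ?thesis
        using refl_e[of j i] refl_e[of j j] ij by (simp add: linear_diff[OF root_refl_linear] sw_def)
    qed
    ultimately show ?thesis by simp
  qed
qed simp

text \<open>Each simple reflection permutes the \<open>e i\<close> by an adjacent transposition, up
  to a common translation that cancels in differences. The translation is nonzero only for the last
  reflection, which moves the base point of the coordinates.\<close>

lemma chain_type_A: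
  assumes l2: "l = 2"
  shows "chain_roots \<Phi> \<Delta> b s {1} a e"
proof unfold_locales
  fix \<beta> assume "\<beta> \<in> \<Phi>"
  then show "\<exists>i\<le>n. \<exists>j\<le>n. \<exists>\<sigma>\<in>{1}. \<exists>c. \<beta> = c *\<^sub>R (e i - \<sigma> *\<^sub>R e j)"
  proof (rule Phi_induct[rotated 2])
    fix k assume "k < n"
    then show "\<exists>i\<le>n. \<exists>j\<le>n. \<exists>\<sigma>\<in>{1}. \<exists>c. b k = c *\<^sub>R (e i - \<sigma> *\<^sub>R e j)"
      using b_e[of k] by (intro exI[of _ k] exI[of _ "Suc k"] conjI) auto
  next
    fix k v assume k: "k < n" and "\<exists>i\<le>n. \<exists>j\<le>n. \<exists>\<sigma>\<in>{1}. \<exists>c. v = c *\<^sub>R (e i - \<sigma> *\<^sub>R e j)"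
    then obtain i j c where ij: "i \<le> n" "j \<le> n" "v = c *\<^sub>R (e i - e j)" by auto
    have "\<exists>u. \<forall>i\<le>n. root_refl (a k) (e i) = e (sw k i) - u"
    proof (cases "Suc k = n")
      case True
      have "root_refl (a k) (e i) = e (sw k i) - a k" if i: "i \<le> n" for i
        using e_a[OF k i] refl_a[OF k, of "e i"] a_e[OF k] True l2 i e_n
        by (cases "i = k"; cases "i = n") (auto simp: sw_def scaleR_2)
      then show ?thesis by blast
    next
      case False
      then show ?thesis using refl_e[of k] k by (intro exI[of _ 0]) simp
    qed
    then obtain u where "\<forall>i\<le>n. root_refl (a k) (e i) = e (sw k i) - u" by blast
    then have "root_refl (a k) v = c *\<^sub>R (e (sw k i) - e (sw k j))"
      using ij by (simp add: linear_diff[OF root_refl_linear] linear_scale[OF root_refl_linear])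
    then show "\<exists>i\<le>n. \<exists>j\<le>n. \<exists>\<sigma>\<in>{1}. \<exists>c. root_refl (a k) v = c *\<^sub>R (e i - \<sigma> *\<^sub>R e j)"
      using sw_le[OF k ij(1)] sw_le[OF k ij(2)]
      by (intro exI[of _ "sw k i"] exI[of _ "sw k j"] conjI bexI[of _ 1] exI[of _ c]) auto
  qed
next
  fix i j :: nat and \<sigma> :: real assume ij: "i \<le> n" "j \<le> n" and \<sigma>: "\<sigma> \<in> {1}"
  have *: "on_line (e i - e j)" if "i < j" "j \<le> n" for i j
    using on_line_diff_up[of i j] that l2 by (cases "j = n") auto
  have "on_line (e i - e j)"
    using *[of i j] on_line_minus[OF *[of j i]] ij by (cases i j rule: linorder_cases) (auto simp: on_line_def)
  then show "e i - \<sigma> *\<^sub>R e j = 0 \<or> (\<exists>\<beta>\<in>\<Phi>. \<exists>c. e i - \<sigma> *\<^sub>R e j = c *\<^sub>R \<beta>)"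
    using \<sigma> by (simp add: on_line_def)
qed (use bij_b s_pos a e in auto)

text \<open>The last simple reflection changes the sign of \<open>e m\<close> and fixes the other
  \<open>e i\<close>, while the remaining ones transpose neighbours. This accounts for the two
  values of \<open>\<sigma>\<close>.\<close>

lemma chain_type_B:
  assumes l1: "l = 1"
  shows "chain_roots \<Phi> \<Delta> b s {1, -1} a e"
proof -
  define m where "m = n - 1"
  have m: "m < n" "Suc m = n" using n_pos by (auto simp: m_def)
  have last: "root_refl (a m) (e i) = (if i = m then - e i else e i)" if i: "i \<le> n" for i
    using e_a[OF m(1) i] refl_a[OF m(1), of "e i"] a_e[OF m(1)] m l1 e_n by (auto simp: scaleR_2)
  have single: "on_line (e i)" if "i \<le> n" for i
    using that
  proof (induction i rule: inc_induct)
    case base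
    show ?case by (simp add: e_n on_line_def)
  next
    case (step i)
    show ?case
    proof (cases "i = m")
      case True
      then show ?thesis using a_e[of i] on_line_a[of i] m e_n by auto
    next
      case False
      then have i: "Suc i < n" using step m by simp
      have "on_line (root_refl (a i) (e (Suc i)))" using step by (intro on_line_refl) auto
      then show ?thesis using refl_e[OF i, of "Suc i"] i by (simp add: sw_def)
    qed
  qed
  \<comment> \<open>Downward induction: the last reflection turns \<open>e i - e m\<close> into
    \<open>e i + e m\<close>, and the transpositions then lower the second index.\<close>
  have plus: "on_line (e i + e j)" if "i < j" "j \<le> m" for i j
    using that(2,1)
  proof (induction j rule: inc_induct)
    case base
    have "on_line (root_refl (a m) (e i - e m))"
      using base m on_line_diff_up[of i m] by (intro on_line_refl) auto
    then show ?case using last[of i] last[of m] base m by (simp add: linear_diff[OF root_refl_linear])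
  next
    case (step j)
    have j: "Suc j < n" using step m by simp
    have "on_line (root_refl (a j) (e i + e (Suc j)))" using step j by (intro on_line_refl) auto
    then show ?case
      using refl_e[OF j, of i] refl_e[OF j, of "Suc j"] j step.prems
      by (simp add: linear_add[OF root_refl_linear] sw_def)
  qed
  show ?thesis
  proof unfold_locales
    fix \<beta> assume "\<beta> \<in> \<Phi>"
    then show "\<exists>i\<le>n. \<exists>j\<le>n. \<exists>\<sigma>\<in>{1, -1}. \<exists>c. \<beta> = c *\<^sub>R (e i - \<sigma> *\<^sub>R e j)"
    proof (rule Phi_induct[rotated 2])
      fix k assume "k < n"
      then show "\<exists>i\<le>n. \<exists>j\<le>n. \<exists>\<sigma>\<in>{1, -1}. \<exists>c. b k = c *\<^sub>R (e i - \<sigma> *\<^sub>R e j)"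
        using b_e[of k] by (intro exI[of _ k] exI[of _ "Suc k"] conjI) auto
    next
      fix k v assume k: "k < n" and "\<exists>i\<le>n. \<exists>j\<le>n. \<exists>\<sigma>\<in>{1, -1}. \<exists>c. v = c *\<^sub>R (e i - \<sigma> *\<^sub>R e j)"
      then obtain i j \<sigma> c where ij: "i \<le> n" "j \<le> n" "\<sigma> \<in> {1, -1}" "v = c *\<^sub>R (e i - \<sigma> *\<^sub>R e j)" by blast
      have rv: "root_refl (a k) v = c *\<^sub>R (root_refl (a k) (e i) - \<sigma> *\<^sub>R root_refl (a k) (e j))"
        by (simp only: ij(4) linear_scale[OF root_refl_linear] refl_diff)
      show "\<exists>i\<le>n. \<exists>j\<le>n. \<exists>\<sigma>\<in>{1, -1}. \<exists>c. root_refl (a k) v = c *\<^sub>R (e i - \<sigma> *\<^sub>R e j)"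
      proof (cases "k = m")
        case False
        then have k': "Suc k < n" using k m by simp
        show ?thesis
          using rv refl_e[OF k' ij(1)] refl_e[OF k' ij(2)] sw_le[OF k ij(1)] sw_le[OF k ij(2)] ij(3) by metis
      next
        case True
        define \<epsilon> :: "nat \<Rightarrow> real" where "\<epsilon> i = (if i = m then -1 else 1)" for i
        have "root_refl (a k) (e i) = \<epsilon> i *\<^sub>R e i" if "i \<le> n" for i
          using last[OF that] True by (simp add: \<epsilon>_def)
        then have "root_refl (a k) v = c *\<^sub>R (\<epsilon> i *\<^sub>R e i - \<sigma> *\<^sub>R \<epsilon> j *\<^sub>R e j)" using rv ij by simp
        also have "\<dots> = (c * \<epsilon> i) *\<^sub>R (e i - (\<sigma> * \<epsilon> i * \<epsilon> j) *\<^sub>R e j)"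
          by (simp add: \<epsilon>_def algebra_simps)
        finally have "root_refl (a k) v = (c * \<epsilon> i) *\<^sub>R (e i - (\<sigma> * \<epsilon> i * \<epsilon> j) *\<^sub>R e j)" .
        moreover have "\<sigma> * \<epsilon> i * \<epsilon> j \<in> {1, -1}" using ij(3) by (auto simp: \<epsilon>_def)
        ultimately show ?thesis using ij(1,2) by blast
      qed
    qed
  next
    fix i j :: nat and \<sigma> :: real assume ij: "i \<le> n" "j \<le> n" and \<sigma>: "\<sigma> \<in> {1, -1}"
    have minus: "on_line (e i - e j)" if "i < j" "j \<le> n" for i j
      using on_line_diff_up[of i j] single[of i] that e_n by (cases "j = n") auto
    have plus': "on_line (e i + e j)" if "i < j" "j \<le> n" for i j
      using plus[of i j] single[of i] that e_n m by (cases "j = n") auto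
    have "on_line (e i - e j)"
      using minus[of i j] on_line_minus[OF minus[of j i]] ij
      by (cases i j rule: linorder_cases) (auto simp: on_line_def)
    moreover have "on_line (e i + e j)"
    proof (cases i j rule: linorder_cases)
      case equal
      then show ?thesis using on_line_scale[OF single[OF ij(1)], of 2] by (simp add: scaleR_2)
    next
      case greater
      then show ?thesis using plus'[of j i] ij by (simp add: add.commute)
    qed (use plus' ij in auto)
    ultimately have "on_line (e i - \<sigma> *\<^sub>R e j)" using \<sigma> by auto
    then show "e i - \<sigma> *\<^sub>R e j = 0 \<or> (\<exists>\<beta>\<in>\<Phi>. \<exists>c. e i - \<sigma> *\<^sub>R e j = c *\<^sub>R \<beta>)"
      unfolding on_line_def .
  qed (use bij_b s_pos a e in auto)
qed


end

section \<open>The identities in types A and B\<close>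

context based_roots
begin

lemma gram_roots_exist:
  fixes l :: real
  assumes l: "l = 2 \<or> l = 1" and bij: "bij_betw b {..<card \<Delta>} \<Delta>"
    and adj: "\<And>i. Suc i < card \<Delta> \<Longrightarrow>
      coxeter_m (b i) (b (Suc i)) = (if Suc (Suc i) = card \<Delta> \<and> l = 1 then 4 else 3)"
    and far: "\<And>i j. i < card \<Delta> \<Longrightarrow> j < card \<Delta> \<Longrightarrow> i \<noteq> j \<Longrightarrow> Suc i \<noteq> j \<Longrightarrow> Suc j \<noteq> i \<Longrightarrow>
      coxeter_m (b i) (b j) = 2"
  shows "\<exists>s a e. gram_roots \<Phi> \<Delta> b s a e l"
proof -
  let ?n = "card \<Delta>"
  define N where "N i = (if Suc i = ?n then l else 2)" for i
  \<comment> \<open>Scales \<open>b i\<close> to squared length \<open>N i\<close>. The value 1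
    outside the range reflects that the locale asks for positivity at every index.\<close>
  define s where "s i = (if i < ?n then sqrt (N i) / norm (b i) else 1)" for i
  define a where "a i = s i *\<^sub>R b i" for i
  have bD: "b i \<in> \<Delta>" if "i < ?n" for i using bij that bij_betwE by blast
  have bne: "b i \<noteq> b j" if "i < ?n" "j < ?n" "i \<noteq> j" for i j
    using bij that by (auto simp: bij_betw_def inj_on_eq_iff)
  have norm: "0 < norm (b i)" if "i < ?n" for i using bD[OF that] zero_notin_Delta by auto
  have N: "0 < N i" for i using l by (auto simp: N_def)
  have s: "0 < s i" for i using norm N by (auto simp: s_def)
  have diag: "a i \<bullet> a i = N i" if "i < ?n" for i
  proof -
    have "a i \<bullet> a i = (s i * norm (b i))\<^sup>2"
      by (simp add: a_def power_mult_distrib dot_square_norm power2_eq_square)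
    also have "s i * norm (b i) = sqrt (N i)" using norm[OF that] that by (simp add: s_def)
    finally show ?thesis using N[of i] by simp
  qed
  have "a i \<bullet> a (Suc i) = -1" if i: "Suc i < ?n" for i
  proof -
    \<comment> \<open>The constant plays two parts: it is the product of the squared lengths of the
      scaled neighbours and the factor in the angle identity of \<open>coxeter_m_inner\<close> for
      order 4 or 3.\<close>
    define c :: real where "c = (if Suc (Suc i) = ?n \<and> l = 1 then 2 else 4)"
    note D = bD[of i] bD[OF i] bne[of i "Suc i"]
    have "c * (b i \<bullet> b (Suc i))\<^sup>2 = (b i \<bullet> b i) * (b (Suc i) \<bullet> b (Suc i))"
      using coxeter_m_inner(2,3)[of "b i" "b (Suc i)"] adj[OF i] D i by (auto simp: c_def)
    moreover have "(a i \<bullet> a i) * (a (Suc i) \<bullet> a (Suc i)) = c"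
      using diag[of i] diag[OF i] i l by (auto simp: N_def c_def)
    ultimately show ?thesis
      using scaled_inner[of "b i" "b (Suc i)" c "s i" "s (Suc i)"] D i s
      unfolding a_def by (auto simp: c_def)
  qed
  moreover have "a i \<bullet> a j = 0"
    if "i < ?n" "j < ?n" "i \<noteq> j" "Suc i \<noteq> j" "Suc j \<noteq> i" for i j
    using coxeter_m_inner(1)[OF bD bD bne] far that by (simp add: a_def)
  moreover have "a = (\<lambda>i. s i *\<^sub>R b i)" by (simp add: a_def fun_eq_iff)
  ultimately have "gram_roots \<Phi> \<Delta> b s a (\<lambda>i. sum a {i..<?n}) l"
    using bij s diag l by unfold_locales (auto simp: N_def)
  then show ?thesis by blast
qed

lemma restr_sum_type_A:
  assumes "type_A \<Delta>" "K \<subseteq> \<Delta>"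
  shows "restr_sum x K = x ^ (DIM('a) - card K)"
proof -
  obtain b where b: "bij_betw b {..<card \<Delta>} \<Delta>"
    "\<forall>i<card \<Delta>. \<forall>j<card \<Delta>. coxeter_m (b i) (b j) = matrix_A i j"
    using assms(1) by (auto simp: type_A_def has_coxeter_matrix_def)
  obtain s a e where "gram_roots \<Phi> \<Delta> b s a e 2"
    using gram_roots_exist[of 2 b] b by (auto simp: matrix_A_def)
  then interpret gram_roots \<Phi> \<Delta> b s a e 2 .
  interpret chain_roots \<Phi> \<Delta> b s "{1}" a e by (rule chain_type_A) simp
  show ?thesis by (rule chain_restr_sum[OF assms(2)])
qed

lemma restr_sum_type_B:
  assumes "type_B \<Delta>" "K \<subseteq> \<Delta>"
  shows "restr_sum x K = x ^ (DIM('a) - card K)"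
proof -
  obtain b where b: "bij_betw b {..<card \<Delta>} \<Delta>" and n: "2 \<le> card \<Delta>"
    and m: "\<And>i j. i < card \<Delta> \<Longrightarrow> j < card \<Delta> \<Longrightarrow> coxeter_m (b i) (b j) = matrix_BC (card \<Delta>) i j"
    using assms(1) by (auto simp: type_B_def has_coxeter_matrix_def)
  have "coxeter_m (b i) (b (Suc i)) = (if Suc (Suc i) = card \<Delta> \<and> 1 = (1::real) then 4 else 3)"
    if "Suc i < card \<Delta>" for i
    using m[of i "Suc i"] that n by (auto simp: matrix_BC_def matrix_A_def doubleton_eq_iff)
  moreover have "coxeter_m (b i) (b j) = 2"
    if "i < card \<Delta>" "j < card \<Delta>" "i \<noteq> j" "Suc i \<noteq> j" "Suc j \<noteq> i" for i j
    using m[of i j] that n by (auto simp: matrix_BC_def matrix_A_def doubleton_eq_iff)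
  ultimately obtain s a e where "gram_roots \<Phi> \<Delta> b s a e 1"
    using gram_roots_exist[of 1 b] b by auto
  then interpret gram_roots \<Phi> \<Delta> b s a e 1 .
  interpret chain_roots \<Phi> \<Delta> b s "{1, -1}" a e by (rule chain_type_B) simp
  show ?thesis by (rule chain_restr_sum[OF assms(2)])
qed

end

theorem theorem3:
  fixes \<Phi> \<Delta> :: "'a::euclidean_space set" and x :: real
  assumes "root_system \<Phi>" and "root_base \<Phi> \<Delta>" and "irreducible_base \<Delta>"
    and "type_A \<Delta> \<or> type_B \<Delta> \<or> type_C \<Delta> \<or> type_H3 \<Delta> \<or> DIM('a) = 2"
    and "x \<noteq> 0"
  shows "\<forall>w \<in> carrier (refl_group \<Phi>). H_measure \<Phi> \<Delta> x w = M_measure \<Phi> \<Delta> x w"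
proof -
  interpret based_roots \<Phi> \<Delta> using assms by unfold_locales
  have "restr_sum x K = x ^ (DIM('a) - card K)" if K: "K \<subseteq> \<Delta>" for K
  proof -
    from assms(4) consider "type_A \<Delta>" | "type_B \<Delta>" | "type_C \<Delta>" | "type_H3 \<Delta>" | "DIM('a) = 2"
      by blast
    then show ?thesis
    proof cases
      case 3
      then have "type_B \<Delta>" by (simp add: type_B_def type_C_def)
      then show ?thesis using K by (rule restr_sum_type_B)
    next
      case 4
      then have "DIM('a) = 3" by (simp add: type_H3_def card_Delta)
      then show ?thesis using K by (intro restr_sum_small_rank) auto
    qed (use K restr_sum_type_A restr_sum_type_B restr_sum_small_rank in auto)
  qed
  then show ?thesis using H_eq_M[OF assms(5)] by blast
qed

end
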